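(* There is a constant $C$ such that for every positive integer $n$, $$|Forb(n,F_5)| < \left(1+2^{Cn-\frac{2n^2}{45}}\right) T(n).$$ In particular, almost all $F_5$-free $3$-graphs on $[n]$ are $3$-partite.
   Context: A $3$-graph (triple system) on $[n]=\{1,\dots,n\}$ is a set of $3$-element subsets (edges) of $[n]$. Let $F_5$ be the $3$-graph with edges $\{1,2,3\},\{1,2,4\},\{3,4,5\}$. $Forb(n,F_5)$ denotes the set of (labeled) $3$-graphs on vertex set $[n]$ containing no copy of $F_5$ as a (not necessarily induced) subhypergraph. A $3$-graph is $3$-partite (tripartite) if its vertex set has a partition into three parts such that every edge has exactly one vertex in each part. $T(n)$ denotes the number of $3$-partite $3$-graphs on vertex set $[n]$. *)

theory Defs
  imports Complex_Main
begin

definition three_graphs :: "nat \<Rightarrow> nat set set set" where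
  "three_graphs n = {H. \<forall>e\<in>H. e \<subseteq> {1..n} \<and> card e = 3}"

definition F5 :: "nat set set" where
  "F5 = {{1, 2, 3}, {1, 2, 4}, {3, 4, 5}}"

(* A hypergraph is given by its edge set.  F is assumed to have no isolated
   vertices (as is the case for F5), so that its vertex set is \<Union>F. *)
definition contains_copy :: "'a set set \<Rightarrow> 'b set set \<Rightarrow> bool" where
  "contains_copy H F \<longleftrightarrow> (\<exists>f. inj_on f (\<Union>F) \<and> (\<forall>e\<in>F. f ` e \<in> H))"

definition Forb :: "nat \<Rightarrow> nat set set \<Rightarrow> nat set set set" where
  "Forb n F = {H \<in> three_graphs n. \<not> contains_copy H F}"

(* The parts may be empty; otherwise nothing on fewer than three vertices
   would be tripartite. *)
definition tripartite :: "'a set \<Rightarrow> 'a set set \<Rightarrow> bool" where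
  "tripartite V H \<longleftrightarrow>
    (\<exists>X Y Z. X \<union> Y \<union> Z = V \<and> X \<inter> Y = {} \<and> X \<inter> Z = {} \<and> Y \<inter> Z = {} \<and>
      (\<forall>e\<in>H. card (e \<inter> X) = 1 \<and> card (e \<inter> Y) = 1 \<and> card (e \<inter> Z) = 1))"

definition T :: "nat \<Rightarrow> nat" where
  "T n = card {H \<in> three_graphs n. tripartite {1..n} H}"

end

theory Submission
  imports Defs "HOL-Library.FuncSet" "HOL-Real_Asymp.Real_Asymp"
begin

text \<open>Neither a regularity lemma nor a general container theorem is needed, because graph-sized
  information is negligible on the scale of \<open>n ^ 3\<close>. Let \<open>P\<close> consist of the pairs of codegree at
  least 3 in an \<open>F5\<close>-free system \<open>H\<close>. All codegree neighbourhoods of \<open>H\<close> are independent in \<open>P\<close>, so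
  \<open>P\<close> together with a bounded fingerprint for each pair determines a container of \<open>H\<close> whose codegree
  neighbourhoods are sparse in \<open>P\<close>. To such containers the Keevash--Mubayi argument for
  cancellative systems applies: they have at most about \<open>n ^ 3 / 27\<close> triples, and nearly that many
  only if they are nearly tripartite. Hence all but \<open>2 powr (n ^ 3 / 27 - \<delta> * n ^ 3)\<close> of the \<open>F5\<close>-free
  systems are nearly tripartite, with dense crossing triples.

  In such a system every vertex link lies, up to a few pairs, between two of the three classes. If the
  system is not tripartite, it has an edge \<open>{y, z, x}\<close> for which the links of \<open>y\<close> and \<open>z\<close> lie between
  the same two classes, and the two links can only meet in pairs containing \<open>x\<close>. There are about
  \<open>3 powr (n ^ 2 / 9)\<close> choices for such a pair of links, against \<open>2 powr (2 * n ^ 2 / 9)\<close> ways to extend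
  a tripartite system by two vertices, and the theorem follows by induction from \<open>n - 2\<close> to \<open>n\<close>.\<close>

section \<open>Counting\<close>

text \<open>Deleting a single vertex would gain nothing: its link has about
  \<open>2 powr (n ^ 2 / 9)\<close> choices, as many as in a tripartite system. The gain comes from
  two vertices of one edge whose links compete for the same pairs, since each such pair then has
  three states instead of four. As \<open>log 2 3 < 8 / 5\<close> is strict, a quadratic margin is
  left over, and all errors (exceptional link pairs, imbalance of the classes, linear terms) are
  made small against it.

  No optimal partition is chosen. A colouring with few non-crossing triples serves only as a frame
  of reference: each vertex is recoloured by the class that its link nearly avoids, and a system is
  tripartite as soon as all its triples are crossing for the new colouring. So failing to be
  tripartite yields the required edge at once.

  The tolerances form a hierarchy: a density guaranteed at one scale becomes the size threshold at
  the next, and the distance to the reference colouring comes last. For this reason the counting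
  lemmas are uniform in the parameters that are chosen later.\<close>

definition triples :: "nat \<Rightarrow> nat set set" where
  "triples n = {e. e \<subseteq> {1..n} \<and> card e = 3}"

definition pairs :: "nat \<Rightarrow> nat set set" where
  "pairs n = {p. p \<subseteq> {1..n} \<and> card p = 2}"

lemma three_graphs_eq: "three_graphs n = Pow (triples n)"
  by (auto simp: three_graphs_def triples_def)

lemma finite_triples [simp]: "finite (triples n)"
  unfolding triples_def by (rule finite_subset[of _ "Pow {1..n}"]) auto

lemma finite_pairs [simp]: "finite (pairs n)"
  unfolding pairs_def by (rule finite_subset[of _ "Pow {1..n}"]) auto

lemma card_triples_le: "real (card (triples n)) \<le> real n ^ 3"
proof -
  have "card (triples n) = n choose 3"
    unfolding triples_def using n_subsets[of "{1..n}" 3] by simp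
  also have "\<dots> \<le> n ^ 3"
    by (cases "3 \<le> n") (auto intro: binomial_le_pow simp: binomial_eq_0)
  finally show ?thesis
    by (metis of_nat_le_iff of_nat_power)
qed

lemma card_pairs_le: "real (card (pairs n)) \<le> real n ^ 2"
proof -
  have "card (pairs n) = n choose 2"
    unfolding pairs_def using n_subsets[of "{1..n}" 2] by simp
  also have "\<dots> \<le> n ^ 2"
    by (cases "2 \<le> n") (auto intro: binomial_le_pow simp: binomial_eq_0)
  finally show ?thesis
    by (metis of_nat_le_iff of_nat_power)
qed

lemma card_eq_3D:
  assumes "card {a, b, c} = 3" shows "a \<noteq> b" "a \<noteq> c" "b \<noteq> c"
  using assms by (auto simp: card_insert_if split: if_splits)

lemma F5_freeD:
  fixes H :: "'a set set"
  assumes "\<not> contains_copy H F5" and unif: "\<And>e. e \<in> H \<Longrightarrow> card e = 3"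
    and e: "{a, b, x} \<in> H" "{a, b, y} \<in> H" "{x, y, z} \<in> H" and "x \<noteq> y" "z \<noteq> a" "z \<noteq> b"
  shows False
proof -
  define f :: "nat \<Rightarrow> 'a" where
    "f k = (if k = 1 then a else if k = 2 then b else if k = 3 then x else if k = 4 then y else z)" for k
  have *: "a \<noteq> b" "a \<noteq> x" "b \<noteq> x" "a \<noteq> y" "b \<noteq> y" "x \<noteq> z" "y \<noteq> z"
    using card_eq_3D[OF unif[OF e(1)]] card_eq_3D[OF unif[OF e(2)]] card_eq_3D[OF unif[OF e(3)]] by auto
  have "\<Union>F5 = {1, 2, 3, 4, 5}" by (auto simp: F5_def)
  moreover have "inj_on f {1, 2, 3, 4, 5}"
    using * assms(6-8) by (auto simp: f_def inj_on_def)
  moreover have "f ` {1, 2, 3} = {a, b, x}" "f ` {1, 2, 4} = {a, b, y}" "f ` {3, 4, 5} = {x, y, z}"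
    by (auto simp: f_def)
  ultimately have "contains_copy H F5"
    unfolding contains_copy_def using e by (intro exI[of _ f]) (auto simp: F5_def simp del: image_insert)
  with assms(1) show False by simp
qed

section \<open>Numbers of small subsets, and the basic counting scheme\<close>

lemma sum_power_card_Pow:
  fixes x :: real
  assumes "finite S" shows "(\<Sum>A\<in>Pow S. x ^ card A) = (1 + x) ^ card S"
  using assms
proof (induction S)
  case (insert s S)
  have inj: "inj_on (insert s) (Pow S)"
    using insert.hyps by (auto simp: inj_on_def)
  have "(\<Sum>A\<in>Pow (insert s S). x ^ card A)
      = (\<Sum>A\<in>Pow S. x ^ card A) + (\<Sum>A\<in>insert s ` Pow S. x ^ card A)"
    unfolding Pow_insert using insert.hyps by (intro sum.union_disjoint) auto
  also have "(\<Sum>A\<in>insert s ` Pow S. x ^ card A) = (\<Sum>A\<in>Pow S. x * x ^ card A)"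
    unfolding sum.reindex[OF inj] o_def
  proof (rule sum.cong)
    fix A assume "A \<in> Pow S"
    then have "finite A" "s \<notin> A" using insert.hyps finite_subset by auto
    then show "x ^ card (insert s A) = x * x ^ card A" by simp
  qed simp
  finally show ?case
    using insert by (simp add: sum_distrib_left[symmetric] algebra_simps)
qed simp

definition small_subsets :: "'a set \<Rightarrow> real \<Rightarrow> 'a set set" where
  "small_subsets S k = {A. A \<subseteq> S \<and> real (card A) \<le> k}"

lemma finite_small_subsets [simp]: "finite S \<Longrightarrow> finite (small_subsets S k)"
  unfolding small_subsets_def by (rule finite_subset[of _ "Pow S"]) auto

text \<open>Exponential Markov inequality: with weight \<open>x\<close> per element every small set
  weighs at least \<open>x powr (\<eta> * M)\<close>, while all subsets together weigh
  \<open>(1 + x) ^ card S\<close>. It makes small error sets negligible on the exponential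
  scale.\<close>

lemma card_small_subsets_le:
  assumes "\<epsilon> > 0"
  shows "\<exists>\<eta> > 0. \<forall>(S :: 'a set) M. finite S \<longrightarrow> real (card S) \<le> M \<longrightarrow>
    real (card (small_subsets S (\<eta> * M))) \<le> 2 powr (\<epsilon> * M)"
proof -
  \<comment> \<open>Half of \<open>\<epsilon>\<close> pays for \<open>(1 + x) ^ card S\<close>, the
    other half for dividing by \<open>x powr (\<eta> * M)\<close>. Adding 1 to \<open>L\<close>
    keeps the denominator positive when \<open>x = 1\<close>.\<close>
  define x where "x = min 1 (\<epsilon> / 4)"
  define L where "L = log 2 (1 / x)"
  define \<eta> where "\<eta> = \<epsilon> / (2 * (L + 1))"
  have x: "0 < x" "x \<le> 1" "2 * x \<le> \<epsilon> / 2" using assms by (auto simp: x_def)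
  have L: "L \<ge> 0" using x by (simp add: L_def)
  have \<eta>: "\<eta> > 0" using L assms by (simp add: \<eta>_def)
  have \<eta>L: "\<eta> * L \<le> \<epsilon> / 2"
    using L assms by (simp add: \<eta>_def field_simps)
  have xpow: "x powr t = 2 powr (- (L * t))" for t
    using x by (simp add: L_def powr_def log_def ln_div field_simps)
  show ?thesis
  proof (intro exI[of _ \<eta>] conjI allI impI \<eta>)
    fix S :: "'a set" and M assume S: "finite S" "real (card S) \<le> M"
    let ?F = "small_subsets S (\<eta> * M)"
    have M: "M \<ge> 0" using S(2) of_nat_0_le_iff order_trans by blast
    have "real (card ?F) * x powr (\<eta> * M) = (\<Sum>A\<in>?F. x powr (\<eta> * M))" by simp
    also have "\<dots> \<le> (\<Sum>A\<in>?F. x ^ card A)"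
    proof (rule sum_mono)
      fix A assume "A \<in> ?F"
      then have "real (card A) \<le> \<eta> * M" by (simp add: small_subsets_def)
      then have "x powr (\<eta> * M) \<le> x powr real (card A)"
        using x by (intro powr_mono') auto
      then show "x powr (\<eta> * M) \<le> x ^ card A" using x by (simp add: powr_realpow)
    qed
    also have "\<dots> \<le> (\<Sum>A\<in>Pow S. x ^ card A)"
      using S x by (intro sum_mono2) (auto simp: small_subsets_def)
    also have "\<dots> = (1 + x) ^ card S" by (rule sum_power_card_Pow[OF S(1)])
    also have "\<dots> \<le> exp x ^ card S"
      using x exp_ge_add_one_self[of x] by (intro power_mono) auto
    also have "\<dots> = exp (real (card S) * x)" by (simp add: exp_of_nat_mult)
    also have "\<dots> \<le> exp (M * x)" using S x by (simp add: mult_right_mono)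
    \<comment> \<open>Changing the base from \<open>exp 1\<close> to 2 costs a factor 2 in the
      exponent, because \<open>exp 1 \<le> 4\<close>.\<close>
    also have "\<dots> \<le> exp (M * x * (2 * ln 2))"
    proof -
      have "exp 1 \<le> (2::real) ^ 2" using exp_le by simp
      then have "1 \<le> ln ((2::real) ^ 2)" by (subst ln_ge_iff) auto
      then have "1 \<le> 2 * ln (2::real)" by (subst (asm) ln_realpow) auto
      then have "M * x * 1 \<le> M * x * (2 * ln 2)" using M x by (intro mult_left_mono) auto
      then show ?thesis by simp
    qed
    also have "\<dots> = 2 powr (2 * x * M)" by (simp add: powr_def algebra_simps)
    finally have "real (card ?F) * 2 powr (- (L * (\<eta> * M))) \<le> 2 powr (2 * x * M)"
      by (simp add: xpow)
    then have "real (card ?F) \<le> 2 powr (2 * x * M) * 2 powr (L * (\<eta> * M))"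
      by (simp add: powr_minus field_simps)
    also have "\<dots> = 2 powr ((2 * x + \<eta> * L) * M)" by (simp add: powr_add[symmetric] algebra_simps)
    also have "\<dots> \<le> 2 powr (\<epsilon> * M)"
      using x \<eta>L M by (intro powr_mono mult_right_mono) auto
    finally show "real (card ?F) \<le> 2 powr (\<epsilon> * M)" .
  qed
qed

text \<open>The common scheme for counting rare families: \<open>H\<close> is recovered from the
  index \<open>j\<close>, its trace on the container \<open>A j\<close> and the few triples
  outside.\<close>

lemma card_cover_le:
  assumes "finite J" "finite S"
    and F: "\<And>H. H \<in> F \<Longrightarrow> H \<subseteq> S \<and> (\<exists>j\<in>J. real (card (H - A j)) \<le> k)"
    and A: "\<And>j. j \<in> J \<Longrightarrow> finite (A j) \<and> real (card (A j)) \<le> m"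
  shows "real (card F) \<le> real (card J) * 2 powr m * real (card (small_subsets S k))"
proof -
  define D where "D = small_subsets S k"
  define X where "X = (SIGMA j:J. Pow (A j) \<times> D)"
  have fD: "finite D" using assms(2) by (simp add: D_def)
  have fX: "finite X" using assms fD A by (auto simp: X_def intro!: finite_SigmaI)
  have "F \<subseteq> (\<lambda>(j, Y, Z). Y \<union> Z) ` X"
  proof
    fix H assume "H \<in> F"
    then obtain j where j: "H \<subseteq> S" "j \<in> J" "real (card (H - A j)) \<le> k" using F by blast
    then have "(j, H \<inter> A j, H - A j) \<in> X" by (auto simp: X_def D_def small_subsets_def)
    moreover have "H = (\<lambda>(j, Y, Z). Y \<union> Z) (j, H \<inter> A j, H - A j)" by auto
    ultimately show "H \<in> (\<lambda>(j, Y, Z). Y \<union> Z) ` X" by (rule rev_image_eqI)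
  qed
  then have "card F \<le> card X" by (meson card_image_le card_mono fX finite_imageI order_trans)
  then have "real (card F) \<le> real (card X)" by simp
  also have "\<dots> = (\<Sum>j\<in>J. 2 ^ card (A j) * real (card D))"
    unfolding X_def using assms fD A by (subst card_SigmaI) (auto simp: card_cartesian_product card_Pow)
  also have "\<dots> \<le> (\<Sum>j\<in>J. 2 powr m * real (card D))"
    using A by (intro sum_mono mult_right_mono) (auto simp: powr_realpow[symmetric] intro!: powr_mono)
  finally show ?thesis by (simp add: D_def mult_ac)
qed

section \<open>Containers\<close>

definition nb :: "'a set set \<Rightarrow> 'a \<Rightarrow> 'a \<Rightarrow> 'a set" where
  "nb H a b = {c. {a, b, c} \<in> H}"

text \<open>A greedy choice, phrased as a maximal set. As long as some \<open>v\<close> in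
  \<open>I\<close> has \<open>t\<close> neighbours not yet hit, adding it keeps the invariant that
  each chosen vertex accounts for \<open>t\<close> hit vertices; hence at most
  \<open>card V / t\<close> vertices are chosen.\<close>

lemma fingerprint_exists:
  fixes t :: real
  assumes "finite V" "I \<subseteq> V" "t > 0"
  obtains S where "S \<subseteq> I" "real (card S) * t \<le> real (card V)"
    "\<And>v. v \<in> I \<Longrightarrow> real (card {w \<in> V. (v, w) \<in> P \<and> (\<forall>s\<in>S. (s, w) \<notin> P)}) < t"
proof -
  define hit where "hit S = {w \<in> V. \<exists>s\<in>S. (s, w) \<in> P}" for S
  define F where "F = {S. S \<subseteq> I \<and> real (card S) * t \<le> real (card (hit S))}"
  have fI: "finite I" using assms finite_subset by blast
  have hit_sub: "hit S \<subseteq> V" for S by (auto simp: hit_def)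
  then have hV: "finite (hit S)" "card (hit S) \<le> card V" for S
    using assms(1) by (auto intro: finite_subset card_mono)
  have "finite F" unfolding F_def by (rule finite_subset[of _ "Pow I"]) (use fI in auto)
  moreover have "{} \<in> F" by (simp add: F_def)
  ultimately have "\<exists>S\<in>F. {} \<subseteq> S \<and> (\<forall>S'\<in>F. S \<subseteq> S' \<longrightarrow> S = S')"
    by (rule finite_has_maximal2)
  then obtain S where S: "S \<in> F" and max: "\<forall>S'\<in>F. S \<subseteq> S' \<longrightarrow> S = S'"
    by (elim bexE conjE)
  have SI: "S \<subseteq> I" and Sc: "real (card S) * t \<le> real (card (hit S))" using S by (auto simp: F_def)
  show ?thesis
  proof (rule that[OF SI])
    show "real (card S) * t \<le> real (card V)"
      using Sc hV(2)[of S] by linarith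
    fix v assume v: "v \<in> I"
    let ?N = "{w \<in> V. (v, w) \<in> P \<and> (\<forall>s\<in>S. (s, w) \<notin> P)}"
    show "real (card ?N) < t"
    proof (rule ccontr)
      assume "\<not> ?thesis"
      then have big: "t \<le> real (card ?N)" by simp
      have "?N \<noteq> {}"
      proof
        assume "?N = {}"
        then have "card ?N = 0" by (simp only: card.empty)
        then show False using big assms(3) by simp
      qed
      then obtain w where "(v, w) \<in> P" "\<forall>s\<in>S. (s, w) \<notin> P" by auto
      then have vS: "v \<notin> S" by auto
      have "hit (insert v S) = hit S \<union> ?N" by (auto simp: hit_def)
      moreover have "hit S \<inter> ?N = {}" by (auto simp: hit_def)
      ultimately have "card (hit (insert v S)) = card (hit S) + card ?N"
        using assms(1) hV by (simp add: card_Un_disjoint)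
      moreover have "card (insert v S) = Suc (card S)"
        using vS finite_subset[OF SI fI] by simp
      ultimately have "insert v S \<in> F"
        using v SI Sc big by (simp add: F_def algebra_simps)
      with max have "S = insert v S" by (elim ballE impE) auto
      with vS show False by auto
    qed
  qed
qed

text \<open>It depends on \<open>P\<close> and the fingerprint alone and not on \<open>I\<close>,
  which is what makes it a container. If \<open>I\<close> is independent in \<open>P\<close> and
  \<open>S\<close> is its fingerprint, all of \<open>I\<close> survives.\<close>

definition survivors :: "('a \<times> 'a) set \<Rightarrow> 'a set \<Rightarrow> real \<Rightarrow> 'a set \<Rightarrow> 'a set" where
  "survivors P V t S = {v \<in> V. (\<forall>s\<in>S. (s, v) \<notin> P) \<and>
     real (card {w \<in> V. (v, w) \<in> P \<and> (\<forall>s\<in>S. (s, w) \<notin> P)}) < t}"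

lemma survivors_sparse:
  assumes "finite V" "v \<in> survivors P V t S"
  shows "real (card {w \<in> survivors P V t S. (v, w) \<in> P}) < t"
proof -
  have "card {w \<in> survivors P V t S. (v, w) \<in> P}
      \<le> card {w \<in> V. (v, w) \<in> P \<and> (\<forall>s\<in>S. (s, w) \<notin> P)}"
    using assms(1) by (intro card_mono) (auto simp: survivors_def)
  then show ?thesis using assms(2) by (auto simp: survivors_def)
qed

text \<open>The condition is imposed on all orderings of a triple, so that \<open>P\<close> and
  \<open>S\<close> may be asymmetric.\<close>

definition container :: "('a \<times> 'a) set \<Rightarrow> 'a set \<Rightarrow> real \<Rightarrow> ('a \<times> 'a \<Rightarrow> 'a set) \<Rightarrow> 'a set set" where
  "container P V t S = {e. e \<subseteq> V \<and> card e = 3 \<and>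
     (\<forall>a b c. e = {a, b, c} \<longrightarrow> (a, b) \<in> P \<and> c \<in> survivors P V t (S (a, b)))}"

lemma container_pair: "{a, b, c} \<in> container P V t S \<Longrightarrow> (a, b) \<in> P"
  unfolding container_def by blast

lemma container_nb_sparse:
  assumes "finite V" "v \<in> nb (container P V t S) a b"
  shows "real (card {w \<in> nb (container P V t S) a b. (v, w) \<in> P}) < t"
proof -
  have sub: "nb (container P V t S) a b \<subseteq> survivors P V t (S (a, b))"
    unfolding nb_def container_def by blast
  have "finite (survivors P V t (S (a, b)))" using assms(1) by (simp add: survivors_def)
  then have "real (card {w \<in> nb (container P V t S) a b. (v, w) \<in> P})
      \<le> real (card {w \<in> survivors P V t (S (a, b)). (v, w) \<in> P})"
    using sub by (intro of_nat_mono card_mono) auto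
  also have "\<dots> < t" using sub assms by (intro survivors_sparse) auto
  finally show ?thesis .
qed

text \<open>A lost triple must contain a pair outside \<open>P\<close>. Such a pair has codegree at
  most 2, so the loss is at most twice the number of ordered pairs. \<open>S\<close> is extensional
  in order that the choices of fingerprints can be counted.\<close>

lemma container_exists:
  fixes V :: "'a set" and t :: real
  assumes V: "finite V" and "t > 0"
    and H: "\<And>e. e \<in> H \<Longrightarrow> e \<subseteq> V \<and> card e = 3" and free: "\<not> contains_copy H F5"
  obtains P S where "P \<subseteq> V \<times> V"
    "S \<in> V \<times> V \<rightarrow>\<^sub>E small_subsets V (real (card V) / t)"
    "real (card (H - container P V t S)) \<le> 2 * real (card V) ^ 2"
proof -
  define P where "P = {(x, y). card (nb H x y) \<ge> 3}"
  have nbV: "nb H a b \<subseteq> V" for a b using H by (auto simp: nb_def)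
  have fnb: "finite (nb H a b)" for a b using nbV V finite_subset by blast
  \<comment> \<open>Of three completions of \<open>c\<close>, \<open>d\<close>, one avoids both
    \<open>a\<close> and \<open>b\<close>; together with \<open>{a, b, c}\<close> and
    \<open>{a, b, d}\<close> it forms a copy of \<open>F5\<close>. This is the origin of the
    threshold 3.\<close>
  have indep: "(c, d) \<notin> P" if "c \<in> nb H a b" "d \<in> nb H a b" for a b c d
  proof
    assume "(c, d) \<in> P"
    then have "\<not> card (nb H c d) \<le> card {a, b}"
      by (simp add: P_def card_insert_if split: if_splits)
    then have "\<not> nb H c d \<subseteq> {a, b}" using card_mono[of "{a, b}" "nb H c d"] by auto
    then obtain z where z: "{c, d, z} \<in> H" "z \<noteq> a" "z \<noteq> b" by (auto simp: nb_def)
    have "card {c, d, z} = 3" using H z(1) by blast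
    then have "c \<noteq> d" by (rule card_eq_3D)
    with F5_freeD[OF free _ _ _ z(1), of a b] H that z show False by (auto simp: nb_def)
  qed
  have PV: "P \<subseteq> V \<times> V"
  proof clarify
    fix x y assume "(x, y) \<in> P"
    then have "nb H x y \<noteq> {}" by (auto simp: P_def)
    then show "x \<in> V \<and> y \<in> V" using H by (auto simp: nb_def)
  qed
  define good where "good a b S \<longleftrightarrow> S \<subseteq> nb H a b \<and> real (card S) * t \<le> real (card V) \<and>
    (\<forall>v\<in>nb H a b. real (card {w \<in> V. (v, w) \<in> P \<and> (\<forall>s\<in>S. (s, w) \<notin> P)}) < t)" for a b S
  have "\<exists>S. good a b S" for a b
    by (rule fingerprint_exists[OF V nbV[of a b] \<open>t > 0\<close>, of P]) (auto simp: good_def)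
  then obtain S0 where S0: "\<And>a b. good a b (S0 a b)" by metis
  define S where "S = restrict (\<lambda>(a, b). S0 a b) (V \<times> V)"
  have S: "S (a, b) = S0 a b" if "a \<in> V" "b \<in> V" for a b using that by (simp add: S_def)
  have SE: "S \<in> V \<times> V \<rightarrow>\<^sub>E small_subsets V (real (card V) / t)"
    unfolding S_def
  proof (intro restrict_PiE_iff[THEN iffD2] ballI, clarify)
    fix a b
    have "S0 a b \<subseteq> V" "real (card (S0 a b)) * t \<le> real (card V)"
      using S0[of a b] nbV by (auto simp: good_def)
    then show "S0 a b \<in> small_subsets V (real (card V) / t)"
      using \<open>t > 0\<close> by (simp add: small_subsets_def field_simps)
  qed
  have surv: "nb H a b \<subseteq> survivors P V t (S (a, b))" if "a \<in> V" "b \<in> V" for a b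
  proof
    fix v assume v: "v \<in> nb H a b"
    have "S0 a b \<subseteq> nb H a b" using S0[of a b] by (simp add: good_def)
    then have "\<forall>s\<in>S0 a b. (s, v) \<notin> P" using indep v by blast
    then show "v \<in> survivors P V t (S (a, b))"
      using v S0[of a b] nbV that by (auto simp: survivors_def S good_def)
  qed
  let ?D = "(\<lambda>(p, c). {fst p, snd p, c}) ` (SIGMA p:{p \<in> V \<times> V. p \<notin> P}. nb H (fst p) (snd p))"
  have fS: "finite (SIGMA p:{p \<in> V \<times> V. p \<notin> P}. nb H (fst p) (snd p))"
    using V fnb by auto
  have "H - container P V t S \<subseteq> ?D"
  proof
    fix e assume e: "e \<in> H - container P V t S"
    then have eV: "e \<subseteq> V" "card e = 3" using H by auto
    then obtain a b c where abc: "e = {a, b, c}" "\<not> ((a, b) \<in> P \<and> c \<in> survivors P V t (S (a, b)))"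
      using e unfolding container_def by auto
    have c: "c \<in> nb H a b" and ab: "a \<in> V" "b \<in> V" using e abc eV by (auto simp: nb_def)
    then have "(a, b) \<notin> P" using abc surv by blast
    then have "((a, b), c) \<in> (SIGMA p:{p \<in> V \<times> V. p \<notin> P}. nb H (fst p) (snd p))"
      using c ab by auto
    then show "e \<in> ?D" using abc(1) by (intro rev_image_eqI) auto
  qed
  then have "card (H - container P V t S) \<le> card ?D" using fS by (intro card_mono) auto
  also have "\<dots> \<le> card (SIGMA p:{p \<in> V \<times> V. p \<notin> P}. nb H (fst p) (snd p))"
    using fS by (rule card_image_le)
  also have "\<dots> = (\<Sum>p\<in>{p \<in> V \<times> V. p \<notin> P}. card (nb H (fst p) (snd p)))"
    using V fnb by (intro card_SigmaI) auto
  also have "\<dots> \<le> (\<Sum>p\<in>{p \<in> V \<times> V. p \<notin> P}. 2)"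
    by (intro sum_mono) (auto simp: P_def)
  also have "\<dots> \<le> 2 * card (V \<times> V)"
  proof -
    have "card {p \<in> V \<times> V. p \<notin> P} \<le> card (V \<times> V)" using V by (intro card_mono) auto
    then show ?thesis by simp
  qed
  finally have "real (card (H - container P V t S)) \<le> real (2 * (card V * card V))"
    by (simp only: card_cartesian_product of_nat_le_iff)
  then show ?thesis using that[OF PV SE] by (simp add: power2_eq_square)
qed

text \<open>The number 0 is not in \<open>{1..n}\<close>, so it can pad the lists to the common
  length \<open>K\<close>.\<close>

lemma card_small_subsets_le_power:
  "card (small_subsets {1..n} (real K)) \<le> (n + 1) ^ K"
proof -
  let ?L = "{xs. set xs \<subseteq> {0..n} \<and> length xs = K}"
  have "small_subsets {1..n} (real K) \<subseteq> (\<lambda>xs. set xs - {0}) ` ?L"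
  proof
    fix S assume "S \<in> small_subsets {1..n} (real K)"
    then have S: "S \<subseteq> {1..n}" "card S \<le> K" by (auto simp: small_subsets_def)
    then have fS: "finite S" using finite_subset by blast
    let ?xs = "sorted_list_of_set S @ replicate (K - card S) 0"
    have "?xs \<in> ?L" using S fS by auto
    moreover have "S = set ?xs - {0}" using S fS by auto
    ultimately show "S \<in> (\<lambda>xs. set xs - {0}) ` ?L" by (rule rev_image_eqI)
  qed
  moreover have "finite ?L" by (rule finite_lists_length_eq) simp
  ultimately have "card (small_subsets {1..n} (real K)) \<le> card ?L"
    by (meson card_image_le card_mono finite_imageI order_trans)
  then show ?thesis by (simp add: card_lists_length_eq)
qed

section \<open>Stability of the containers\<close>

lemma sum_squared_le_card_mult_sum:
  fixes f :: "'a \<Rightarrow> real"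
  assumes "finite A"
  shows "(\<Sum>x\<in>A. f x)\<^sup>2 \<le> real (card A) * (\<Sum>x\<in>A. (f x)\<^sup>2)"
proof (cases "A = {}")
  case False
  define n where "n = real (card A)"
  define s where "s = (\<Sum>x\<in>A. f x)"
  have n: "n > 0" using False assms by (simp add: n_def card_gt_0_iff)
  have "0 \<le> (\<Sum>x\<in>A. (n * f x - s)\<^sup>2)" by (intro sum_nonneg) simp
  also have "\<dots> = (\<Sum>x\<in>A. n\<^sup>2 * (f x)\<^sup>2 - 2 * n * s * f x + s\<^sup>2)"
    by (simp add: power2_diff power_mult_distrib algebra_simps)
  also have "\<dots> = n\<^sup>2 * (\<Sum>x\<in>A. (f x)\<^sup>2) - 2 * n * s * s + n * s\<^sup>2"
    by (simp add: sum.distrib sum_subtractf sum_distrib_left[symmetric] s_def[symmetric] n_def)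
  also have "\<dots> = n * (n * (\<Sum>x\<in>A. (f x)\<^sup>2) - s\<^sup>2)"
    by (simp add: power2_eq_square algebra_simps)
  finally show ?thesis using n by (simp add: zero_le_mult_iff n_def s_def)
qed simp

lemma card_six_orderings:
  assumes "card e = 3"
  shows "6 \<le> card {((a, b), c). {a, b, c} = e}"
proof -
  obtain x y z where e: "e = {x, y, z}" "x \<noteq> y" "x \<noteq> z" "y \<noteq> z"
    using assms by (auto simp: card_3_iff)
  let ?S = "{((x, y), z), ((x, z), y), ((y, x), z), ((y, z), x), ((z, x), y), ((z, y), x)}"
  have "card ?S = 6" using e by simp
  moreover have "?S \<subseteq> {((a, b), c). {a, b, c} = e}" using e by auto
  moreover have "finite {((a, b), c). {a, b, c} = e}"
  proof (rule finite_subset)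
    show "{((a, b), c). {a, b, c} = e} \<subseteq> (e \<times> e) \<times> e" by auto
    show "finite ((e \<times> e) \<times> e)" using assms by (simp add: card_ge_0_finite)
  qed
  ultimately show ?thesis using card_mono[of "{((a, b), c). {a, b, c} = e}" ?S] by simp
qed

lemma card_UN_ge:
  assumes "finite C" "\<And>e. e \<in> C \<Longrightarrow> finite (B e) \<and> k \<le> card (B e)"
    "\<And>e e'. e \<in> C \<Longrightarrow> e' \<in> C \<Longrightarrow> e \<noteq> e' \<Longrightarrow> B e \<inter> B e' = {}"
  shows "k * card C \<le> card (\<Union>e\<in>C. B e)"
proof -
  have "k * card C = (\<Sum>e\<in>C. k)" by simp
  also have "\<dots> \<le> (\<Sum>e\<in>C. card (B e))" using assms(2) by (intro sum_mono) auto
  also have "\<dots> = card (\<Union>e\<in>C. B e)" using assms by (intro card_UN_disjoint[symmetric]) auto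
  finally show ?thesis .
qed

text \<open>Averaging the codegree sum over the triples is a Cauchy--Schwarz inequality for the codegrees.\<close>
lemma exists_large_codegree_sum:
  assumes V: "finite V" and PV: "P \<subseteq> V \<times> V"
    and C: "\<And>e. e \<in> C \<Longrightarrow> e \<subseteq> V \<and> card e = 3" "C \<noteq> {}"
    and CP: "\<And>a b c. {a, b, c} \<in> C \<Longrightarrow> (a, b) \<in> P"
  obtains a b c where "{a, b, c} \<in> C"
    "real (card (nb C a b) + card (nb C b c) + card (nb C c a)) * real (card P) \<ge> 18 * real (card C)"
proof -
  define Q where "Q = (SIGMA p:P. nb C (fst p) (snd p))"
  define d where "d p = real (card (nb C (fst p) (snd p)))" for p
  have fP: "finite P" using PV V finite_subset by blast
  have nbV: "nb C a b \<subseteq> V" for a b using C by (auto simp: nb_def)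
  have fnb: "finite (nb C a b)" for a b using nbV V finite_subset by blast
  have fC: "finite C" by (rule finite_subset[of _ "Pow V"]) (use C V in auto)
  have fQ: "finite Q" using fP fnb by (auto simp: Q_def)
  have Q_iff: "((a, b), c) \<in> Q \<longleftrightarrow> {a, b, c} \<in> C" for a b c
    using CP by (auto simp: Q_def nb_def)
  have Q_eq: "Q = (\<Union>e\<in>C. {((a, b), c). {a, b, c} = e})" using Q_iff by auto
  have "6 * card C \<le> card (\<Union>e\<in>C. {((a, b), c). {a, b, c} = e})"
  proof (rule card_UN_ge[OF fC])
    fix e assume "e \<in> C"
    then have "finite e" "card e = 3" using C V finite_subset by blast+
    moreover have "finite {((a, b), c). {a, b, c} = e}"
      by (rule finite_subset[of _ "(e \<times> e) \<times> e"]) (use \<open>finite e\<close> in auto)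
    ultimately show "finite {((a, b), c). {a, b, c} = e} \<and> 6 \<le> card {((a, b), c). {a, b, c} = e}"
      using card_six_orderings by blast
  qed auto
  then have Q6: "6 * real (card C) \<le> real (card Q)" unfolding Q_eq[symmetric] by linarith
  have C0: "card C > 0" using fC C(2) by (simp add: card_gt_0_iff)
  have Qd: "real (card Q) = (\<Sum>p\<in>P. d p)"
    unfolding Q_def using fP fnb by (subst card_SigmaI) (auto simp: d_def)
  have "P \<noteq> {}" using Q6 C0 Qd by auto
  then have P0: "card P > 0" using fP by (simp add: card_gt_0_iff)
  have d1: "(\<Sum>q\<in>Q. d (fst q)) = (\<Sum>p\<in>P. (d p)\<^sup>2)"
    unfolding Q_def using fP fnb
    by (subst sum.Sigma[symmetric, where B = "\<lambda>p. nb C (fst p) (snd p)" and g = "\<lambda>x y. d x", unfolded split_def])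
       (auto simp: d_def power2_eq_square)
  \<comment> \<open>\<open>Q\<close> holds the orderings of the triples and is invariant under
    cyclic shifts, so the three codegrees of a triple have the same total over \<open>Q\<close>,
    namely the sum of the squared codegrees.\<close>
  have d2: "(\<Sum>q\<in>Q. d (snd (fst q), snd q)) = (\<Sum>q\<in>Q. d (fst q))"
    by (rule sum.reindex_bij_witness[where i = "\<lambda>((a, b), c). ((c, a), b)" and j = "\<lambda>((a, b), c). ((b, c), a)"])
       (auto simp: Q_iff insert_commute)
  have d3: "(\<Sum>q\<in>Q. d (snd q, fst (fst q))) = (\<Sum>q\<in>Q. d (fst q))"
    by (rule sum.reindex_bij_witness[where i = "\<lambda>((a, b), c). ((b, c), a)" and j = "\<lambda>((a, b), c). ((c, a), b)"])
       (auto simp: Q_iff insert_commute)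
  define s where "s q = d (fst q) + d (snd (fst q), snd q) + d (snd q, fst (fst q))" for q
  have "\<exists>q\<in>Q. s q * real (card P) \<ge> 18 * real (card C)"
  proof (rule ccontr)
    assume "\<not> ?thesis"
    then have small: "s q * real (card P) < 18 * real (card C)" if "q \<in> Q" for q using that by force
    have Q0: "card Q > 0" using Q6 C0 by linarith
    then have "Q \<noteq> {}" by auto
    \<comment> \<open>The mean of \<open>s\<close> over \<open>Q\<close> is at least
      \<open>3 * card Q / card P\<close>, and \<open>card Q\<close> is at least
      \<open>6 * card C\<close>: hence the constant 18.\<close>
    have "3 * (real (card Q))\<^sup>2 \<le> 3 * (real (card P) * (\<Sum>p\<in>P. (d p)\<^sup>2))"
      using sum_squared_le_card_mult_sum[OF fP, of d] by (simp add: Qd)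
    also have "\<dots> = (\<Sum>q\<in>Q. s q * real (card P))"
      unfolding s_def sum_distrib_right[symmetric] sum.distrib d2 d3 d1 by simp
    also have "\<dots> < (\<Sum>q\<in>Q. 18 * real (card C))"
      using small fQ \<open>Q \<noteq> {}\<close> by (intro sum_strict_mono) auto
    also have "\<dots> \<le> real (card Q) * (3 * real (card Q))"
      using Q6 by (simp add: mult_left_mono)
    finally show False by (simp add: power2_eq_square)
  qed
  then obtain q where q: "q \<in> Q" "s q * real (card P) \<ge> 18 * real (card C)" by blast
  obtain a b c where abc: "q = ((a, b), c)" by (metis prod.collapse)
  show ?thesis
    using q that[of a b c] by (simp add: abc Q_iff s_def d_def)
qed

text \<open>Here \<open>\<tau>\<close> stands for the fraction of vertices covered by the classes,
  \<open>S\<close> for the normalised codegree sum and \<open>\<pi>\<close> for the density of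
  \<open>P\<close>. On the unit interval \<open>\<tau> * (1 - \<tau> ^ 2 / 3)\<close> has its
  maximum \<open>2 / 3\<close> only at 1, and it falls off quadratically there; this produces the
  square root.\<close>

lemma cover_fraction_bound:
  fixes \<tau> S \<pi> \<epsilon> \<delta> :: real
  assumes "\<tau> \<le> 1" "S \<le> \<tau> + 3 * \<epsilon>" "2 / 3 - 18 * \<delta> \<le> S * \<pi>" "\<pi> \<le> 1 - \<tau>\<^sup>2 / 3 + \<epsilon>"
    "0 \<le> \<pi>" "\<pi> \<le> 1" "0 \<le> S" "0 \<le> \<epsilon>" "18 * \<delta> + 3 * \<epsilon> \<le> 2 / 3"
  shows "1 - \<tau> \<le> sqrt (27 * \<delta> + 6 * \<epsilon>)"
proof -
  have "S * \<pi> \<le> S" using assms(5-7) by (simp add: mult_left_le)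
  then have \<tau>: "0 \<le> \<tau>" using assms by linarith
  have "S * \<pi> \<le> (\<tau> + 3 * \<epsilon>) * \<pi>" using assms by (intro mult_right_mono) auto
  also have "\<dots> = \<tau> * \<pi> + 3 * \<epsilon> * \<pi>" by (simp add: algebra_simps)
  also have "\<dots> \<le> \<tau> * (1 - \<tau>\<^sup>2 / 3 + \<epsilon>) + 3 * \<epsilon> * 1"
    using assms \<tau> by (intro add_mono mult_left_mono) auto
  also have "\<dots> \<le> \<tau> * (1 - \<tau>\<^sup>2 / 3) + 4 * \<epsilon>"
    using mult_right_mono[OF assms(1) assms(8)] by (simp add: algebra_simps)
  finally have *: "2 / 3 - 18 * \<delta> \<le> \<tau> * (1 - \<tau>\<^sup>2 / 3) + 4 * \<epsilon>" using assms by linarith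
  \<comment> \<open>Expansion at the maximum: the linear term vanishes and \<open>u ^ 3 / 3\<close>
    consumes at most a third of \<open>u ^ 2\<close>. Dividing by the remaining \<open>2 / 3\<close>
    turns 18 and 4 into 27 and 6.\<close>
  define u where "u = 1 - \<tau>"
  have u: "0 \<le> u" "u \<le> 1" using assms \<tau> by (auto simp: u_def)
  have "\<tau> * (1 - \<tau>\<^sup>2 / 3) = 2 / 3 - u\<^sup>2 + u ^ 3 / 3"
    by (simp add: u_def power2_eq_square power3_eq_cube field_simps)
  moreover have "u ^ 3 \<le> u\<^sup>2" using u by (intro power_decreasing) auto
  ultimately have "u\<^sup>2 \<le> 27 * \<delta> + 6 * \<epsilon>" using * by linarith
  then show ?thesis unfolding u_def[symmetric] by (rule real_le_rsqrt)
qed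

text \<open>The three codegree neighbourhoods of a triple with a large codegree sum are nearly disjoint,
  and each spans few pairs of \<open>P\<close>; they are the colour classes. The codegree sum bounds \<open>card P\<close>
  from above in terms of itself, which forces them to cover nearly everything.\<close>
lemma stability:
  fixes V :: "'a set" and \<epsilon> \<delta> :: real
  defines "n \<equiv> real (card V)"
  assumes V: "finite V" "V \<noteq> {}" and PV: "P \<subseteq> V \<times> V"
    and C: "\<And>e. e \<in> C \<Longrightarrow> e \<subseteq> V \<and> card e = 3"
    and CP: "\<And>a b c. {a, b, c} \<in> C \<Longrightarrow> (a, b) \<in> P"
    and sparse: "\<And>a b v. v \<in> nb C a b \<Longrightarrow> real (card {w \<in> nb C a b. (v, w) \<in> P}) \<le> \<epsilon> * n"
    and \<epsilon>: "0 \<le> \<epsilon>" "18 * \<delta> + 3 * \<epsilon> < 2 / 3"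
    and large: "(1 / 27 - \<delta>) * n ^ 3 \<le> real (card C)"
  obtains c :: "'a \<Rightarrow> nat" where "range c \<subseteq> {..<3}"
    "real (card {e \<in> C. \<not> inj_on c e}) \<le> (sqrt (27 * \<delta> + 6 * \<epsilon>) + \<epsilon>) * n ^ 3"
proof -
  have n: "n > 0" using V by (simp add: n_def card_gt_0_iff)
  have nbV: "nb C a b \<subseteq> V" for a b using C by (auto simp: nb_def)
  have fnb: "finite (nb C a b)" for a b using nbV V finite_subset by blast
  have fP: "finite P" using PV V finite_subset by blast
  have "1 / 27 - \<delta> > 0" using \<epsilon> by linarith
  then have "real (card C) > 0" using large n by (smt (verit) mult_pos_pos zero_less_power)
  then have "C \<noteq> {}" by auto
  obtain a b c where abc: "{a, b, c} \<in> C" and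
    sum: "real (card (nb C a b) + card (nb C b c) + card (nb C c a)) * real (card P) \<ge> 18 * real (card C)"
    by (rule exists_large_codegree_sum[OF V(1) PV C \<open>C \<noteq> {}\<close> CP]) assumption+
  define X where "X = nb C a b"
  define Y where "Y = nb C b c"
  define Z where "Z = nb C c a"
  have mem: "c \<in> X" "a \<in> Y" using abc by (auto simp: X_def Y_def nb_def insert_commute)
  have fin: "finite X" "finite Y" "finite Z" by (auto simp: X_def Y_def Z_def fnb)
  have sub: "X \<subseteq> V" "Y \<subseteq> V" "Z \<subseteq> V" using nbV by (auto simp: X_def Y_def Z_def)
  have spX: "v \<in> X \<Longrightarrow> real (card {w \<in> X. (v, w) \<in> P}) \<le> \<epsilon> * n" for v
    using sparse by (simp add: X_def)
  have spY: "v \<in> Y \<Longrightarrow> real (card {w \<in> Y. (v, w) \<in> P}) \<le> \<epsilon> * n" for v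
    using sparse by (simp add: Y_def)
  have spZ: "v \<in> Z \<Longrightarrow> real (card {w \<in> Z. (v, w) \<in> P}) \<le> \<epsilon> * n" for v
    using sparse by (simp add: Z_def)
  have CPY: "(c, w) \<in> P" if "w \<in> Y" for w
  proof -
    have "{c, w, b} = {b, c, w}" by auto
    then show ?thesis using that CP[of c w b] by (simp add: Y_def nb_def)
  qed
  have CPZ: "(c, w) \<in> P" "(a, w) \<in> P" if "w \<in> Z" for w
  proof -
    have "{c, w, a} = {c, a, w}" "{a, w, c} = {c, a, w}" by auto
    then show "(c, w) \<in> P" "(a, w) \<in> P"
      using that CP[of c w a] CP[of a w c] by (simp_all add: Z_def nb_def)
  qed
  \<comment> \<open>The triple itself supplies the witness: \<open>c\<close> lies in
    \<open>X\<close> and is joined in \<open>P\<close> to all of \<open>Y\<close>, so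
    \<open>X \<inter> Y\<close> is part of the sparse neighbourhood of \<open>c\<close> inside
    \<open>X\<close>. The other two intersections are similar.\<close>
  have XY: "real (card (X \<inter> Y)) \<le> \<epsilon> * n"
  proof -
    have "X \<inter> Y \<subseteq> {w \<in> X. (c, w) \<in> P}"
      using CPY by auto
    then show ?thesis using card_mono[of "{w \<in> X. (c, w) \<in> P}" "X \<inter> Y"] spX[OF mem(1)] fin by fastforce
  qed
  have XZ: "real (card (X \<inter> Z)) \<le> \<epsilon> * n"
  proof -
    have "X \<inter> Z \<subseteq> {w \<in> X. (c, w) \<in> P}"
      using CPZ by auto
    then show ?thesis using card_mono[of "{w \<in> X. (c, w) \<in> P}" "X \<inter> Z"] spX[OF mem(1)] fin by fastforce
  qed
  have YZ: "real (card (Y \<inter> Z)) \<le> \<epsilon> * n"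
  proof -
    have "Y \<inter> Z \<subseteq> {w \<in> Y. (a, w) \<in> P}"
      using CPZ by auto
    then show ?thesis using card_mono[of "{w \<in> Y. (a, w) \<in> P}" "Y \<inter> Z"] spY[OF mem(2)] fin by fastforce
  qed
  define Y' where "Y' = Y - X"
  define Z' where "Z' = Z - X - Y"
  define R where "R = V - X - Y' - Z'"
  define \<sigma> where "\<sigma> = real (card X) + real (card Y') + real (card Z')"
  have fin': "finite Y'" "finite Z'" "finite R" using fin V by (auto simp: Y'_def Z'_def R_def)
  have disj: "X \<inter> Y' = {}" "X \<inter> Z' = {}" "Y' \<inter> Z' = {}" by (auto simp: Y'_def Z'_def)
  have sub': "Y' \<subseteq> V" "Z' \<subseteq> V" using sub by (auto simp: Y'_def Z'_def)
  have cY: "real (card Y) \<le> real (card Y') + \<epsilon> * n"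
  proof -
    have "card Y = card (Y - X) + card (Y \<inter> X)" using fin by (metis card_Diff_subset_Int card_Int_Diff add.commute)
    then show ?thesis using XY by (simp add: Y'_def Int_commute)
  qed
  have cZ: "real (card Z) \<le> real (card Z') + 2 * \<epsilon> * n"
  proof -
    have "Z \<subseteq> Z' \<union> (X \<inter> Z) \<union> (Y \<inter> Z)" by (auto simp: Z'_def)
    then have "card Z \<le> card (Z' \<union> (X \<inter> Z) \<union> (Y \<inter> Z))" using fin fin' by (intro card_mono) auto
    also have "\<dots> \<le> card Z' + card (X \<inter> Z) + card (Y \<inter> Z)"
      by (meson add_mono card_Un_le le_refl order_trans)
    finally show ?thesis using XZ YZ by linarith
  qed
  have part: "real (card R) + \<sigma> = n"
  proof -
    have "V = R \<union> (X \<union> (Y' \<union> Z'))" using sub sub' by (auto simp: R_def)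
    then have "card V = card (R \<union> (X \<union> (Y' \<union> Z')))" by simp
    also have "\<dots> = card R + (card X + (card Y' + card Z'))"
      using fin fin' disj by (subst card_Un_disjoint; (auto simp: R_def)?)+
    finally show ?thesis by (simp add: n_def \<sigma>_def)
  qed
  have inside: "real (card (P \<inter> A \<times> A)) \<le> real (card A) * (\<epsilon> * n)"
    if "finite A" "\<And>v. v \<in> A \<Longrightarrow> real (card {w \<in> A. (v, w) \<in> P}) \<le> \<epsilon> * n" for A
  proof -
    have "P \<inter> A \<times> A = (SIGMA v:A. {w \<in> A. (v, w) \<in> P})" by auto
    then have "real (card (P \<inter> A \<times> A)) = (\<Sum>v\<in>A. real (card {w \<in> A. (v, w) \<in> P}))"
      using that by simp
    also have "\<dots> \<le> (\<Sum>v\<in>A. \<epsilon> * n)" using that by (intro sum_mono)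
    finally show ?thesis by simp
  qed
  define I where "I = P \<inter> (X \<times> X \<union> Y' \<times> Y' \<union> Z' \<times> Z')"
  have mono: "real (card {w \<in> A. (v, w) \<in> P}) \<le> real (card {w \<in> B. (v, w) \<in> P})"
    if "A \<subseteq> B" "finite B" for A B v
    using that by (intro of_nat_mono card_mono) auto
  have cI: "real (card I) \<le> \<epsilon> * n\<^sup>2"
  proof -
    have "card I \<le> card (P \<inter> X \<times> X) + card (P \<inter> Y' \<times> Y') + card (P \<inter> Z' \<times> Z')"
      unfolding I_def Int_Un_distrib by (meson add_mono card_Un_le le_refl order_trans)
    then have "real (card I) \<le> real (card (P \<inter> X \<times> X)) + real (card (P \<inter> Y' \<times> Y')) + real (card (P \<inter> Z' \<times> Z'))"
      by linarith
    also have "\<dots> \<le> real (card X) * (\<epsilon> * n) + real (card Y') * (\<epsilon> * n) + real (card Z') * (\<epsilon> * n)"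
    proof (intro add_mono inside)
      fix v assume "v \<in> Y'"
      then show "real (card {w \<in> Y'. (v, w) \<in> P}) \<le> \<epsilon> * n"
        using order_trans[OF mono[of Y' Y v] spY[of v]] fin by (simp add: Y'_def)
    next
      fix v assume "v \<in> Z'"
      then show "real (card {w \<in> Z'. (v, w) \<in> P}) \<le> \<epsilon> * n"
        using order_trans[OF mono[of Z' Z v] spZ[of v]] fin by (simp add: Z'_def Diff_subset subset_eq)
    qed (use fin fin' spX in auto)
    also have "\<dots> = \<sigma> * (\<epsilon> * n)" by (simp add: \<sigma>_def algebra_simps)
    also have "\<dots> \<le> n * (\<epsilon> * n)" using part \<epsilon> n by (intro mult_right_mono) auto
    finally show ?thesis by (simp add: power2_eq_square mult_ac)
  qed
  \<comment> \<open>\<open>P\<close> avoids the pairs inside the classes, except for those in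
    \<open>I\<close>, and the squares of three sizes with sum \<open>\<sigma>\<close> add up to at
    least \<open>\<sigma> ^ 2 / 3\<close>.\<close>
  have cP: "real (card P) \<le> n\<^sup>2 - \<sigma>\<^sup>2 / 3 + \<epsilon> * n\<^sup>2"
  proof -
    let ?D = "X \<times> X \<union> Y' \<times> Y' \<union> Z' \<times> Z'"
    have fD: "finite ?D" using fin fin' by auto
    have cD: "card ?D = card X * card X + card Y' * card Y' + card Z' * card Z'"
      using fin fin' disj by (subst card_Un_disjoint; (auto simp: card_cartesian_product)?)+
    have DV: "?D \<subseteq> V \<times> V" using sub sub' by auto
    have PD: "P \<subseteq> (V \<times> V - ?D) \<union> I" using PV by (auto simp: I_def)
    have "finite ((V \<times> V - ?D) \<union> I)" using V fP by (simp add: I_def)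
    then have "card P \<le> card ((V \<times> V - ?D) \<union> I)" using PD by (rule card_mono)
    also have "\<dots> \<le> card (V \<times> V - ?D) + card I" by (rule card_Un_le)
    also have "card (V \<times> V - ?D) = card (V \<times> V) - card ?D"
      by (rule card_Diff_subset[OF fD DV])
    finally have "real (card P) \<le> real (card (V \<times> V)) - real (card ?D) + real (card I)"
    proof -
      assume *: "card P \<le> card (V \<times> V) - card ?D + card I"
      have "card ?D \<le> card (V \<times> V)" using DV V by (intro card_mono) auto
      then have "card P + card ?D \<le> card (V \<times> V) + card I" using * by linarith
      then show ?thesis by linarith
    qed
    also have "real (card (V \<times> V)) = n\<^sup>2" by (simp add: card_cartesian_product n_def power2_eq_square)
    also have "real (card ?D) = (real (card X))\<^sup>2 + (real (card Y'))\<^sup>2 + (real (card Z'))\<^sup>2"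
      unfolding cD by (simp add: power2_eq_square)
    also have "n\<^sup>2 - ((real (card X))\<^sup>2 + (real (card Y'))\<^sup>2 + (real (card Z'))\<^sup>2) + real (card I)
        \<le> n\<^sup>2 - \<sigma>\<^sup>2 / 3 + \<epsilon> * n\<^sup>2"
    proof -
      have "\<sigma>\<^sup>2 \<le> 3 * ((x :: real)\<^sup>2 + y\<^sup>2 + z\<^sup>2)" if "\<sigma> = x + y + z" for x y z
      proof -
        have "0 \<le> (x - y)\<^sup>2 + (y - z)\<^sup>2 + (x - z)\<^sup>2" by simp
        then show ?thesis unfolding that by (simp add: power2_eq_square algebra_simps)
      qed
      note * = this[OF \<sigma>_def]
      have "A \<le> 3 * B \<Longrightarrow> D \<le> E \<Longrightarrow> n\<^sup>2 - B + D \<le> n\<^sup>2 - A / 3 + E" for A B D E :: real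
        by simp
      from this[OF * cI] show ?thesis .
    qed
    finally show ?thesis .
  qed
  define \<rho> where "\<rho> = sqrt (27 * \<delta> + 6 * \<epsilon>)"
  have "1 - \<sigma> / n \<le> \<rho>"
    unfolding \<rho>_def
  proof (rule cover_fraction_bound[where S = "(real (card X) + real (card Y) + real (card Z)) / n"
        and \<pi> = "real (card P) / n\<^sup>2"])
    show "\<sigma> / n \<le> 1" using part n by simp
    show "(real (card X) + real (card Y) + real (card Z)) / n \<le> \<sigma> / n + 3 * \<epsilon>"
    proof -
      have "real (card X) + real (card Y) + real (card Z) \<le> \<sigma> + 3 * \<epsilon> * n"
        using cY cZ by (simp add: \<sigma>_def)
      then have "(real (card X) + real (card Y) + real (card Z)) / n \<le> (\<sigma> + 3 * \<epsilon> * n) / n"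
        using n by (intro divide_right_mono) auto
      then show ?thesis using n by (simp add: add_divide_distrib)
    qed
    have "(2 / 3 - 18 * \<delta>) * n ^ 3 \<le> (real (card X) + real (card Y) + real (card Z)) * real (card P)"
      using sum large by (simp add: X_def Y_def Z_def algebra_simps)
    then show "2 / 3 - 18 * \<delta> \<le> (real (card X) + real (card Y) + real (card Z)) / n * (real (card P) / n\<^sup>2)"
      using n by (simp add: field_simps power2_eq_square power3_eq_cube)
    show "real (card P) / n\<^sup>2 \<le> 1 - (\<sigma> / n)\<^sup>2 / 3 + \<epsilon>"
      using cP n by (simp add: field_simps)
    have "card P \<le> card (V \<times> V)" using PV V by (intro card_mono) auto
    then have "real (card P) \<le> real (card V * card V)" by (simp only: card_cartesian_product of_nat_le_iff)
    then show "real (card P) / n\<^sup>2 \<le> 1" using n by (simp add: n_def power2_eq_square)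
  qed (use n \<epsilon> in auto)
  then have cR: "real (card R) \<le> \<rho> * n" using part n by (simp add: field_simps)
  \<comment> \<open>Uncovered vertices get colour 2 by default. A triple with two vertices of one
    colour then meets \<open>R\<close> or contains a pair of \<open>I\<close>, and both kinds are
    few.\<close>
  define col :: "'a \<Rightarrow> nat" where "col v = (if v \<in> X then 0 else if v \<in> Y then 1 else 2)" for v
  show ?thesis
  proof (rule that)
    show "range col \<subseteq> {..<3}" by (auto simp: col_def)
    let ?S = "R \<times> V \<times> V \<union> (\<lambda>((v, w), u). (v, w, u)) ` (I \<times> V)"
    have fI: "finite I" using fP by (simp add: I_def)
    have "{e \<in> C. \<not> inj_on col e} \<subseteq> (\<lambda>(v, w, u). {v, w, u}) ` ?S"
    proof clarify
      fix e assume e: "e \<in> C" "\<not> inj_on col e"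
      then obtain v w where vw: "v \<in> e" "w \<in> e" "v \<noteq> w" "col v = col w" by (auto simp: inj_on_def)
      have "card (e - {v, w}) = 1" using vw C[OF e(1)] by (simp add: card_Diff_subset)
      then obtain u where "e - {v, w} = {u}" by (rule card_1_singletonE)
      then have ee: "e = {v, w, u}" using vw by auto
      have eV: "v \<in> V" "w \<in> V" "u \<in> V" using C[OF e(1)] ee by auto
      have P: "(v, w) \<in> P" using CP e(1) ee by blast
      have img: "e \<in> (\<lambda>(v, w, u). {v, w, u}) ` ?S"
        if "e = {v', w', u'}" "(v', w', u') \<in> ?S" for v' w' u'
        using that by (intro image_eqI[of _ _ "(v', w', u')"]) simp_all
      consider "v \<in> R" | "w \<in> R" | "v \<notin> R" "w \<notin> R" by blast
      then show "e \<in> (\<lambda>(v, w, u). {v, w, u}) ` ?S"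
      proof cases
        case 1
        then have "(v, w, u) \<in> ?S" using eV by auto
        then show ?thesis by (rule img[OF ee])
      next
        case 2
        then have "(w, v, u) \<in> ?S" using eV by auto
        then show ?thesis using ee by (intro img) auto
      next
        case 3
        then have "(v, w) \<in> I"
          using vw P eV by (auto simp: I_def R_def col_def Y'_def Z'_def split: if_splits)
        then have "(v, w, u) \<in> ?S" using eV by (auto intro!: rev_image_eqI[of "((v, w), u)"])
        then show ?thesis by (rule img[OF ee])
      qed
    qed
    then have "card {e \<in> C. \<not> inj_on col e} \<le> card ?S"
      using V fin' fI by (intro surj_card_le) auto
    also have "\<dots> \<le> card (R \<times> V \<times> V) + card (I \<times> V)"
    proof -
      have "card ((\<lambda>((v, w), u). (v, w, u)) ` (I \<times> V)) \<le> card (I \<times> V)"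
        using V fI by (intro card_image_le) auto
      then show ?thesis by (intro order_trans[OF card_Un_le] add_mono) auto
    qed
    finally have "real (card {e \<in> C. \<not> inj_on col e}) \<le> real (card (R \<times> V \<times> V) + card (I \<times> V))"
      by (simp only: of_nat_le_iff)
    also have "\<dots> = real (card R) * n\<^sup>2 + real (card I) * n"
      by (simp add: card_cartesian_product n_def power2_eq_square)
    also have "\<dots> \<le> (\<rho> * n) * n\<^sup>2 + (\<epsilon> * n\<^sup>2) * n"
      using cR cI n by (intro add_mono mult_right_mono) auto
    finally show "real (card {e \<in> C. \<not> inj_on col e}) \<le> (sqrt (27 * \<delta> + 6 * \<epsilon>) + \<epsilon>) * n ^ 3"
      by (simp add: \<rho>_def power2_eq_square power3_eq_cube algebra_simps)
  qed
qed

section \<open>Crossing triples and nearly tripartite systems\<close>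

definition colourings :: "nat \<Rightarrow> (nat \<Rightarrow> nat) set" where
  "colourings n = {1..n} \<rightarrow>\<^sub>E {..<3}"

definition crossing :: "nat \<Rightarrow> (nat \<Rightarrow> nat) \<Rightarrow> nat set set" where
  "crossing n c = {e \<in> triples n. inj_on c e}"

definition colour_class :: "nat \<Rightarrow> (nat \<Rightarrow> nat) \<Rightarrow> nat \<Rightarrow> nat set" where
  "colour_class n c i = {x \<in> {1..n}. c x = i}"

text \<open>For \<open>i < 3\<close> this is where the link of a vertex of class \<open>i\<close>
  lies when all triples are crossing.\<close>

definition cross_pairs :: "nat \<Rightarrow> (nat \<Rightarrow> nat) \<Rightarrow> nat \<Rightarrow> nat set set" where
  "cross_pairs n c i = {p \<in> pairs n. c ` p = {..<3} - {i}}"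

definition joins :: "'a set \<Rightarrow> 'a set set \<Rightarrow> 'a set set" where
  "joins U G = (\<lambda>(u, p). insert u p) ` (U \<times> G)"

lemma finite_colourings [simp]: "finite (colourings n)"
  unfolding colourings_def by (intro finite_PiE) auto

lemma card_colourings [simp]: "card (colourings n) = 3 ^ n"
  unfolding colourings_def by (simp add: card_PiE)

lemma colouring_less: "c \<in> colourings n \<Longrightarrow> x \<in> {1..n} \<Longrightarrow> c x < 3"
  unfolding colourings_def by (auto simp: PiE_iff)

lemma finite_crossing [simp]: "finite (crossing n c)"
  unfolding crossing_def by simp

lemma finite_cross_pairs [simp]: "finite (cross_pairs n c i)"
  unfolding cross_pairs_def by simp

lemma finite_colour_class [simp]: "finite (colour_class n c i)"
  unfolding colour_class_def by simp

lemma card_colour_class_le: "card (colour_class n c i) \<le> n"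
proof -
  have "card (colour_class n c i) \<le> card {1..n}"
    by (rule card_mono) (auto simp: colour_class_def)
  then show ?thesis by simp
qed

lemma inj_on_joins: "inj_on (\<lambda>(u, p). insert u p) (colour_class n c i \<times> cross_pairs n c i)"
proof (rule inj_onI, clarify)
  fix u p u' p'
  assume *: "u \<in> colour_class n c i" "p \<in> cross_pairs n c i"
    "u' \<in> colour_class n c i" "p' \<in> cross_pairs n c i" "insert u p = insert u' p'"
  have c: "c u = i" "c u' = i" "i \<notin> c ` p" "i \<notin> c ` p'"
    using *(1-4) by (auto simp: colour_class_def cross_pairs_def)
  then have notin: "u \<notin> p" "u' \<notin> p'" "u \<notin> p'" "u' \<notin> p" by (metis imageI)+
  then have "u = u'" using *(5) by auto
  then show "u = u' \<and> p = p'" using *(5) notin by (metis insert_ident)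
qed

lemma card_joins:
  assumes "U \<subseteq> colour_class n c i" "G \<subseteq> cross_pairs n c i"
  shows "card (joins U G) = card U * card G"
  unfolding joins_def card_cartesian_product[symmetric]
  by (rule card_image[OF inj_on_subset[OF inj_on_joins]]) (use assms in auto)

lemma finite_joins [simp]: "finite U \<Longrightarrow> finite G \<Longrightarrow> finite (joins U G)"
  by (simp add: joins_def)

lemma crossing_eq_joins:
  assumes "c \<in> colourings n" "i < 3"
  shows "crossing n c = joins (colour_class n c i) (cross_pairs n c i)"
proof (intro equalityI subsetI)
  fix e assume "e \<in> crossing n c"
  then have e: "e \<subseteq> {1..n}" "card e = 3" "inj_on c e" by (auto simp: crossing_def triples_def)
  have "c ` e = {..<3}"
    using e assms colouring_less by (intro card_subset_eq) (auto simp: card_image)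
  then obtain u where u: "u \<in> e" "c u = i" using assms(2) by (metis imageE lessThan_iff)
  have "c ` (e - {u}) = c ` e - c ` {u}"
    using e u by (intro inj_on_image_set_diff) auto
  then have "e - {u} \<in> cross_pairs n c i"
    using e u \<open>c ` e = {..<3}\<close> by (auto simp: cross_pairs_def pairs_def card_Diff_subset)
  moreover have "u \<in> colour_class n c i" using e u by (auto simp: colour_class_def)
  moreover have "e = insert u (e - {u})" using u by auto
  ultimately show "e \<in> joins (colour_class n c i) (cross_pairs n c i)"
    unfolding joins_def by (intro image_eqI[of _ _ "(u, e - {u})"]) auto
next
  fix e assume "e \<in> joins (colour_class n c i) (cross_pairs n c i)"
  then obtain u p where e: "e = insert u p" and u: "u \<in> {1..n}" "c u = i"
    and p: "p \<subseteq> {1..n}" "card p = 2" "c ` p = {..<3} - {i}"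
    by (auto simp: joins_def colour_class_def cross_pairs_def pairs_def)
  have fp: "finite p" using p finite_subset by blast
  have "i \<notin> c ` p" using p(3) by simp
  then have up: "u \<notin> p" using u by auto
  have "card (c ` p) = card p" using p(2,3) assms(2) by (simp add: card_Diff_subset)
  then have "inj_on c p" using fp by (simp add: inj_on_iff_eq_card)
  then have "inj_on c (insert u p)" using up \<open>i \<notin> c ` p\<close> u by simp
  then show "e \<in> crossing n c"
    using e u p up fp by (auto simp: crossing_def triples_def)
qed

lemma card_cross_pairs_le:
  assumes c: "c \<in> colourings n" and i: "i < 3"
  shows "4 * real (card (cross_pairs n c i)) \<le> (real n - real (card (colour_class n c i)))\<^sup>2"
proof -
  obtain j k where jk: "{..<3} - {i} = {j, k}" "j \<noteq> k" "i \<noteq> j" "i \<noteq> k"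
  proof -
    have "i = 0 \<or> i = 1 \<or> i = 2" using i by auto
    moreover have "{..<3} - {0} = {1, 2 :: nat}" "{..<3} - {1} = {0, 2 :: nat}" "{..<3} - {2} = {0, 1 :: nat}"
      by auto
    ultimately show ?thesis using that[of 1 2] that[of 0 2] that[of 0 1] by auto
  qed
  let ?v = "\<lambda>i. card (colour_class n c i)"
  have "cross_pairs n c i \<subseteq> (\<lambda>(a, b). {a, b}) ` (colour_class n c j \<times> colour_class n c k)"
  proof
    fix p assume p: "p \<in> cross_pairs n c i"
    then have p': "p \<subseteq> {1..n}" "card p = 2" "c ` p = {j, k}" by (auto simp: cross_pairs_def pairs_def jk)
    then obtain a b where ab: "a \<in> p" "b \<in> p" "c a = j" "c b = k" by (metis imageE insertCI)
    then have "a \<noteq> b" using jk by auto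
    moreover obtain x y where "p = {x, y}" using p'(2) by (auto simp: card_2_iff)
    ultimately have "p = {a, b}" using ab by auto
    then show "p \<in> (\<lambda>(a, b). {a, b}) ` (colour_class n c j \<times> colour_class n c k)"
      using ab p' by (intro image_eqI[of _ _ "(a, b)"]) (auto simp: colour_class_def)
  qed
  then have "card (cross_pairs n c i) \<le> card (colour_class n c j \<times> colour_class n c k)"
    by (intro surj_card_le) auto
  then have q: "real (card (cross_pairs n c i)) \<le> real (?v j) * real (?v k)"
    by (metis card_cartesian_product of_nat_le_iff of_nat_mult)
  have "?v i + (?v j + ?v k) = card (colour_class n c i \<union> (colour_class n c j \<union> colour_class n c k))"
    using jk(2-4) by (subst card_Un_disjoint; (auto simp: colour_class_def)?)+
  also have "colour_class n c i \<union> (colour_class n c j \<union> colour_class n c k) = {1..n}"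
  proof -
    have "{..<3} = insert i {j, k}" using jk(1) i by auto
    then have "c x \<in> insert i {j, k}" if "x \<in> {1..n}" for x using colouring_less[OF c that] by blast
    then show ?thesis unfolding colour_class_def by blast
  qed
  finally have "real n - real (?v i) = real (?v j) + real (?v k)" by simp
  moreover have "4 * (real (?v j) * real (?v k)) \<le> (real (?v j) + real (?v k))\<^sup>2"
    using sum_squares_ge_zero[of "real (?v j) - real (?v k)" 0] by (simp add: power2_eq_square algebra_simps)
  ultimately show ?thesis using q by simp
qed

text \<open>With one class of size \<open>v\<close>, the number of crossing triples is largest when
  the other two are equal, and then it is the left-hand side. The right-hand side displays the
  deficit from the maximum at \<open>v = n / 3\<close>.\<close>

lemma class_product_identity:
  fixes v n :: real
  shows "v * (n - v)\<^sup>2 / 4 = n ^ 3 / 27 - (n / 3 - v)\<^sup>2 * (4 * n / 3 - v) / 4"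
  by (simp add: power2_eq_square power3_eq_cube field_simps)

lemma card_crossing_eq:
  assumes "c \<in> colourings n" "i < 3"
  shows "real (card (crossing n c)) = real (card (colour_class n c i)) * real (card (cross_pairs n c i))"
  unfolding crossing_eq_joins[OF assms] by (simp add: card_joins[OF order_refl order_refl])

lemma card_crossing_le_aux:
  assumes "c \<in> colourings n" "i < 3"
  shows "real (card (crossing n c)) \<le>
    real n ^ 3 / 27 - (real n / 3 - real (card (colour_class n c i)))\<^sup>2 * (real n / 12)"
proof -
  let ?v = "real (card (colour_class n c i))"
  have v: "?v \<le> real n" using card_colour_class_le by simp
  have "real (card (crossing n c)) = ?v * real (card (cross_pairs n c i))"
    by (rule card_crossing_eq[OF assms])
  also have "\<dots> \<le> ?v * ((real n - ?v)\<^sup>2 / 4)"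
    using card_cross_pairs_le[OF assms] by (intro mult_left_mono) auto
  also have "\<dots> = real n ^ 3 / 27 - (real n / 3 - ?v)\<^sup>2 * (4 * real n / 3 - ?v) / 4"
    using class_product_identity[of ?v "real n"] by simp
  \<comment> \<open>Since \<open>v\<close> is at most \<open>n\<close>, the last factor is at least
    \<open>n / 3\<close>.\<close>
  also have "\<dots> \<le> real n ^ 3 / 27 - (real n / 3 - ?v)\<^sup>2 * (real n / 3) / 4"
    using v by (intro diff_left_mono divide_right_mono mult_left_mono) auto
  finally show ?thesis by simp
qed

lemma card_crossing_le:
  assumes "c \<in> colourings n"
  shows "real (card (crossing n c)) \<le> real n ^ 3 / 27"
proof -
  have "0 \<le> (real n / 3 - real (card (colour_class n c 0)))\<^sup>2 * (real n / 12)" by simp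
  then show ?thesis using card_crossing_le_aux[OF assms, of 0] by linarith
qed

text \<open>The lower bound follows because a class has at most \<open>n\<close> vertices. For the
  upper bound, the deficit found before prevents the class from falling more than
  \<open>sqrt (12 * \<delta>) * n\<close> short of \<open>n / 3\<close>, so the other two classes
  cannot be too large.\<close>

lemma cross_pairs_balanced:
  assumes c: "c \<in> colourings n" "i < 3" and n: "n > 0" and \<delta>: "0 \<le> \<delta>" "\<delta> \<le> 1 / 54"
    and large: "real n ^ 3 / 27 - \<delta> * real n ^ 3 \<le> real (card (crossing n c))"
  shows "real n ^ 2 / 54 \<le> real (card (cross_pairs n c i))"
    "real (card (cross_pairs n c i)) \<le> (1 / 9 + (sqrt (12 * \<delta>) + 3 * \<delta>)) * real n ^ 2"
proof -
  define v where "v = real (card (colour_class n c i))"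
  define q where "q = real (card (cross_pairs n c i))"
  define u where "u = real n / 3 - v"
  have v: "0 \<le> v" "v \<le> real n" using card_colour_class_le by (auto simp: v_def)
  have q: "0 \<le> q" by (simp add: q_def)
  have "real n ^ 3 * (1 / 54) \<le> real n ^ 3 * (1 / 27 - \<delta>)" using \<delta> by (intro mult_left_mono) auto
  also have "\<dots> \<le> v * q"
    using large card_crossing_eq[OF c] by (simp add: v_def q_def algebra_simps)
  also have "\<dots> \<le> real n * q" using v q by (intro mult_right_mono)
  finally have "real n * (real n ^ 2 / 54) \<le> real n * q" by (simp add: power2_eq_square power3_eq_cube)
  then show "real n ^ 2 / 54 \<le> real (card (cross_pairs n c i))"
    using n by (simp add: q_def)
  have "u\<^sup>2 * (real n / 12) \<le> \<delta> * real n ^ 3"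
    using card_crossing_le_aux[OF c] large by (simp add: u_def v_def)
  then have "real n * u\<^sup>2 \<le> real n * (12 * \<delta> * real n ^ 2)"
    by (simp add: power2_eq_square power3_eq_cube algebra_simps)
  then have u2: "u\<^sup>2 \<le> 12 * \<delta> * real n ^ 2" using n by simp
  then have "u \<le> sqrt (12 * \<delta> * real n ^ 2)" by (rule real_le_rsqrt)
  then have u1: "u \<le> sqrt (12 * \<delta>) * real n" by (simp add: real_sqrt_mult)
  have "4 * q \<le> (2 * real n / 3 + u)\<^sup>2"
    using card_cross_pairs_le[OF c] by (simp add: u_def v_def q_def)
  then have "q \<le> real n ^ 2 / 9 + real n * u / 3 + u\<^sup>2 / 4"
    by (simp add: power2_eq_square algebra_simps)
  also have "\<dots> \<le> real n ^ 2 / 9 + real n * (sqrt (12 * \<delta>) * real n) / 3 + 12 * \<delta> * real n ^ 2 / 4"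
    using u1 u2 by (intro add_mono divide_right_mono mult_left_mono) auto
  also have "\<dots> \<le> (1 / 9 + (sqrt (12 * \<delta>) + 3 * \<delta>)) * real n ^ 2"
  proof -
    have "0 \<le> sqrt (12 * \<delta>) * real n ^ 2" using \<delta> by simp
    then show ?thesis by (simp add: power2_eq_square algebra_simps)
  qed
  finally show "real (card (cross_pairs n c i)) \<le> (1 / 9 + (sqrt (12 * \<delta>) + 3 * \<delta>)) * real n ^ 2"
    by (simp add: q_def)
qed

section \<open>Systems far from tripartite are rare\<close>

lemma eventually_quadratic_log_le_cubic:
  fixes \<gamma> K :: real
  assumes "\<gamma> > 0"
  shows "\<forall>\<^sub>F n in sequentially. real n ^ 2 + K * real n ^ 2 * log 2 (real n + 1) \<le> \<gamma> * real n ^ 3"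
proof -
  have "(\<lambda>n. 1 / real n + K * (log 2 (real n + 1) / real n)) \<longlonglongrightarrow> 0 + K * 0"
    by (intro tendsto_add tendsto_mult tendsto_const) real_asymp+
  then have "\<forall>\<^sub>F n in sequentially. 1 / real n + K * (log 2 (real n + 1) / real n) < \<gamma>"
    using assms by (intro order_tendstoD) auto
  then show ?thesis using eventually_gt_at_top[of 0]
  proof eventually_elim
    case (elim n)
    then have "(1 / real n + K * (log 2 (real n + 1) / real n)) * real n ^ 3 \<le> \<gamma> * real n ^ 3"
      by (intro mult_right_mono) auto
    also have "(1 / real n + K * (log 2 (real n + 1) / real n)) * real n ^ 3
        = real n ^ 2 + K * real n ^ 2 * log 2 (real n + 1)"
      using elim by (simp add: power2_eq_square power3_eq_cube field_simps)
    finally show ?case .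
  qed
qed

lemma Forb_eq: "Forb n F = {H. H \<subseteq> triples n \<and> \<not> contains_copy H F}"
  by (auto simp: Forb_def three_graphs_eq)

lemma small_subsets_mono: "k \<le> l \<Longrightarrow> small_subsets S k \<subseteq> small_subsets S l"
  by (auto simp: small_subsets_def)

text \<open>A container that is nearly as large as \<open>n ^ 3 / 27\<close> is nearly tripartite by
  stability, and so is every system captured by it up to few triples. Systems far from tripartite
  therefore sit in smaller containers, and naming a container takes only about
  \<open>n ^ 2 * log 2 n\<close> bits.\<close>

lemma few_far_from_tripartite:
  assumes "\<eta> > 0"
  obtains \<delta> :: real where "\<delta> > 0"
    "\<forall>\<^sub>F n in sequentially.
       real (card {H \<in> Forb n F5. \<forall>c\<in>colourings n. real (card (H - crossing n c)) > \<eta> * real n ^ 3})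
         \<le> 2 powr (real n ^ 3 / 27 - \<delta> * real n ^ 3)"
proof -
  \<comment> \<open>One number serves as sparseness and as deficit in the stability lemma, hence
    \<open>33 = 27 + 6\<close>; the bound \<open>1 / 100\<close> ensures
    \<open>18 * \<epsilon> + 3 * \<epsilon> < 2 / 3\<close>.\<close>
  define \<epsilon> where "\<epsilon> = min (1 / 100) (min (\<eta> / 4) ((\<eta> / 4)\<^sup>2 / 33))"
  have \<epsilon>: "0 < \<epsilon>" "\<epsilon> \<le> 1 / 100" "\<epsilon> \<le> \<eta> / 4" "33 * \<epsilon> \<le> (\<eta> / 4)\<^sup>2"
    using assms by (auto simp: \<epsilon>_def)
  have rt: "sqrt (27 * \<epsilon> + 6 * \<epsilon>) + \<epsilon> \<le> \<eta> / 2"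
  proof -
    have "sqrt (33 * \<epsilon>) \<le> \<eta> / 4" using \<epsilon>(4) assms by (intro real_le_lsqrt) auto
    then show ?thesis using \<epsilon>(3) by simp
  qed
  \<comment> \<open>Fingerprints have at most \<open>n / t = 1 / \<epsilon>\<close> elements, a
    bound that does not grow with \<open>n\<close>.\<close>
  define K where "K = nat \<lceil>1 / \<epsilon>\<rceil>"
  have K: "1 / \<epsilon> \<le> real K" using \<epsilon> by (simp add: K_def of_nat_ceiling)
  have "\<epsilon> / 4 > 0" using \<epsilon>(1) by simp
  from card_small_subsets_le[OF this, where 'a = "nat set"]
  obtain \<eta>' :: real where \<eta>': "\<eta>' > 0" and small: "\<forall>(S :: nat set set) M. finite S \<longrightarrow> real (card S) \<le> M \<longrightarrow>
       real (card (small_subsets S (\<eta>' * M))) \<le> 2 powr (\<epsilon> / 4 * M)"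
    by blast
  have ev1: "\<forall>\<^sub>F n in sequentially. 2 * real n ^ 2 \<le> min (\<eta> / 2) \<eta>' * real n ^ 3"
  proof -
    have "min (\<eta> / 2) \<eta>' > 0" using assms \<eta>' by simp
    then have "\<forall>\<^sub>F n in sequentially. 2 / min (\<eta> / 2) \<eta>' \<le> real n" by real_asymp
    then show ?thesis
    proof eventually_elim
      case (elim n)
      then have "2 \<le> min (\<eta> / 2) \<eta>' * real n" using \<open>min (\<eta> / 2) \<eta>' > 0\<close> by (simp add: field_simps)
      then have "2 * real n ^ 2 \<le> (min (\<eta> / 2) \<eta>' * real n) * real n ^ 2" by (intro mult_right_mono) auto
      then show ?case by (simp add: power2_eq_square power3_eq_cube mult_ac)
    qed
  qed
  have ev2: "\<forall>\<^sub>F n in sequentially. real n ^ 2 + real K * real n ^ 2 * log 2 (real n + 1) \<le> \<epsilon> / 4 * real n ^ 3"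
    using \<epsilon> by (intro eventually_quadratic_log_le_cubic) auto
  show ?thesis
  proof (rule that)
    show "\<epsilon> / 2 > 0" using \<epsilon> by simp
    show "\<forall>\<^sub>F n in sequentially.
       real (card {H \<in> Forb n F5. \<forall>c\<in>colourings n. real (card (H - crossing n c)) > \<eta> * real n ^ 3})
         \<le> 2 powr (real n ^ 3 / 27 - \<epsilon> / 2 * real n ^ 3)"
      using ev1 ev2 eventually_gt_at_top[of 0]
    proof eventually_elim
      case (elim n)
      define V where "V = {1..n}"
      define F where "F = {H \<in> Forb n F5. \<forall>c\<in>colourings n. real (card (H - crossing n c)) > \<eta> * real n ^ 3}"
      define t where "t = \<epsilon> * real n"
      define J0 where "J0 = Pow (V \<times> V) \<times> (V \<times> V \<rightarrow>\<^sub>E small_subsets V (real K))"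
      define A where "A j = container (fst j) V t (snd j)" for j
      define m where "m = (1 / 27 - \<epsilon>) * real n ^ 3"
      define J where "J = {j \<in> J0. real (card (A j)) \<le> m}"
      have V: "finite V" "card V = n" "V \<noteq> {}" using elim(3) by (auto simp: V_def)
      have t: "t > 0" using \<epsilon> elim(3) by (simp add: t_def)
      have tK: "real (card V) / t \<le> real K" using K elim(3) \<epsilon> by (simp add: V t_def)
      have fJ0: "finite J0" using V by (auto simp: J0_def intro!: finite_PiE finite_cartesian_product)
      have Atrip: "A j \<subseteq> triples n" for j by (auto simp: A_def container_def triples_def V_def)
      have "real (card F) \<le> real (card J) * 2 powr m * real (card (small_subsets (triples n) (\<eta>' * real n ^ 3)))"
      proof (rule card_cover_le[where A = A])
        show "finite J" using fJ0 by (simp add: J_def)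
        fix H assume HF: "H \<in> F"
        then have H: "H \<subseteq> triples n" "\<not> contains_copy H F5" by (auto simp: F_def Forb_eq)
        have HV: "e \<subseteq> V \<and> card e = 3" if "e \<in> H" for e using that H by (auto simp: triples_def V_def)
        have "\<exists>P S. P \<subseteq> V \<times> V \<and> S \<in> V \<times> V \<rightarrow>\<^sub>E small_subsets V (real (card V) / t) \<and>
          real (card (H - container P V t S)) \<le> 2 * real (card V) ^ 2"
          by (rule container_exists[OF V(1) t HV H(2)]) (assumption, intro exI conjI)
        then obtain P S where PS: "P \<subseteq> V \<times> V" "S \<in> V \<times> V \<rightarrow>\<^sub>E small_subsets V (real (card V) / t)"
          and few: "real (card (H - container P V t S)) \<le> 2 * real (card V) ^ 2"
          by (elim exE conjE)
        have "S \<in> V \<times> V \<rightarrow>\<^sub>E small_subsets V (real K)"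
          by (rule subsetD[OF PiE_mono PS(2)]) (rule small_subsets_mono[OF tK])
        then have J0: "(P, S) \<in> J0" using PS(1) by (simp add: J0_def)
        have few': "real (card (H - A (P, S))) \<le> 2 * real n ^ 2" using few V by (simp add: A_def)
        have "real (card (A (P, S))) \<le> m"
        proof (rule ccontr)
          assume big: "\<not> ?thesis"
          have "\<exists>c. range c \<subseteq> {..<3::nat} \<and>
            real (card {e \<in> A (P, S). \<not> inj_on c e}) \<le> (sqrt (27 * \<epsilon> + 6 * \<epsilon>) + \<epsilon>) * real (card V) ^ 3"
          proof (rule stability[where V = V and P = P and C = "A (P, S)" and \<epsilon> = \<epsilon> and \<delta> = \<epsilon>])
            show "finite V" "V \<noteq> {}" "P \<subseteq> V \<times> V" using V PS by auto
            show "e \<subseteq> V \<and> card e = 3" if "e \<in> A (P, S)" for e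
              using that by (auto simp: A_def container_def)
            show "(a, b) \<in> P" if "{a, b, c} \<in> A (P, S)" for a b c
              using that container_pair by (simp add: A_def)
            show "real (card {w \<in> nb (A (P, S)) a b. (v, w) \<in> P}) \<le> \<epsilon> * real (card V)"
              if "v \<in> nb (A (P, S)) a b" for a b v
              using that container_nb_sparse[OF V(1), of v P t S a b] V by (simp add: A_def t_def)
            show "(1 / 27 - \<epsilon>) * real (card V) ^ 3 \<le> real (card (A (P, S)))"
              using big V by (simp add: m_def)
          qed (use \<epsilon> in auto)
          then obtain c where c: "range c \<subseteq> {..<3::nat}"
            "real (card {e \<in> A (P, S). \<not> inj_on c e}) \<le> (sqrt (27 * \<epsilon> + 6 * \<epsilon>) + \<epsilon>) * real n ^ 3"
            using V by auto
          define c' where "c' = restrict c {1..n}"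
          have c'C: "c' \<in> colourings n" using c(1) by (auto simp: c'_def colourings_def)
          have inj: "inj_on c' e \<longleftrightarrow> inj_on c e" if "e \<subseteq> {1..n}" for e
            using that by (intro inj_on_cong) (auto simp: c'_def)
          have sub: "H - crossing n c' \<subseteq> (H - A (P, S)) \<union> {e \<in> A (P, S). \<not> inj_on c e}"
            using H inj by (auto simp: crossing_def triples_def)
          have "finite H" by (rule finite_subset[OF H(1) finite_triples])
          moreover have "finite (A (P, S))" by (rule finite_subset[OF Atrip finite_triples])
          ultimately have "card (H - crossing n c') \<le> card ((H - A (P, S)) \<union> {e \<in> A (P, S). \<not> inj_on c e})"
            using sub by (intro card_mono) auto
          also have "\<dots> \<le> card (H - A (P, S)) + card {e \<in> A (P, S). \<not> inj_on c e}"
            by (rule card_Un_le)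
          finally have "real (card (H - crossing n c'))
              \<le> real (card (H - A (P, S))) + real (card {e \<in> A (P, S). \<not> inj_on c e})" by linarith
          also have "\<dots> \<le> \<eta> / 2 * real n ^ 3 + \<eta> / 2 * real n ^ 3"
          proof (rule add_mono)
            have "min (\<eta> / 2) \<eta>' * real n ^ 3 \<le> \<eta> / 2 * real n ^ 3" by (intro mult_right_mono) auto
            then show "real (card (H - A (P, S))) \<le> \<eta> / 2 * real n ^ 3" using few' elim(1) by linarith
            show "real (card {e \<in> A (P, S). \<not> inj_on c e}) \<le> \<eta> / 2 * real n ^ 3"
              by (rule order_trans[OF c(2) mult_right_mono[OF rt]]) simp
          qed
          finally have "real (card (H - crossing n c')) \<le> \<eta> * real n ^ 3" by simp
          then show False using HF c'C by (force simp: F_def)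
        qed
        then have "(P, S) \<in> J" using J0 by (simp add: J_def)
        moreover have "real (card (H - A (P, S))) \<le> \<eta>' * real n ^ 3"
        proof -
          have "min (\<eta> / 2) \<eta>' * real n ^ 3 \<le> \<eta>' * real n ^ 3" by (intro mult_right_mono) auto
          then show ?thesis using few' elim(1) by linarith
        qed
        ultimately show "H \<subseteq> triples n \<and> (\<exists>j\<in>J. real (card (H - A j)) \<le> \<eta>' * real n ^ 3)"
          using H by blast
      next
        fix j assume "j \<in> J"
        then show "finite (A j) \<and> real (card (A j)) \<le> m"
          using finite_subset[OF Atrip finite_triples] by (simp add: J_def)
      qed simp
      also have "\<dots> \<le> 2 powr (\<epsilon> / 4 * real n ^ 3) * 2 powr m * 2 powr (\<epsilon> / 4 * real n ^ 3)"
      proof (intro mult_mono)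
        have "card J \<le> card J0" using fJ0 by (intro card_mono) (auto simp: J_def)
        also have "\<dots> = 2 ^ (n * n) * card (small_subsets V (real K)) ^ (n * n)"
          using V by (simp add: J0_def card_cartesian_product card_Pow card_PiE)
        also have "\<dots> \<le> 2 ^ (n * n) * ((n + 1) ^ K) ^ (n * n)"
          unfolding V_def using card_small_subsets_le_power by (intro mult_left_mono power_mono) auto
        finally have "real (card J) \<le> real (2 ^ (n * n) * ((n + 1) ^ K) ^ (n * n))"
          by (simp only: of_nat_le_iff)
        also have "\<dots> = 2 ^ (n * n) * (real n + 1) ^ (K * (n * n))"
          by (simp add: power_mult add.commute)
        also have "2 ^ (n * n) = (2::real) powr real (n * n)" by (rule powr_realpow[symmetric]) simp
        also have "(real n + 1) ^ (K * (n * n)) = (real n + 1) powr real (K * (n * n))"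
          by (rule powr_realpow[symmetric]) simp
        also have "\<dots> = 2 powr (log 2 (real n + 1) * real (K * (n * n)))"
          by (subst powr_powr[symmetric]) simp
        also have "2 powr real (n * n) * \<dots> = 2 powr (real n ^ 2 + real K * real n ^ 2 * log 2 (real n + 1))"
          by (simp add: powr_add[symmetric] power2_eq_square mult_ac)
        also have "\<dots> \<le> 2 powr (\<epsilon> / 4 * real n ^ 3)" using elim(2) by (intro powr_mono) auto
        finally show "real (card J) \<le> 2 powr (\<epsilon> / 4 * real n ^ 3)" .
        show "real (card (small_subsets (triples n) (\<eta>' * real n ^ 3))) \<le> 2 powr (\<epsilon> / 4 * real n ^ 3)"
          using small card_triples_le by simp
      qed auto
      \<comment> \<open>The containers save \<open>\<epsilon>\<close>; indices and uncovered triples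
        give back \<open>\<epsilon> / 4\<close> each.\<close>
      also have "\<dots> = 2 powr (real n ^ 3 / 27 - \<epsilon> / 2 * real n ^ 3)"
        by (simp add: powr_add[symmetric] m_def algebra_simps)
      finally show ?case by (simp add: F_def)
    qed
  qed
qed

section \<open>Vertex links\<close>

definition link :: "'a set set \<Rightarrow> 'a \<Rightarrow> 'a set set" where
  "link H y = {p. y \<notin> p \<and> insert y p \<in> H}"

text \<open>A one-sided quasirandomness condition. One side of a box is an arbitrary set of crossing
  pairs, because parts of links will be inserted there.\<close>

definition dense_crossing :: "nat \<Rightarrow> (nat \<Rightarrow> nat) \<Rightarrow> nat set set \<Rightarrow> real \<Rightarrow> real \<Rightarrow> bool" where
  "dense_crossing n c H \<theta> \<kappa> \<longleftrightarrow> (\<forall>i<3. \<forall>U\<subseteq>colour_class n c i. \<forall>G\<subseteq>cross_pairs n c i.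
     \<theta> * real n \<le> real (card U) \<longrightarrow> \<theta> * real n ^ 2 \<le> real (card G) \<longrightarrow>
     \<kappa> * real n ^ 3 < real (card (H \<inter> joins U G)))"

lemma link_subset_pairs: "H \<subseteq> triples n \<Longrightarrow> link H y \<subseteq> pairs n"
proof
  fix p assume "H \<subseteq> triples n" "p \<in> link H y"
  then have p: "y \<notin> p" "insert y p \<subseteq> {1..n}" "card (insert y p) = 3" by (auto simp: link_def triples_def)
  then have "finite p" using finite_subset by auto
  then show "p \<in> pairs n" using p by (auto simp: pairs_def)
qed

lemma finite_link: "H \<subseteq> triples n \<Longrightarrow> finite (link H y)"
  using link_subset_pairs finite_subset finite_pairs by metis

text \<open>A box that \<open>H\<close> nearly misses removes \<open>\<theta> ^ 2 * n ^ 3\<close>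
  triples from the container, while naming the box costs only about \<open>n ^ 2\<close> bits. As
  \<open>\<kappa>0\<close> depends on \<open>\<theta>\<close> alone and the threshold for
  \<open>n\<close> is uniform, \<open>\<kappa>\<close> and \<open>\<eta>\<close> can be fixed
  afterwards.\<close>

lemma few_not_dense:
  assumes "\<theta> > 0"
  shows "\<exists>\<kappa>0 > 0. \<forall>\<^sub>F n in sequentially. \<forall>\<kappa> \<eta>. \<kappa> + \<eta> \<le> \<kappa>0 \<longrightarrow>
    real (card {H. H \<subseteq> triples n \<and> (\<exists>c\<in>colourings n. real (card (H - crossing n c)) \<le> \<eta> * real n ^ 3 \<and>
        \<not> dense_crossing n c H \<theta> \<kappa>)})
      \<le> 2 powr (real n ^ 3 / 27 - \<theta>\<^sup>2 / 2 * real n ^ 3)"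
proof -
  \<comment> \<open>A quarter of the saving pays for the choice of the box, another quarter for the
    triples outside the container.\<close>
  define \<epsilon> where "\<epsilon> = \<theta>\<^sup>2 / 4"
  have \<epsilon>: "\<epsilon> > 0" using assms by (simp add: \<epsilon>_def)
  from card_small_subsets_le[OF this, where 'a = "nat set"]
  obtain \<kappa>0 :: real where \<kappa>0: "\<kappa>0 > 0" and small: "\<forall>(S :: nat set set) M. finite S \<longrightarrow> real (card S) \<le> M \<longrightarrow>
       real (card (small_subsets S (\<kappa>0 * M))) \<le> 2 powr (\<epsilon> * M)"
    by blast
  have "\<forall>\<^sub>F n in sequentially. 3 * real n + 2 + real n ^ 2 \<le> \<epsilon> * real n ^ 3"
    using \<epsilon> by real_asymp
  then have "\<forall>\<^sub>F n in sequentially. \<forall>\<kappa> \<eta>. \<kappa> + \<eta> \<le> \<kappa>0 \<longrightarrow>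
    real (card {H. H \<subseteq> triples n \<and> (\<exists>c\<in>colourings n. real (card (H - crossing n c)) \<le> \<eta> * real n ^ 3 \<and>
        \<not> dense_crossing n c H \<theta> \<kappa>)})
      \<le> 2 powr (real n ^ 3 / 27 - \<theta>\<^sup>2 / 2 * real n ^ 3)"
  proof eventually_elim
    case (elim n)
    show ?case
    proof (intro allI impI)
      fix \<kappa> \<eta> :: real assume \<kappa>\<eta>: "\<kappa> + \<eta> \<le> \<kappa>0"
      define F where "F = {H. H \<subseteq> triples n \<and> (\<exists>c\<in>colourings n.
        real (card (H - crossing n c)) \<le> \<eta> * real n ^ 3 \<and> \<not> dense_crossing n c H \<theta> \<kappa>)}"
      define J0 where "J0 = colourings n \<times> {..<3::nat} \<times> Pow {1..n} \<times> Pow (pairs n)"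
      define J where "J = {(c, i, U, G). (c, i, U, G) \<in> J0 \<and> U \<subseteq> colour_class n c i \<and> G \<subseteq> cross_pairs n c i \<and>
        \<theta> * real n \<le> real (card U) \<and> \<theta> * real n ^ 2 \<le> real (card G)}"
      define A where "A = (\<lambda>(c, i :: nat, U, G). crossing n c - joins U G)"
      define m where "m = real n ^ 3 / 27 - \<theta>\<^sup>2 * real n ^ 3"
      have fJ0: "finite J0" by (simp add: J0_def)
      have JJ0: "J \<subseteq> J0" by (auto simp: J_def)
      have "real (card F) \<le> real (card J) * 2 powr m * real (card (small_subsets (triples n) (\<kappa>0 * real n ^ 3)))"
      proof (rule card_cover_le[where A = A])
        show "finite J" using fJ0 JJ0 finite_subset by blast
        fix H assume "H \<in> F"
        then obtain c where H: "H \<subseteq> triples n" and c: "c \<in> colourings n"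
          "real (card (H - crossing n c)) \<le> \<eta> * real n ^ 3" "\<not> dense_crossing n c H \<theta> \<kappa>"
          by (auto simp: F_def)
        then obtain i U G where iUG: "i < 3" "U \<subseteq> colour_class n c i" "G \<subseteq> cross_pairs n c i"
          "\<theta> * real n \<le> real (card U)" "\<theta> * real n ^ 2 \<le> real (card G)"
          "real (card (H \<inter> joins U G)) \<le> \<kappa> * real n ^ 3"
          by (auto simp: dense_crossing_def not_less)
        have inJ: "(c, i, U, G) \<in> J"
          using iUG c by (auto simp: J_def J0_def colour_class_def cross_pairs_def)
        have fH: "finite H" using H finite_subset finite_triples by metis
        have "H - A (c, i, U, G) \<subseteq> (H - crossing n c) \<union> (H \<inter> joins U G)" by (auto simp: A_def)
        then have "card (H - A (c, i, U, G)) \<le> card ((H - crossing n c) \<union> (H \<inter> joins U G))"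
          using fH by (intro card_mono) auto
        also have "\<dots> \<le> card (H - crossing n c) + card (H \<inter> joins U G)" by (rule card_Un_le)
        finally have "real (card (H - A (c, i, U, G))) \<le> \<eta> * real n ^ 3 + \<kappa> * real n ^ 3"
          using c(2) iUG(6) by linarith
        also have "\<dots> = (\<kappa> + \<eta>) * real n ^ 3" by (simp add: algebra_simps)
        also have "\<dots> \<le> \<kappa>0 * real n ^ 3" using \<kappa>\<eta> by (intro mult_right_mono) auto
        finally show "H \<subseteq> triples n \<and> (\<exists>j\<in>J. real (card (H - A j)) \<le> \<kappa>0 * real n ^ 3)"
          using H inJ by blast
      next
        fix j assume "j \<in> J"
        then obtain c i U G where j: "j = (c, i, U, G)" and c: "c \<in> colourings n" "i < 3"
          and UG: "U \<subseteq> colour_class n c i" "G \<subseteq> cross_pairs n c i"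
          "\<theta> * real n \<le> real (card U)" "\<theta> * real n ^ 2 \<le> real (card G)"
          by (auto simp: J_def J0_def)
        have fin: "finite U" "finite G" using UG finite_subset finite_colour_class finite_cross_pairs by metis+
        have sub: "joins U G \<subseteq> crossing n c"
          unfolding crossing_eq_joins[OF c] using UG by (auto simp: joins_def)
        have "\<theta>\<^sup>2 * real n ^ 3 = (\<theta> * real n) * (\<theta> * real n ^ 2)"
          by (simp add: power2_eq_square power3_eq_cube)
        also have "\<dots> \<le> real (card U) * real (card G)" using UG assms by (intro mult_mono) auto
        also have "\<dots> = real (card (joins U G))" by (simp add: card_joins[OF UG(1,2)])
        finally have big: "\<theta>\<^sup>2 * real n ^ 3 \<le> real (card (joins U G))" .
        have "card (crossing n c - joins U G) + card (joins U G) = card (crossing n c)"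
          using card_Diff_subset[OF finite_joins[OF fin] sub] card_mono[OF finite_crossing sub] by simp
        then have "real (card (crossing n c - joins U G)) \<le> m"
          using big card_crossing_le[OF c(1)] by (simp add: m_def)
        then show "finite (A j) \<and> real (card (A j)) \<le> m" by (simp add: A_def j)
      qed simp
      also have "\<dots> \<le> 2 powr (\<epsilon> * real n ^ 3) * 2 powr m * 2 powr (\<epsilon> * real n ^ 3)"
      proof (intro mult_mono)
        have "card J \<le> card J0" using fJ0 JJ0 by (rule card_mono)
        also have "\<dots> = 3 ^ n * (3 * (2 ^ n * 2 ^ card (pairs n)))"
          by (simp add: J0_def card_cartesian_product card_Pow)
        finally have "real (card J) \<le> real (3 ^ n * (3 * (2 ^ n * 2 ^ card (pairs n))))"
          by (simp only: of_nat_le_iff)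
        also have "\<dots> \<le> 4 ^ n * (4 * (2 ^ n * 2 powr (real n ^ 2)))"
        proof -
          have "(3::real) ^ n \<le> 4 ^ n" by (rule power_mono) auto
          moreover have "2 powr real (card (pairs n)) \<le> 2 powr (real n ^ 2)"
            using card_pairs_le by (intro powr_mono) auto
          then have "(2::real) ^ card (pairs n) \<le> 2 powr (real n ^ 2)" by (simp add: powr_realpow)
          ultimately have "(3::real) ^ n * (3 * (2 ^ n * 2 ^ card (pairs n))) \<le> 4 ^ n * (4 * (2 ^ n * 2 powr (real n ^ 2)))"
            by (intro mult_mono) auto
          then show ?thesis by simp
        qed
        also have "\<dots> = 2 powr (3 * real n + 2 + real n ^ 2)"
        proof -
          have "(4::real) ^ n * (4 * 2 ^ n) = 2 ^ (3 * n + 2)"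
          proof -
            have "(4::real) ^ n = (2 ^ 2) ^ n" by simp
            also have "\<dots> = 2 ^ (2 * n)" by (simp only: power_mult)
            finally have "(4::real) ^ n * (4 * 2 ^ n) = 2 ^ (2 * n) * 2 ^ 2 * 2 ^ n" by simp
            also have "\<dots> = 2 ^ (2 * n + 2 + n)" by (simp only: power_add)
            finally show ?thesis by (simp add: algebra_simps)
          qed
          also have "\<dots> = 2 powr real (3 * n + 2)" by (rule powr_realpow[symmetric]) simp
          finally have "(4::real) ^ n * (4 * (2 ^ n * 2 powr (real n ^ 2))) = 2 powr real (3 * n + 2) * 2 powr (real n ^ 2)"
            by (simp only: mult.assoc[symmetric])
          also have "\<dots> = 2 powr (real (3 * n + 2) + real n ^ 2)" by (rule powr_add[symmetric])
          finally show ?thesis by (simp add: add_ac)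
        qed
        also have "\<dots> \<le> 2 powr (\<epsilon> * real n ^ 3)" using elim by (intro powr_mono) auto
        finally show "real (card J) \<le> 2 powr (\<epsilon> * real n ^ 3)" .
        show "real (card (small_subsets (triples n) (\<kappa>0 * real n ^ 3))) \<le> 2 powr (\<epsilon> * real n ^ 3)"
          using small card_triples_le by simp
      qed auto
      also have "\<dots> = 2 powr (real n ^ 3 / 27 - \<theta>\<^sup>2 / 2 * real n ^ 3)"
        by (simp add: powr_add[symmetric] m_def \<epsilon>_def algebra_simps)
      finally show "real (card {H. H \<subseteq> triples n \<and> (\<exists>c\<in>colourings n. real (card (H - crossing n c)) \<le> \<eta> * real n ^ 3 \<and>
        \<not> dense_crossing n c H \<theta> \<kappa>)}) \<le> 2 powr (real n ^ 3 / 27 - \<theta>\<^sup>2 / 2 * real n ^ 3)"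
        by (simp add: F_def)
    qed
  qed
  then show ?thesis using \<kappa>0 by blast
qed

text \<open>The crossing triples of \<open>c\<close> are themselves the container, and there are
  only \<open>3 ^ n\<close> of these, so any cubic shortfall from \<open>n ^ 3 / 27\<close> survives
  in the count.\<close>

lemma few_unbalanced:
  assumes "\<delta> > 0"
  shows "\<exists>\<eta>0 > 0. \<forall>\<^sub>F n in sequentially. \<forall>\<eta>\<le>\<eta>0.
    real (card {H. H \<subseteq> triples n \<and> (\<exists>c\<in>colourings n. real (card (H - crossing n c)) \<le> \<eta> * real n ^ 3 \<and>
        real (card (crossing n c)) < real n ^ 3 / 27 - \<delta> * real n ^ 3)})
      \<le> 2 powr (real n ^ 3 / 27 - \<delta> / 2 * real n ^ 3)"
proof -
  define \<epsilon> where "\<epsilon> = \<delta> / 4"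
  have \<epsilon>: "\<epsilon> > 0" using assms by (simp add: \<epsilon>_def)
  from card_small_subsets_le[OF this, where 'a = "nat set"]
  obtain \<eta>0 :: real where \<eta>0: "\<eta>0 > 0" and small: "\<forall>(S :: nat set set) M. finite S \<longrightarrow> real (card S) \<le> M \<longrightarrow>
       real (card (small_subsets S (\<eta>0 * M))) \<le> 2 powr (\<epsilon> * M)"
    by blast
  have "\<forall>\<^sub>F n in sequentially. 2 * real n \<le> \<epsilon> * real n ^ 3"
    using \<epsilon> by real_asymp
  then have "\<forall>\<^sub>F n in sequentially. \<forall>\<eta>\<le>\<eta>0.
    real (card {H. H \<subseteq> triples n \<and> (\<exists>c\<in>colourings n. real (card (H - crossing n c)) \<le> \<eta> * real n ^ 3 \<and>
        real (card (crossing n c)) < real n ^ 3 / 27 - \<delta> * real n ^ 3)})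
      \<le> 2 powr (real n ^ 3 / 27 - \<delta> / 2 * real n ^ 3)"
  proof eventually_elim
    case (elim n)
    show ?case
    proof (intro allI impI)
      fix \<eta> :: real assume \<eta>: "\<eta> \<le> \<eta>0"
      define F where "F = {H. H \<subseteq> triples n \<and> (\<exists>c\<in>colourings n.
        real (card (H - crossing n c)) \<le> \<eta> * real n ^ 3 \<and>
        real (card (crossing n c)) < real n ^ 3 / 27 - \<delta> * real n ^ 3)}"
      define m where "m = real n ^ 3 / 27 - \<delta> * real n ^ 3"
      define J where "J = {c \<in> colourings n. real (card (crossing n c)) \<le> m}"
      have "real (card F) \<le> real (card J) * 2 powr m * real (card (small_subsets (triples n) (\<eta>0 * real n ^ 3)))"
      proof (rule card_cover_le[where A = "crossing n"])
        show "finite J" by (simp add: J_def)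
        fix H assume "H \<in> F"
        then obtain c where H: "H \<subseteq> triples n" and c': "c \<in> colourings n"
          "real (card (H - crossing n c)) \<le> \<eta> * real n ^ 3"
          "real (card (crossing n c)) < real n ^ 3 / 27 - \<delta> * real n ^ 3"
          unfolding F_def by blast
        then have c: "c \<in> J" "real (card (H - crossing n c)) \<le> \<eta> * real n ^ 3"
          by (auto simp: J_def m_def)
        have "\<eta> * real n ^ 3 \<le> \<eta>0 * real n ^ 3" using \<eta> by (intro mult_right_mono) auto
        then have "real (card (H - crossing n c)) \<le> \<eta>0 * real n ^ 3" using c(2) by linarith
        then show "H \<subseteq> triples n \<and> (\<exists>j\<in>J. real (card (H - crossing n j)) \<le> \<eta>0 * real n ^ 3)"
          using H c(1) by blast
      qed (auto simp: J_def)
      also have "\<dots> \<le> 2 powr (\<epsilon> * real n ^ 3) * 2 powr m * 2 powr (\<epsilon> * real n ^ 3)"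
      proof (intro mult_mono)
        have "card J \<le> card (colourings n)" by (intro card_mono) (auto simp: J_def)
        then have "card J \<le> 3 ^ n" by simp
        then have "real (card J) \<le> real (3 ^ n)" by (simp only: of_nat_le_iff)
        also have "\<dots> \<le> 4 ^ n" by (simp add: power_mono)
        also have "\<dots> = 2 powr (2 * real n)" by (simp add: powr_powr[symmetric] powr_realpow)
        also have "\<dots> \<le> 2 powr (\<epsilon> * real n ^ 3)" using elim by (intro powr_mono) auto
        finally show "real (card J) \<le> 2 powr (\<epsilon> * real n ^ 3)" .
        show "real (card (small_subsets (triples n) (\<eta>0 * real n ^ 3))) \<le> 2 powr (\<epsilon> * real n ^ 3)"
          using small card_triples_le by simp
      qed auto
      also have "\<dots> = 2 powr (real n ^ 3 / 27 - \<delta> / 2 * real n ^ 3)"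
        by (simp add: powr_add[symmetric] m_def \<epsilon>_def algebra_simps)
      finally show "real (card {H. H \<subseteq> triples n \<and> (\<exists>c\<in>colourings n. real (card (H - crossing n c)) \<le> \<eta> * real n ^ 3 \<and>
        real (card (crossing n c)) < real n ^ 3 / 27 - \<delta> * real n ^ 3)}) \<le> 2 powr (real n ^ 3 / 27 - \<delta> / 2 * real n ^ 3)"
        by (simp add: F_def)
    qed
  qed
  then show ?thesis using \<eta>0 by blast
qed

section \<open>Links in \<open>F5\<close>-free systems with dense crossing triples\<close>

lemma links_meet_in_star:
  assumes "H \<subseteq> triples n" "\<not> contains_copy H F5" "{y, u, w} \<in> H"
    and p: "p \<in> link H y" "p \<in> link H u"
  shows "w \<in> p"
proof (rule ccontr)
  assume w: "w \<notin> p"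
  have unif: "card e = 3" if "e \<in> H" for e using that assms(1) by (auto simp: triples_def)
  have "card p = 2" using link_subset_pairs[OF assms(1)] p(1) by (auto simp: pairs_def)
  then obtain a b where ab: "p = {a, b}" by (auto simp: card_2_iff)
  \<comment> \<open>If \<open>w\<close> is outside \<open>{a, b}\<close>, the triples
    \<open>{a, b, y}\<close>, \<open>{a, b, u}\<close> and \<open>{y, u, w}\<close> form a copy of
    \<open>F5\<close>.\<close>
  have "insert y {a, b} = {a, b, y}" "insert u {a, b} = {a, b, u}" by auto
  then have "{a, b, y} \<in> H" "{a, b, u} \<in> H" using p by (auto simp: link_def ab)
  moreover have "y \<noteq> u" using card_eq_3D[OF unif[OF assms(3)]] by simp
  ultimately show False
    using F5_freeD[OF assms(2) unif _ _ assms(3), of a b] w ab by auto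
qed

lemma card_pairs_through:
  assumes "G \<subseteq> pairs n" "\<And>p. p \<in> G \<Longrightarrow> w \<in> p"
  shows "card G \<le> n"
proof -
  have "G \<subseteq> (\<lambda>x. {w, x}) ` {1..n}"
  proof
    fix p assume p: "p \<in> G"
    then have "card p = 2" "p \<subseteq> {1..n}" "w \<in> p" using assms by (auto simp: pairs_def)
    then obtain x where "p = {w, x}" by (auto simp: card_2_iff)
    then show "p \<in> (\<lambda>x. {w, x}) ` {1..n}" using \<open>p \<subseteq> {1..n}\<close> by auto
  qed
  then have "card G \<le> card {1..n}" by (intro surj_card_le) auto
  then show ?thesis by simp
qed

text \<open>Let \<open>U\<close> be the neighbours of \<open>y\<close> in the class and
  \<open>G\<close> its crossing link pairs. If both were large, density would give more than
  \<open>n ^ 2\<close> triples \<open>insert u p\<close> in \<open>H\<close>. But then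
  \<open>p\<close> lies in the links of both \<open>y\<close> and \<open>u\<close>; these meet in a
  star, which allows at most \<open>n\<close> such pairs for each \<open>u\<close>.\<close>

lemma few_in_class_if_many_cross:
  assumes H: "H \<subseteq> triples n" "\<not> contains_copy H F5"
    and dense: "dense_crossing n c H \<theta> \<kappa>" and \<kappa>: "real n ^ 2 \<le> \<kappa> * real n ^ 3"
    and i: "i < 3" and many: "\<theta> * real n ^ 2 \<le> real (card (link H y \<inter> cross_pairs n c i))"
  shows "real (card {u \<in> colour_class n c i. \<exists>w. {y, u, w} \<in> H}) < \<theta> * real n"
proof (rule ccontr)
  define U where "U = {u \<in> colour_class n c i. \<exists>w. {y, u, w} \<in> H}"
  define G where "G = link H y \<inter> cross_pairs n c i"
  assume "\<not> ?thesis"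
  then have "\<kappa> * real n ^ 3 < real (card (H \<inter> joins U G))"
    using dense many i unfolding dense_crossing_def U_def G_def by (simp add: not_less)
  moreover have "card (H \<inter> joins U G) \<le> n * n"
  proof -
    have fU: "finite U" "card U \<le> n"
      using card_mono[of "colour_class n c i" U] card_colour_class_le[of n c i] by (auto simp: U_def)
    have "H \<inter> joins U G \<subseteq> (\<Union>u\<in>U. insert u ` (link H y \<inter> link H u))"
    proof
      fix e assume "e \<in> H \<inter> joins U G"
      then obtain u p where up: "e \<in> H" "e = insert u p" "u \<in> U" "p \<in> G" by (auto simp: joins_def)
      have "c u = i" "i \<notin> c ` p" using up by (auto simp: U_def G_def colour_class_def cross_pairs_def)
      then have "u \<notin> p" by auto
      then have "p \<in> link H y \<inter> link H u" using up by (auto simp: link_def G_def)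
      then show "e \<in> (\<Union>u\<in>U. insert u ` (link H y \<inter> link H u))" using up by blast
    qed
    moreover have "finite (link H y \<inter> link H u)" for u using finite_link[OF H(1)] by blast
    ultimately have "card (H \<inter> joins U G) \<le> card (\<Union>u\<in>U. insert u ` (link H y \<inter> link H u))"
      using fU by (intro card_mono) auto
    also have "\<dots> \<le> (\<Sum>u\<in>U. card (insert u ` (link H y \<inter> link H u)))" by (rule card_UN_le[OF fU(1)])
    also have "\<dots> \<le> (\<Sum>u\<in>U. n)"
    proof (rule sum_mono)
      fix u assume "u \<in> U"
      then obtain w where w: "{y, u, w} \<in> H" by (auto simp: U_def)
      have "card (insert u ` (link H y \<inter> link H u)) \<le> card (link H y \<inter> link H u)"
        using finite_link[OF H(1)] by (intro card_image_le) blast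
      also have "\<dots> \<le> n"
        using link_subset_pairs[OF H(1)] links_meet_in_star[OF H w] by (intro card_pairs_through[of _ _ w]) auto
      finally show "card (insert u ` (link H y \<inter> link H u)) \<le> n" .
    qed
    also have "\<dots> \<le> n * n" using fU by simp
    finally show ?thesis .
  qed
  then have "real (card (H \<inter> joins U G)) \<le> real n ^ 2"
    by (metis of_nat_le_iff of_nat_mult power2_eq_square)
  ultimately show False using \<kappa> by linarith
qed

text \<open>Density is used at two scales. At the coarse one, few vertices of the class have a small
  crossing link; at the fine one, any other vertex has few neighbours in its own class by the
  previous lemma. A link pair inside the class consists of two such neighbours.\<close>

lemma few_link_pairs_inside_class:
  assumes H: "H \<subseteq> triples n" "\<not> contains_copy H F5"
    and dense: "dense_crossing n c H \<theta> \<theta>'" "dense_crossing n c H \<theta>' \<kappa>" and \<kappa>: "real n ^ 2 \<le> \<kappa> * real n ^ 3"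
    and i: "i < 3" and large: "\<theta> * real n ^ 2 \<le> real (card (cross_pairs n c i))" and "\<theta>' \<ge> 0"
  shows "real (card {p \<in> link H y. p \<subseteq> colour_class n c i}) \<le> (\<theta> + \<theta>') * real n ^ 2"
proof -
  define W where "W = {w \<in> colour_class n c i. real (card (link H w \<inter> cross_pairs n c i)) < \<theta>' * real n ^ 2}"
  define N where "N w = {u \<in> colour_class n c i. \<exists>w'. {w, u, w'} \<in> H}" for w
  have fW: "finite W" "card W \<le> n" "W \<subseteq> colour_class n c i"
    using card_mono[of "colour_class n c i" W] card_colour_class_le[of n c i] by (auto simp: W_def)
  have cW: "real (card W) \<le> \<theta> * real n"
  proof (rule ccontr)
    assume "\<not> ?thesis"
    then have "\<theta>' * real n ^ 3 < real (card (H \<inter> joins W (cross_pairs n c i)))"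
      using dense(1) large i fW(3) unfolding dense_crossing_def by simp
    also have "\<dots> \<le> real (\<Sum>w\<in>W. card (link H w \<inter> cross_pairs n c i))"
    proof -
      have "H \<inter> joins W (cross_pairs n c i) \<subseteq> (\<Union>w\<in>W. insert w ` (link H w \<inter> cross_pairs n c i))"
      proof
        fix e assume "e \<in> H \<inter> joins W (cross_pairs n c i)"
        then obtain u p where up: "e \<in> H" "e = insert u p" "u \<in> W" "p \<in> cross_pairs n c i" by (auto simp: joins_def)
        have "c u = i" "i \<notin> c ` p" using up by (auto simp: W_def colour_class_def cross_pairs_def)
        then have "u \<notin> p" by auto
        then have "p \<in> link H u \<inter> cross_pairs n c i" using up by (auto simp: link_def)
        then show "e \<in> (\<Union>w\<in>W. insert w ` (link H w \<inter> cross_pairs n c i))" using up by blast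
      qed
      then have "card (H \<inter> joins W (cross_pairs n c i)) \<le> card (\<Union>w\<in>W. insert w ` (link H w \<inter> cross_pairs n c i))"
        using fW by (intro card_mono) auto
      also have "\<dots> \<le> (\<Sum>w\<in>W. card (insert w ` (link H w \<inter> cross_pairs n c i)))" by (rule card_UN_le[OF fW(1)])
      also have "\<dots> \<le> (\<Sum>w\<in>W. card (link H w \<inter> cross_pairs n c i))"
        by (intro sum_mono card_image_le) simp
      finally show ?thesis by (simp only: of_nat_le_iff)
    qed
    also have "\<dots> = (\<Sum>w\<in>W. real (card (link H w \<inter> cross_pairs n c i)))" by simp
    also have "\<dots> \<le> (\<Sum>w\<in>W. \<theta>' * real n ^ 2)" by (intro sum_mono) (auto simp: W_def)
    also have "\<dots> = real (card W) * (\<theta>' * real n ^ 2)" by simp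
    also have "\<dots> \<le> real n * (\<theta>' * real n ^ 2)" using fW \<open>\<theta>' \<ge> 0\<close> by (intro mult_right_mono) auto
    finally show False by (simp add: power2_eq_square power3_eq_cube mult_ac)
  qed
  have N: "real (card (N w)) \<le> \<theta>' * real n" if "w \<in> colour_class n c i - W" for w
  proof -
    have "\<theta>' * real n ^ 2 \<le> real (card (link H w \<inter> cross_pairs n c i))"
      using that by (auto simp: W_def not_less)
    from few_in_class_if_many_cross[OF H dense(2) \<kappa> i this] show ?thesis by (simp add: N_def)
  qed
  have fN: "finite (N w)" for w by (simp add: N_def)
  define S where "S = W \<times> {1..n} \<union> (SIGMA w:colour_class n c i - W. N w)"
  have fS: "finite S" using fW fN by (auto simp: S_def)
  have "{p \<in> link H y. p \<subseteq> colour_class n c i} \<subseteq> (\<lambda>(w, u). {w, u}) ` S"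
  proof clarify
    fix p assume p: "p \<in> link H y" "p \<subseteq> colour_class n c i"
    then have "card p = 2" using link_subset_pairs[OF H(1)] by (auto simp: pairs_def)
    then obtain w u where wu: "p = {w, u}" by (auto simp: card_2_iff)
    have "{w, u, y} = insert y p" using wu by auto
    then have "{w, u, y} \<in> H" using p by (simp add: link_def)
    then have "(w, u) \<in> S" using p(2) wu by (auto simp: S_def N_def colour_class_def)
    then show "p \<in> (\<lambda>(w, u). {w, u}) ` S" using wu by (intro image_eqI[of _ _ "(w, u)"]) auto
  qed
  then have "card {p \<in> link H y. p \<subseteq> colour_class n c i} \<le> card S" using fS by (rule surj_card_le[rotated])
  also have "\<dots> \<le> card (W \<times> {1..n}) + card (SIGMA w:colour_class n c i - W. N w)"
    unfolding S_def by (rule card_Un_le)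
  finally have "real (card {p \<in> link H y. p \<subseteq> colour_class n c i})
      \<le> real (card (W \<times> {1..n}) + card (SIGMA w:colour_class n c i - W. N w))" by (simp only: of_nat_le_iff)
  also have "\<dots> = real (card W) * real n + (\<Sum>w\<in>colour_class n c i - W. real (card (N w)))"
    using fN by (simp add: card_cartesian_product)
  also have "(\<Sum>w\<in>colour_class n c i - W. real (card (N w))) \<le> (\<Sum>w\<in>colour_class n c i - W. \<theta>' * real n)"
    using N by (intro sum_mono) auto
  also have "\<dots> = real (card (colour_class n c i - W)) * (\<theta>' * real n)" by simp
  also have "\<dots> \<le> real n * (\<theta>' * real n)"
    using \<open>\<theta>' \<ge> 0\<close> card_mono[of "colour_class n c i" "colour_class n c i - W"] card_colour_class_le[of n c i]
    by (intro mult_right_mono) auto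
  also have "real (card W) * real n \<le> (\<theta> * real n) * real n"
    using cW by (intro mult_right_mono) auto
  finally show ?thesis by (simp add: power2_eq_square algebra_simps)
qed

lemma link_pair_cases:
  assumes H: "H \<subseteq> triples n" and c: "c \<in> colourings n" and p: "p \<in> link H y"
  shows "(\<exists>j<3. p \<subseteq> colour_class n c j) \<or> (\<exists>i<3. p \<in> cross_pairs n c i)"
    and "i < 3 \<Longrightarrow> p \<inter> colour_class n c i = {} \<Longrightarrow> p \<notin> cross_pairs n c i \<Longrightarrow> \<exists>j<3. p \<subseteq> colour_class n c j"
proof -
  have p': "card p = 2" "p \<subseteq> {1..n}" using link_subset_pairs[OF H] p by (auto simp: pairs_def)
  then obtain a b where ab: "p = {a, b}" "a \<noteq> b" by (auto simp: card_2_iff)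
  have ca: "c a < 3" "c b < 3" using ab p' colouring_less[OF c] by auto
  have same: "\<exists>j<3. p \<subseteq> colour_class n c j" if "c a = c b"
    using that ca p' ab by (intro exI[of _ "c a"]) (auto simp: colour_class_def)
  have diff: "p \<in> cross_pairs n c i" if "i < 3" "c a \<noteq> c b" "i \<noteq> c a" "i \<noteq> c b" for i
  proof -
    have "{c a, c b} = {..<3} - {i}"
      using that ca by (intro card_subset_eq) auto
    then show ?thesis using p' ab by (auto simp: cross_pairs_def pairs_def)
  qed
  have "\<exists>i<3. i \<noteq> c a \<and> i \<noteq> c b"
  proof -
    have "\<not> {..<3} \<subseteq> {c a, c b}"
      using card_mono[of "{c a, c b}" "{..<3::nat}"] by (auto simp: card_insert_if split: if_splits)
    then show ?thesis by auto
  qed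
  then show "(\<exists>j<3. p \<subseteq> colour_class n c j) \<or> (\<exists>i<3. p \<in> cross_pairs n c i)"
    using same diff by blast
  assume "i < 3" "p \<inter> colour_class n c i = {}" "p \<notin> cross_pairs n c i"
  moreover have "i \<noteq> c a" "i \<noteq> c b"
    using \<open>p \<inter> colour_class n c i = {}\<close> p' ab by (auto simp: colour_class_def)
  ultimately show "\<exists>j<3. p \<subseteq> colour_class n c j" using same diff by blast
qed

lemma card_UN_lessThan3_le:
  assumes "\<And>i. i < 3 \<Longrightarrow> real (card (B i)) \<le> b"
  shows "real (card (\<Union>i<3::nat. B i)) \<le> 3 * b"
proof -
  have "card (\<Union>i<3. B i) \<le> (\<Sum>i<3. card (B i))" by (rule card_UN_le) simp
  then have "real (card (\<Union>i<3. B i)) \<le> (\<Sum>i<3. real (card (B i)))" by (metis of_nat_le_iff of_nat_sum)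
  also have "\<dots> \<le> (\<Sum>i<3::nat. b)" using assms by (intro sum_mono) auto
  finally show ?thesis by simp
qed

text \<open>The constant is \<open>9 = 6 + 3\<close>. Pairs inside the three classes cost
  \<open>2 * \<theta>\<close> per class. If many link pairs lie in one crossing set, then few of the
  link pairs touch the class opposite to it; otherwise all three crossing sets contain few. Either
  way the rest costs at most \<open>3 * \<theta>\<close>.\<close>

lemma link_near_cross_pairs:
  assumes H: "H \<subseteq> triples n" "\<not> contains_copy H F5" and c: "c \<in> colourings n"
    and dense: "dense_crossing n c H \<theta> \<theta>'" "dense_crossing n c H \<theta>' \<kappa>" and \<kappa>: "real n ^ 2 \<le> \<kappa> * real n ^ 3"
    and large: "\<And>i. i < 3 \<Longrightarrow> \<theta> * real n ^ 2 \<le> real (card (cross_pairs n c i))" and \<theta>': "0 \<le> \<theta>'" "\<theta>' \<le> \<theta>"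
  shows "\<exists>i<3. real (card (link H y - cross_pairs n c i)) \<le> 9 * \<theta> * real n ^ 2"
proof -
  define D where "D = (\<Union>j<3. {p \<in> link H y. p \<subseteq> colour_class n c j})"
  have fl: "finite (link H y)" by (rule finite_link[OF H(1)])
  have \<theta>n: "\<theta>' * real n ^ 2 \<le> \<theta> * real n ^ 2" using \<theta>' by (intro mult_right_mono) auto
  have "real (card D) \<le> 3 * ((\<theta> + \<theta>') * real n ^ 2)"
    unfolding D_def using few_link_pairs_inside_class[OF H dense \<kappa>] large \<theta>'
    by (intro card_UN_lessThan3_le) auto
  then have D: "real (card D) \<le> 6 * \<theta> * real n ^ 2" using \<theta>n by (simp add: algebra_simps)
  have fD: "finite D" using fl by (simp add: D_def)
  show ?thesis
  proof (cases "\<exists>i<3. \<theta>' * real n ^ 2 \<le> real (card (link H y \<inter> cross_pairs n c i))")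
    case True
    then obtain i where i: "i < 3" and many: "\<theta>' * real n ^ 2 \<le> real (card (link H y \<inter> cross_pairs n c i))" by blast
    define U where "U = {u \<in> colour_class n c i. \<exists>w. {y, u, w} \<in> H}"
    have U: "real (card U) < \<theta>' * real n"
      unfolding U_def by (rule few_in_class_if_many_cross[OF H dense(2) \<kappa> i many])
    have fU: "finite U" by (simp add: U_def)
    let ?B = "(\<lambda>(u, w). {u, w}) ` (U \<times> {1..n})"
    have "link H y - cross_pairs n c i \<subseteq> D \<union> ?B"
    proof
      fix p assume p: "p \<in> link H y - cross_pairs n c i"
      show "p \<in> D \<union> ?B"
      proof (cases "p \<inter> colour_class n c i = {}")
        case True
        have "p \<in> link H y" "p \<notin> cross_pairs n c i" using p by auto
        then obtain j where "j < 3" "p \<subseteq> colour_class n c j"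
          using link_pair_cases(2)[OF H(1) c _ i True] by blast
        then show ?thesis using p unfolding D_def by blast
      next
        case False
        then obtain u where u: "u \<in> p" "u \<in> colour_class n c i" by blast
        have p': "card p = 2" "p \<subseteq> {1..n}" using link_subset_pairs[OF H(1)] p by (auto simp: pairs_def)
        then obtain w where w: "p = {u, w}" using u(1) by (auto simp: card_2_iff)
        have "{y, u, w} \<in> H" using p w by (simp add: link_def)
        then have "(u, w) \<in> U \<times> {1..n}" using u p' w by (auto simp: U_def)
        then have "p \<in> ?B" unfolding w by (rule rev_image_eqI) simp
        then show ?thesis by simp
      qed
    qed
    then have "card (link H y - cross_pairs n c i) \<le> card (D \<union> ?B)" using fD fU by (intro card_mono) auto
    also have "\<dots> \<le> card D + card ?B" by (rule card_Un_le)
    also have "card ?B \<le> card (U \<times> {1..n})" using fU by (intro card_image_le) auto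
    finally have "real (card (link H y - cross_pairs n c i)) \<le> real (card D + card (U \<times> {1..n}))"
      by (simp only: of_nat_le_iff)
    also have "\<dots> = real (card D) + real (card U) * real n" by (simp add: card_cartesian_product)
    also have "\<dots> \<le> 6 * \<theta> * real n ^ 2 + (\<theta>' * real n) * real n"
      using D U by (intro add_mono mult_right_mono) auto
    also have "\<dots> \<le> 9 * \<theta> * real n ^ 2"
    proof -
      have "0 \<le> \<theta> * real n ^ 2" using \<theta>' by simp
      then show ?thesis using \<theta>n by (simp add: power2_eq_square algebra_simps)
    qed
    finally show ?thesis using i by blast
  next
    case False
    define E where "E = (\<Union>i<3. link H y \<inter> cross_pairs n c i)"
    have E: "real (card E) \<le> 3 * (\<theta>' * real n ^ 2)"
      unfolding E_def using False by (intro card_UN_lessThan3_le) (auto simp: not_le less_imp_le)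
    have fE: "finite E" using fl by (simp add: E_def)
    \<comment> \<open>The whole link is small here, so any index will do.\<close>
    have "link H y - cross_pairs n c 0 \<subseteq> D \<union> E"
    proof
      fix p assume p: "p \<in> link H y - cross_pairs n c 0"
      then have "(\<exists>j\<in>{..<3}. p \<subseteq> colour_class n c j) \<or> (\<exists>i\<in>{..<3}. p \<in> cross_pairs n c i)"
        using link_pair_cases(1)[OF H(1) c, of p y] by auto
      then show "p \<in> D \<union> E" using p unfolding D_def E_def by blast
    qed
    then have "card (link H y - cross_pairs n c 0) \<le> card (D \<union> E)" using fD fE by (intro card_mono) auto
    also have "\<dots> \<le> card D + card E" by (rule card_Un_le)
    finally have "real (card (link H y - cross_pairs n c 0)) \<le> 9 * \<theta> * real n ^ 2"
      using D E \<theta>n by linarith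
    then show ?thesis by (intro exI[of _ 0]) simp
  qed
qed

section \<open>Typical systems and tripartite systems\<close>

text \<open>The index \<open>i\<close> depends on \<open>y\<close> and may differ from the colour of
  \<open>y\<close> under \<open>c\<close>: only the links are compared with
  \<open>c\<close>.\<close>

definition typical :: "nat \<Rightarrow> real \<Rightarrow> real \<Rightarrow> nat set set \<Rightarrow> bool" where
  "typical n \<gamma> \<xi> H \<longleftrightarrow> (\<exists>c\<in>colourings n.
     (\<forall>y. \<exists>i<3. real (card (link H y - cross_pairs n c i)) \<le> \<xi> * real n ^ 2) \<and>
     (\<forall>i<3. real (card (cross_pairs n c i)) \<le> (1 / 9 + \<gamma>) * real n ^ 2))"

lemma few_atypical:
  assumes "\<gamma> > 0" "\<xi> > 0"
  shows "\<exists>\<delta> > 0. \<forall>\<^sub>F n in sequentially.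
    real (card {H \<in> Forb n F5. \<not> typical n \<gamma> \<xi> H}) \<le> 2 powr (real n ^ 3 / 27 - \<delta> * real n ^ 3)"
proof -
  \<comment> \<open>Splits \<open>\<gamma>\<close> evenly between the two errors
    \<open>sqrt (12 * \<delta>4)\<close> and \<open>3 * \<delta>4\<close> in the number of crossing
    pairs.\<close>
  define \<delta>4 where "\<delta>4 = min (1 / 54) (min (\<gamma> / 6) (\<gamma>\<^sup>2 / 48))"
  have \<delta>4: "\<delta>4 > 0" "\<delta>4 \<le> 1 / 54" "3 * \<delta>4 \<le> \<gamma> / 2" "12 * \<delta>4 \<le> (\<gamma> / 2)\<^sup>2"
    using assms by (auto simp: \<delta>4_def power2_eq_square)
  have sq: "sqrt (12 * \<delta>4) + 3 * \<delta>4 \<le> \<gamma>"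
  proof -
    have "sqrt (12 * \<delta>4) \<le> \<gamma> / 2" using \<delta>4(4) assms by (intro real_le_lsqrt) auto
    then show ?thesis using \<delta>4(3) by linarith
  qed
  \<comment> \<open>A nearly balanced colouring has at least \<open>n ^ 2 / 54\<close> crossing
    pairs of each kind, so each of these sets counts as large at scale
    \<open>\<theta>1\<close>.\<close>
  define \<theta>1 where "\<theta>1 = min (\<xi> / 9) (1 / 54)"
  have \<theta>1: "\<theta>1 > 0" "9 * \<theta>1 \<le> \<xi>" "\<theta>1 \<le> 1 / 54" using assms by (auto simp: \<theta>1_def)
  define bad where "bad n \<eta> \<theta> \<kappa> = {H. H \<subseteq> triples n \<and> (\<exists>c\<in>colourings n.
    real (card (H - crossing n c)) \<le> \<eta> * real n ^ 3 \<and> \<not> dense_crossing n c H \<theta> \<kappa>)}" for n \<eta> \<theta> \<kappa>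
  define unb where "unb n \<eta> = {H. H \<subseteq> triples n \<and> (\<exists>c\<in>colourings n.
    real (card (H - crossing n c)) \<le> \<eta> * real n ^ 3 \<and>
    real (card (crossing n c)) < real n ^ 3 / 27 - \<delta>4 * real n ^ 3)}" for n \<eta>
  define far where "far n \<eta> = {H \<in> Forb n F5. \<forall>c\<in>colourings n. real (card (H - crossing n c)) > \<eta> * real n ^ 3}" for n \<eta>
  obtain \<kappa>1 where \<kappa>1: "\<kappa>1 > 0" and ev1: "\<forall>\<^sub>F n in sequentially. \<forall>\<kappa> \<eta>. \<kappa> + \<eta> \<le> \<kappa>1 \<longrightarrow>
    real (card (bad n \<eta> \<theta>1 \<kappa>)) \<le> 2 powr (real n ^ 3 / 27 - \<theta>1\<^sup>2 / 2 * real n ^ 3)"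
    using few_not_dense[OF \<theta>1(1)] unfolding bad_def by blast
  \<comment> \<open>This is both the density guaranteed for boxes at scale \<open>\<theta>1\<close>
    and the size of the boxes at the finer scale. Half of \<open>\<kappa>1\<close> is reserved for
    \<open>\<eta>\<close>.\<close>
  define \<theta>2 where "\<theta>2 = min \<theta>1 (\<kappa>1 / 2)"
  have \<theta>2: "\<theta>2 > 0" "\<theta>2 \<le> \<theta>1" "\<theta>2 \<le> \<kappa>1 / 2" using \<theta>1 \<kappa>1 by (auto simp: \<theta>2_def)
  obtain \<kappa>2 where \<kappa>2: "\<kappa>2 > 0" and ev2: "\<forall>\<^sub>F n in sequentially. \<forall>\<kappa> \<eta>. \<kappa> + \<eta> \<le> \<kappa>2 \<longrightarrow>
    real (card (bad n \<eta> \<theta>2 \<kappa>)) \<le> 2 powr (real n ^ 3 / 27 - \<theta>2\<^sup>2 / 2 * real n ^ 3)"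
    using few_not_dense[OF \<theta>2(1)] unfolding bad_def by blast
  obtain \<eta>4 where \<eta>4: "\<eta>4 > 0" and ev3: "\<forall>\<^sub>F n in sequentially. \<forall>\<eta>\<le>\<eta>4.
    real (card (unb n \<eta>)) \<le> 2 powr (real n ^ 3 / 27 - \<delta>4 / 2 * real n ^ 3)"
    using few_unbalanced[OF \<delta>4(1)] unfolding unb_def by blast
  define \<eta> where "\<eta> = min \<eta>4 (min (\<kappa>1 / 2) (\<kappa>2 / 2))"
  have \<eta>: "\<eta> > 0" "\<eta> \<le> \<eta>4" "\<theta>2 + \<eta> \<le> \<kappa>1" "\<kappa>2 / 2 + \<eta> \<le> \<kappa>2"
    using \<eta>4 \<kappa>1 \<kappa>2 \<theta>2 by (auto simp: \<eta>_def min_def)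
  have "\<exists>\<delta>>0. \<forall>\<^sub>F n in sequentially. real (card (far n \<eta>)) \<le> 2 powr (real n ^ 3 / 27 - \<delta> * real n ^ 3)"
    unfolding far_def by (rule few_far_from_tripartite[OF \<eta>(1)]) (intro exI conjI)
  then obtain \<delta>1 where \<delta>1: "\<delta>1 > 0"
    and ev4: "\<forall>\<^sub>F n in sequentially. real (card (far n \<eta>)) \<le> 2 powr (real n ^ 3 / 27 - \<delta>1 * real n ^ 3)"
    by blast
  define \<delta> where "\<delta> = min (min (\<theta>1\<^sup>2 / 2) (\<theta>2\<^sup>2 / 2)) (min (\<delta>4 / 2) \<delta>1)"
  have \<delta>: "\<delta> > 0" "\<delta> \<le> \<theta>1\<^sup>2 / 2" "\<delta> \<le> \<theta>2\<^sup>2 / 2" "\<delta> \<le> \<delta>4 / 2" "\<delta> \<le> \<delta>1"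
    using \<theta>1(1) \<theta>2(1) \<delta>4(1) \<delta>1 unfolding \<delta>_def
    by (simp_all only: min_less_iff_conj min_le_iff_disj order_refl simp_thms) simp
  have "\<forall>\<^sub>F n in sequentially. 2 \<le> \<delta> / 2 * real n ^ 3" using \<delta>(1) by real_asymp
  moreover have "\<forall>\<^sub>F n in sequentially. 1 \<le> \<kappa>2 / 2 * real n" using \<kappa>2 by real_asymp
  ultimately have "\<forall>\<^sub>F n in sequentially. real (card {H \<in> Forb n F5. \<not> typical n \<gamma> \<xi> H})
      \<le> 2 powr (real n ^ 3 / 27 - \<delta> / 2 * real n ^ 3)"
    using ev1 ev2 ev3 ev4 eventually_gt_at_top[of 0]
  proof eventually_elim
    case (elim n)
    define N where "N = 2 powr (real n ^ 3 / 27 - \<delta> * real n ^ 3)"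
    have N: "2 powr (real n ^ 3 / 27 - d * real n ^ 3) \<le> N" if "\<delta> \<le> d" for d
      unfolding N_def using that by (intro powr_mono diff_left_mono mult_right_mono) auto
    have b: "real (card (bad n \<eta> \<theta>1 \<theta>2)) \<le> N" "real (card (bad n \<eta> \<theta>2 (\<kappa>2 / 2))) \<le> N"
      "real (card (unb n \<eta>)) \<le> N" "real (card (far n \<eta>)) \<le> N"
      using elim \<eta> N[OF \<delta>(2)] N[OF \<delta>(3)] N[OF \<delta>(4)] N[OF \<delta>(5)] by (blast intro: order_trans)+
    have sub: "{H \<in> Forb n F5. \<not> typical n \<gamma> \<xi> H}
        \<subseteq> (bad n \<eta> \<theta>1 \<theta>2 \<union> bad n \<eta> \<theta>2 (\<kappa>2 / 2)) \<union> (unb n \<eta> \<union> far n \<eta>)"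
    proof
      fix H assume H0: "H \<in> {H \<in> Forb n F5. \<not> typical n \<gamma> \<xi> H}"
      then have H: "H \<subseteq> triples n" "\<not> contains_copy H F5" by (auto simp: Forb_eq)
      show "H \<in> (bad n \<eta> \<theta>1 \<theta>2 \<union> bad n \<eta> \<theta>2 (\<kappa>2 / 2)) \<union> (unb n \<eta> \<union> far n \<eta>)"
      proof (rule ccontr)
        assume not: "\<not> ?thesis"
        then obtain c where c: "c \<in> colourings n" "real (card (H - crossing n c)) \<le> \<eta> * real n ^ 3"
          using H0 by (auto simp: far_def not_less)
        have d: "dense_crossing n c H \<theta>1 \<theta>2" "dense_crossing n c H \<theta>2 (\<kappa>2 / 2)"
          using not c H(1) by (auto simp: bad_def)
        have bal: "real n ^ 3 / 27 - \<delta>4 * real n ^ 3 \<le> real (card (crossing n c))"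
          using not c H(1) by (auto simp: unb_def not_less)
        have cp: "real n ^ 2 / 54 \<le> real (card (cross_pairs n c i))"
          "real (card (cross_pairs n c i)) \<le> (1 / 9 + (sqrt (12 * \<delta>4) + 3 * \<delta>4)) * real n ^ 2" if "i < 3" for i
          using cross_pairs_balanced[OF c(1) that _ _ \<delta>4(2) bal] elim \<delta>4(1) by auto
        have k2: "real n ^ 2 \<le> \<kappa>2 / 2 * real n ^ 3"
          using mult_right_mono[OF elim(2), of "real n ^ 2"] by (simp add: power2_eq_square power3_eq_cube mult_ac)
        have "typical n \<gamma> \<xi> H"
          unfolding typical_def
        proof (intro bexI[OF _ c(1)] conjI allI impI)
          fix y
          have "\<exists>i<3. real (card (link H y - cross_pairs n c i)) \<le> 9 * \<theta>1 * real n ^ 2"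
          proof (rule link_near_cross_pairs[OF H c(1) d k2])
            fix i :: nat assume "i < 3"
            have "\<theta>1 * real n ^ 2 \<le> 1 / 54 * real n ^ 2" using \<theta>1 by (intro mult_right_mono) auto
            then show "\<theta>1 * real n ^ 2 \<le> real (card (cross_pairs n c i))" using cp(1)[OF \<open>i < 3\<close>] by linarith
          qed (use \<theta>2 in auto)
          moreover have "9 * \<theta>1 * real n ^ 2 \<le> \<xi> * real n ^ 2" using \<theta>1 by (intro mult_right_mono) auto
          ultimately show "\<exists>i<3. real (card (link H y - cross_pairs n c i)) \<le> \<xi> * real n ^ 2"
            by (meson order_trans)
        next
          fix i :: nat assume "i < 3"
          have "(1 / 9 + (sqrt (12 * \<delta>4) + 3 * \<delta>4)) * real n ^ 2 \<le> (1 / 9 + \<gamma>) * real n ^ 2"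
            using sq by (intro mult_right_mono) auto
          then show "real (card (cross_pairs n c i)) \<le> (1 / 9 + \<gamma>) * real n ^ 2"
            using cp(2)[OF \<open>i < 3\<close>] by linarith
        qed
        then show False using H0 by simp
      qed
    qed
    have "finite (Pow (triples n))" by simp
    moreover have "bad n \<eta> \<theta>1 \<theta>2 \<union> bad n \<eta> \<theta>2 (\<kappa>2 / 2) \<union> (unb n \<eta> \<union> far n \<eta>) \<subseteq> Pow (triples n)"
      by (auto simp: bad_def unb_def far_def Forb_eq)
    ultimately have "card {H \<in> Forb n F5. \<not> typical n \<gamma> \<xi> H}
        \<le> card (bad n \<eta> \<theta>1 \<theta>2 \<union> bad n \<eta> \<theta>2 (\<kappa>2 / 2) \<union> (unb n \<eta> \<union> far n \<eta>))"
      using sub by (meson card_mono finite_subset)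
    also have "\<dots> \<le> (card (bad n \<eta> \<theta>1 \<theta>2) + card (bad n \<eta> \<theta>2 (\<kappa>2 / 2))) + (card (unb n \<eta>) + card (far n \<eta>))"
      by (intro order_trans[OF card_Un_le] add_mono card_Un_le)
    finally have "real (card {H \<in> Forb n F5. \<not> typical n \<gamma> \<xi> H}) \<le> 4 * N" using b by linarith
    also have "\<dots> = 2 powr (2 + (real n ^ 3 / 27 - \<delta> * real n ^ 3))"
      by (simp add: N_def powr_add)
    also have "\<dots> \<le> 2 powr (real n ^ 3 / 27 - \<delta> / 2 * real n ^ 3)"
      using elim(1) by (intro powr_mono) auto
    finally show ?case .
  qed
  then show ?thesis using \<delta>(1) by (intro exI[of _ "\<delta> / 2"]) auto
qed

section \<open>Colourings, tripartite systems and the size of \<open>T n\<close>\<close>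

lemma restrict_colouring:
  assumes "\<And>x. w x < 3"
  shows "restrict w {1..n} \<in> colourings n"
    and "crossing n (restrict w {1..n}) = {e \<in> triples n. inj_on w e}"
proof -
  show "restrict w {1..n} \<in> colourings n" using assms by (auto simp: colourings_def)
  have "inj_on (restrict w {1..n}) e \<longleftrightarrow> inj_on w e" if "e \<subseteq> {1..n}" for e
    using that by (intro inj_on_cong) auto
  then show "crossing n (restrict w {1..n}) = {e \<in> triples n. inj_on w e}"
    by (auto simp: crossing_def triples_def)
qed

lemma tripartite_iff:
  assumes H: "H \<subseteq> triples n"
  shows "tripartite {1..n} H \<longleftrightarrow> (\<exists>c\<in>colourings n. H \<subseteq> crossing n c)"
proof
  assume "tripartite {1..n} H"
  then obtain X Y Z where XYZ: "X \<union> Y \<union> Z = {1..n}" "X \<inter> Y = {}" "X \<inter> Z = {}" "Y \<inter> Z = {}"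
    and one: "\<forall>e\<in>H. card (e \<inter> X) = 1 \<and> card (e \<inter> Y) = 1 \<and> card (e \<inter> Z) = 1"
    unfolding tripartite_def by (elim exE conjE)
  define w :: "nat \<Rightarrow> nat" where "w v = (if v \<in> X then 0 else if v \<in> Y then 1 else 2)" for v
  have w3: "w x < 3" for x by (simp add: w_def)
  have "inj_on w e" if e: "e \<in> H" for e
  proof (rule inj_onI)
    fix x y assume xy: "x \<in> e" "y \<in> e" "w x = w y"
    have "e \<subseteq> {1..n}" using e H by (auto simp: triples_def)
    then have "x \<in> X \<union> Y \<union> Z" "y \<in> X \<union> Y \<union> Z" using xy XYZ(1) by auto
    then have "x \<in> X \<and> y \<in> X \<or> x \<in> Y \<and> y \<in> Y \<or> x \<in> Z \<and> y \<in> Z"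
      using xy(3) XYZ(2-4) by (auto simp: w_def split: if_splits)
    moreover have "x = y" if "card (e \<inter> M) = 1" "x \<in> M \<and> y \<in> M" for M
    proof -
      obtain u where "e \<inter> M = {u}" using \<open>card (e \<inter> M) = 1\<close> by (rule card_1_singletonE)
      then have "x \<in> {u}" "y \<in> {u}" using xy that by auto
      then show ?thesis by simp
    qed
    ultimately show "x = y" using one e by blast
  qed
  then have "H \<subseteq> crossing n (restrict w {1..n})" unfolding restrict_colouring(2)[OF w3] using H by auto
  then show "\<exists>c\<in>colourings n. H \<subseteq> crossing n c" by (rule bexI[OF _ restrict_colouring(1)[OF w3]])
next
  assume "\<exists>c\<in>colourings n. H \<subseteq> crossing n c"
  then obtain c where c: "c \<in> colourings n" "H \<subseteq> crossing n c" by blast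
  have one: "card (e \<inter> colour_class n c i) = 1" if eH: "e \<in> H" and i3: "i < 3" for e i
  proof -
    have e: "e \<subseteq> {1..n}" "card e = 3" "inj_on c e" using eH c(2) by (auto simp: crossing_def triples_def)
    have "c ` e = {..<3}"
      using e c(1) colouring_less by (intro card_subset_eq) (auto simp: card_image)
    then obtain u where u: "u \<in> e" "c u = i" using i3 by (metis imageE lessThan_iff)
    then have "e \<inter> colour_class n c i = {u}" using e by (auto simp: colour_class_def inj_on_def)
    then show ?thesis by simp
  qed
  have "x \<in> colour_class n c 0 \<union> colour_class n c 1 \<union> colour_class n c 2" if "x \<in> {1..n}" for x
  proof -
    have "c x = 0 \<or> c x = 1 \<or> c x = 2" using colouring_less[OF c(1) that] by auto
    then show ?thesis using that unfolding colour_class_def by blast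
  qed
  then have U: "colour_class n c 0 \<union> colour_class n c 1 \<union> colour_class n c 2 = {1..n}"
    unfolding colour_class_def by blast
  show "tripartite {1..n} H"
    unfolding tripartite_def
  proof (intro exI conjI ballI)
    show "colour_class n c 0 \<inter> colour_class n c 1 = {}" "colour_class n c 0 \<inter> colour_class n c 2 = {}"
      "colour_class n c 1 \<inter> colour_class n c 2 = {}"
      by (auto simp: colour_class_def)
    show "colour_class n c 0 \<union> colour_class n c 1 \<union> colour_class n c 2 = {1..n}" by (rule U)
    fix e assume "e \<in> H"
    then show "card (e \<inter> colour_class n c 0) = 1" "card (e \<inter> colour_class n c 1) = 1"
      "card (e \<inter> colour_class n c 2) = 1"
      using one[of e 0] one[of e 1] one[of e 2] by simp_all
  qed
qed

text \<open>Any two of the vertices 1, 2, 3, 4 of \<open>F5\<close> share an edge, so a copy would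
  need four colours.\<close>

lemma crossing_F5_free:
  assumes c: "c \<in> colourings n" and H: "H \<subseteq> crossing n c"
  shows "\<not> contains_copy H F5"
proof
  assume "contains_copy H F5"
  then obtain f where "inj_on f (\<Union>F5)" and f: "\<And>e. e \<in> F5 \<Longrightarrow> f ` e \<in> H"
    unfolding contains_copy_def by blast
  then have inj: "inj_on f {1, 2, 3, 4, 5}" by (simp add: F5_def insert_commute)
  have e: "{f 1, f 2, f 3} \<in> H" "{f 1, f 2, f 4} \<in> H" "{f 3, f 4, f 5} \<in> H"
    using f[of "{1, 2, 3}"] f[of "{1, 2, 4}"] f[of "{3, 4, 5}"] by (auto simp: F5_def)
  have d: "f 1 \<noteq> f 2" "f 1 \<noteq> f 3" "f 2 \<noteq> f 3" "f 1 \<noteq> f 4" "f 2 \<noteq> f 4" "f 3 \<noteq> f 4"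
    using inj by (auto simp: inj_on_def)
  have i: "inj_on c {f 1, f 2, f 3}" "inj_on c {f 1, f 2, f 4}" "inj_on c {f 3, f 4, f 5}"
    and V: "f 1 \<in> {1..n}" "f 2 \<in> {1..n}" "f 3 \<in> {1..n}" "f 4 \<in> {1..n}"
    using e H by (auto simp: crossing_def triples_def)
  have "c (f 1) \<noteq> c (f 2)" "c (f 1) \<noteq> c (f 3)" "c (f 2) \<noteq> c (f 3)" "c (f 1) \<noteq> c (f 4)"
    "c (f 2) \<noteq> c (f 4)" "c (f 3) \<noteq> c (f 4)"
    using i d by (auto simp: inj_on_def)
  then have "card {c (f 1), c (f 2), c (f 3), c (f 4)} = 4" by simp
  moreover have "{c (f 1), c (f 2), c (f 3), c (f 4)} \<subseteq> {..<3}" using V[THEN colouring_less[OF c]] by simp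
  then have "card {c (f 1), c (f 2), c (f 3), c (f 4)} \<le> card {..<3::nat}" by (intro card_mono) auto
  ultimately show False by simp
qed

lemma card_Forb_split:
  "card (Forb n F5) = T n + card {H \<in> Forb n F5. \<not> tripartite {1..n} H}"
  "{H \<in> Forb n F5. tripartite {1..n} H} = {H \<in> three_graphs n. tripartite {1..n} H}"
proof -
  show eq: "{H \<in> Forb n F5. tripartite {1..n} H} = {H \<in> three_graphs n. tripartite {1..n} H}"
    using crossing_F5_free tripartite_iff by (auto simp: Forb_eq three_graphs_eq)
  have fin: "finite (Forb n F5)" by (rule finite_subset[of _ "Pow (triples n)"]) (auto simp: Forb_eq)
  have "Forb n F5 = {H \<in> Forb n F5. tripartite {1..n} H} \<union> {H \<in> Forb n F5. \<not> tripartite {1..n} H}" by blast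
  then have "card (Forb n F5) = card ({H \<in> Forb n F5. tripartite {1..n} H} \<union> {H \<in> Forb n F5. \<not> tripartite {1..n} H})"
    by simp
  also have "\<dots> = card {H \<in> Forb n F5. tripartite {1..n} H} + card {H \<in> Forb n F5. \<not> tripartite {1..n} H}"
    using fin by (intro card_Un_disjoint) auto
  finally show "card (Forb n F5) = T n + card {H \<in> Forb n F5. \<not> tripartite {1..n} H}"
    by (simp only: T_def eq)
qed

text \<open>Union bound over the colourings; rounding \<open>3 ^ n\<close> up to
  \<open>4 ^ n\<close> accounts for the term \<open>2 * n\<close>.\<close>

lemma T_le: "real (T n) \<le> 2 powr (real n ^ 3 / 27 + 2 * real n)"
proof -
  have "{H \<in> three_graphs n. tripartite {1..n} H} \<subseteq> (\<Union>c\<in>colourings n. Pow (crossing n c))"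
    using tripartite_iff by (auto simp: three_graphs_eq)
  then have "T n \<le> card (\<Union>c\<in>colourings n. Pow (crossing n c))"
    unfolding T_def by (intro card_mono) auto
  also have "\<dots> \<le> (\<Sum>c\<in>colourings n. card (Pow (crossing n c)))" by (rule card_UN_le) simp
  finally have "real (T n) \<le> real (\<Sum>c\<in>colourings n. card (Pow (crossing n c)))" by (simp only: of_nat_le_iff)
  also have "\<dots> = (\<Sum>c\<in>colourings n. 2 ^ card (crossing n c))" by (simp add: card_Pow)
  also have "\<dots> \<le> (\<Sum>c\<in>colourings n. 2 powr (real n ^ 3 / 27))"
    using card_crossing_le by (intro sum_mono) (simp add: powr_realpow[symmetric])
  also have "\<dots> = 3 ^ n * 2 powr (real n ^ 3 / 27)" by simp
  also have "\<dots> \<le> (2 ^ 2) ^ n * 2 powr (real n ^ 3 / 27)" by (intro mult_right_mono power_mono) auto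
  also have "(2 ^ 2 :: real) ^ n = 2 ^ (2 * n)" by (simp only: power_mult)
  also have "\<dots> = 2 powr real (2 * n)" by (rule powr_realpow[symmetric]) simp
  also have "\<dots> * 2 powr (real n ^ 3 / 27) = 2 powr (real (2 * n) + real n ^ 3 / 27)" by (rule powr_add[symmetric])
  finally show ?thesis by (simp add: add.commute)
qed

text \<open>All subsystems of one balanced complete tripartite system already suffice, and
  divisibility by 3 costs only a linear term in the exponent.\<close>

lemma T_ge: "2 powr (real n ^ 3 / 27 - real n) \<le> real (T n)"
proof -
  \<comment> \<open>The classes are intervals ending at \<open>a\<close>, \<open>b\<close> and
    \<open>n\<close>, of sizes \<open>n div 3\<close>, \<open>(n + 1) div 3\<close> and
    \<open>(n + 2) div 3\<close>, which add up to \<open>n\<close> for every residue modulo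
    3.\<close>
  define a where "a = n div 3"
  define b where "b = a + (n + 1) div 3"
  define q where "q = n div 3"
  have "n = 3 * q + n mod 3" by (simp add: q_def)
  moreover have "n mod 3 < 3" by simp
  ultimately consider "n = 3 * q" | "n = 3 * q + 1" | "n = 3 * q + 2" by linarith
  then have "(n div 3 = q \<and> (n + 1) div 3 = q \<and> (n + 2) div 3 = q \<and> n = 3 * q) \<or>
    (n div 3 = q \<and> (n + 1) div 3 = q \<and> (n + 2) div 3 = q + 1 \<and> n = 3 * q + 1) \<or>
    (n div 3 = q \<and> (n + 1) div 3 = q + 1 \<and> (n + 2) div 3 = q + 1 \<and> n = 3 * q + 2)" (is "?D0 \<or> ?D1 \<or> ?D2")
  proof cases
    case 1
    then have ?D0 by (intro conjI div_nat_eqI) auto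
    then show ?thesis by blast
  next
    case 2
    then have ?D1 by (intro conjI div_nat_eqI) auto
    then show ?thesis by blast
  next
    case 3
    then have ?D2 by (intro conjI div_nat_eqI) auto
    then show ?thesis by blast
  qed
  then have cases: "?D0 \<or> ?D1 \<or> ?D2" .
  then have "n div 3 + (n + 1) div 3 + (n + 2) div 3 = n" by auto
  then have bn: "b \<le> n" "n - b = (n + 2) div 3" by (simp_all add: a_def b_def)
  have ab: "a \<le> b" by (simp add: b_def)
  define w :: "nat \<Rightarrow> nat" where "w v = (if v \<le> a then 0 else if v \<le> b then 1 else 2)" for v
  have w3: "w x < 3" for x by (simp add: w_def)
  define c where "c = restrict w {1..n}"
  have c: "c \<in> colourings n" unfolding c_def by (rule restrict_colouring(1)[OF w3])
  let ?B = "{1..a} \<times> {a<..b} \<times> {b<..n}"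
  have "inj_on (\<lambda>(x, y, z). {x, y, z}) ?B"
  proof (rule inj_onI)
    fix s s' assume s: "s \<in> ?B" "s' \<in> ?B" and eq': "(\<lambda>(x, y, z). {x, y, z}) s = (\<lambda>(x, y, z). {x, y, z}) s'"
    obtain x y z x' y' z' where xyz: "s = (x, y, z)" "s' = (x', y', z')" by (cases s, cases s') auto
    have eq: "{x, y, z} = {x', y', z'}" using eq' by (simp add: xyz)
    have "x \<in> {1..a}" "y \<in> {a<..b}" "z \<in> {b<..n}" "x' \<in> {1..a}" "y' \<in> {a<..b}" "z' \<in> {b<..n}"
      using s by (simp_all add: xyz)
    then have o: "x < y" "y < z" "x \<le> a" "a < y" "y \<le> b" "b < z" "x' \<le> a" "a < y'" "y' \<le> b" "b < z'" by auto
    have "x \<in> {x', y', z'}" "y \<in> {x', y', z'}" "z \<in> {x', y', z'}" using eq by blast+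
    then have "x = x'" "y = y'" "z = z'" using o by auto
    then show "s = s'" by (simp add: xyz)
  qed
  then have "card ((\<lambda>(x, y, z). {x, y, z}) ` ?B) = card ?B" by (rule card_image)
  also have "\<dots> = a * ((b - a) * (n - b))" by (simp add: card_cartesian_product)
  also have "b - a = (n + 1) div 3" by (simp add: b_def)
  also have "a * ((n + 1) div 3 * (n - b)) = n div 3 * ((n + 1) div 3 * ((n + 2) div 3))"
    by (simp only: bn(2) a_def)
  finally have cardB: "card ((\<lambda>(x, y, z). {x, y, z}) ` ?B) = n div 3 * ((n + 1) div 3 * ((n + 2) div 3))" .
  have "(\<lambda>(x, y, z). {x, y, z}) ` ?B \<subseteq> crossing n c"
  proof (rule image_subsetI)
    fix s assume s: "s \<in> ?B"
    obtain x y z where xyz: "s = (x, y, z)" by (cases s)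
    have o: "1 \<le> x" "x \<le> a" "a < y" "y \<le> b" "b < z" "z \<le> n" using s by (auto simp: xyz)
    then have d: "x \<noteq> y" "x \<noteq> z" "y \<noteq> z" "w x = 0" "w y = 1" "w z = 2" using ab by (auto simp: w_def)
    have "{x, y, z} \<subseteq> {1..n}" using o ab bn(1) by auto
    then have "{x, y, z} \<in> triples n" using d by (simp add: triples_def)
    moreover have "inj_on w {x, y, z}" using d by simp
    ultimately show "(\<lambda>(x, y, z). {x, y, z}) s \<in> crossing n c"
      unfolding c_def restrict_colouring(2)[OF w3] by (simp add: xyz)
  qed
  then have "card ((\<lambda>(x, y, z). {x, y, z}) ` ?B) \<le> card (crossing n c)" by (intro card_mono) auto
  then have "n div 3 * ((n + 1) div 3 * ((n + 2) div 3)) \<le> card (crossing n c)" unfolding cardB .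
  then have "real (n div 3) * (real ((n + 1) div 3) * real ((n + 2) div 3)) \<le> real (card (crossing n c))"
    by (metis of_nat_le_iff of_nat_mult)
  moreover have "real n ^ 3 / 27 - real n \<le> real (n div 3) * (real ((n + 1) div 3) * real ((n + 2) div 3))"
    using cases
  proof (elim disjE)
    assume ?D0
    then have d: "n div 3 = q" "(n + 1) div 3 = q" "(n + 2) div 3 = q" and n: "n = 3 * q" by blast+
    show ?thesis unfolding d by (simp add: n power3_eq_cube)
  next
    assume ?D1
    then have d: "n div 3 = q" "(n + 1) div 3 = q" "(n + 2) div 3 = q + 1" and n: "n = 3 * q + 1" by blast+
    show ?thesis unfolding d by (simp add: n power3_eq_cube field_simps)
  next
    assume ?D2
    then have d: "n div 3 = q" "(n + 1) div 3 = q + 1" "(n + 2) div 3 = q + 1" and n: "n = 3 * q + 2" by blast+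
    show ?thesis unfolding d by (simp add: n power3_eq_cube field_simps)
  qed
  ultimately have "2 powr (real n ^ 3 / 27 - real n) \<le> 2 powr real (card (crossing n c))"
    by (intro powr_mono) auto
  also have "\<dots> = real (card (Pow (crossing n c)))" by (simp add: powr_realpow card_Pow)
  also have "\<dots> \<le> real (T n)"
  proof -
    have "Pow (crossing n c) \<subseteq> {H \<in> three_graphs n. tripartite {1..n} H}"
      using tripartite_iff c by (auto simp: three_graphs_eq crossing_def)
    moreover have "finite {H \<in> three_graphs n. tripartite {1..n} H}" by (simp add: three_graphs_eq)
    ultimately show ?thesis unfolding T_def by (intro of_nat_mono card_mono) auto
  qed
  finally show ?thesis .
qed

section \<open>Deleting two vertices and counting their links\<close>

definition F5_free_on :: "'a set \<Rightarrow> 'a set set set" where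
  "F5_free_on W = {H. (\<forall>e\<in>H. e \<subseteq> W \<and> card e = 3) \<and> \<not> contains_copy H F5}"

lemma contains_copy_image:
  assumes h: "inj_on h W" and H: "\<And>e. e \<in> H \<Longrightarrow> e \<subseteq> W" and copy: "contains_copy ((`) h ` H) F"
  shows "contains_copy H F"
proof -
  obtain f where f: "inj_on f (\<Union>F)" "\<And>e. e \<in> F \<Longrightarrow> f ` e \<in> (`) h ` H"
    using copy unfolding contains_copy_def by blast
  let ?g = "inv_into W h \<circ> f"
  have fW: "f ` (\<Union>F) \<subseteq> h ` W" using f(2) H by blast
  have "inj_on ?g (\<Union>F)"
    by (rule comp_inj_on[OF f(1) inj_on_inv_into[OF fW]])
  moreover have "?g ` e \<in> H" if e: "e \<in> F" for e
  proof -
    obtain e' where e': "e' \<in> H" "f ` e = h ` e'" using f(2)[OF e] by blast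
    have "?g ` e = inv_into W h ` h ` e'" by (simp only: image_comp[symmetric] e')
    also have "\<dots> = e'" by (rule inv_into_image_cancel[OF h H[OF e'(1)]])
    finally show ?thesis using e' by simp
  qed
  ultimately show ?thesis unfolding contains_copy_def by blast
qed

text \<open>Removing two arbitrary vertices from \<open>{1..n}\<close> need not leave an initial
  segment, so the rest has to be relabelled.\<close>

lemma card_F5_free_on_le:
  assumes "finite W" shows "card (F5_free_on W) \<le> card (Forb (card W) F5)"
proof -
  obtain h where "bij_betw h {1..card W} W" using ex_bij_betw_nat_finite_1[OF assms] by blast
  then have bij: "bij_betw (inv_into {1..card W} h) W {1..card W}" by (rule bij_betw_inv_into)
  define g where "g = inv_into {1..card W} h"
  have g: "inj_on g W" "g ` W = {1..card W}" using bij by (auto simp: g_def bij_betw_def)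
  have "inj_on ((`) g) (Pow W)" by (rule inj_on_image_Pow[OF g(1)])
  then have "inj_on ((`) ((`) g)) (Pow (Pow W))" by (rule inj_on_image_Pow)
  moreover have "F5_free_on W \<subseteq> Pow (Pow W)" by (auto simp: F5_free_on_def)
  ultimately have inj: "inj_on ((`) ((`) g)) (F5_free_on W)" by (rule inj_on_subset)
  show ?thesis
  proof (rule card_inj_on_le[OF inj])
    show "(`) ((`) g) ` F5_free_on W \<subseteq> Forb (card W) F5"
    proof clarify
      fix H assume H: "H \<in> F5_free_on W"
      then have HW: "\<And>e. e \<in> H \<Longrightarrow> e \<subseteq> W" and H3: "\<And>e. e \<in> H \<Longrightarrow> card e = 3"
        by (auto simp: F5_free_on_def)
      have "\<not> contains_copy ((`) g ` H) F5"
        using contains_copy_image[OF g(1) HW] H by (auto simp: F5_free_on_def)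
      moreover have "(`) g ` H \<subseteq> triples (card W)"
      proof
        fix e assume "e \<in> (`) g ` H"
        then obtain e' where e': "e' \<in> H" "e = g ` e'" by blast
        have "card e = 3" using e' H3 HW inj_on_subset[OF g(1)] by (simp add: card_image)
        moreover have "e \<subseteq> {1..card W}" using e' HW g(2) by blast
        ultimately show "e \<in> triples (card W)" by (simp add: triples_def)
      qed
      ultimately show "(`) g ` H \<in> Forb (card W) F5" by (simp add: Forb_eq)
    qed
    show "finite (Forb (card W) F5)" by (rule finite_subset[of _ "Pow (triples (card W))"]) (auto simp: Forb_eq)
  qed
qed

text \<open>Each element is in \<open>A\<close>, in \<open>B\<close> or in neither. This is the base
  3 that competes with the base 4 of two independent links.\<close>

lemma card_disjoint_pairs_le:
  assumes "finite Q" shows "card {(A, B). A \<subseteq> Q \<and> B \<subseteq> Q \<and> A \<inter> B = {}} \<le> 3 ^ card Q"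
proof -
  let ?f = "\<lambda>(A, B). restrict (\<lambda>p. if p \<in> A then 0 else if p \<in> B then 1 else (2::nat)) Q"
  have "inj_on ?f {(A, B). A \<subseteq> Q \<and> B \<subseteq> Q \<and> A \<inter> B = {}}"
  proof (rule inj_onI, clarify)
    fix A B A' B' assume *: "A \<subseteq> Q" "B \<subseteq> Q" "A \<inter> B = {}" "A' \<subseteq> Q" "B' \<subseteq> Q" "A' \<inter> B' = {}"
      and eq: "restrict (\<lambda>p. if p \<in> A then 0 else if p \<in> B then 1 else (2::nat)) Q =
        restrict (\<lambda>p. if p \<in> A' then 0 else if p \<in> B' then 1 else 2) Q"
    have "p \<in> A \<longleftrightarrow> p \<in> A'" "p \<in> B \<longleftrightarrow> p \<in> B'" if "p \<in> Q" for p
      using fun_cong[OF eq, of p] that * by (auto split: if_splits)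
    then show "A = A' \<and> B = B'" using * by blast
  qed
  moreover have "?f ` {(A, B). A \<subseteq> Q \<and> B \<subseteq> Q \<and> A \<inter> B = {}} \<subseteq> Q \<rightarrow>\<^sub>E {..<3}" by auto
  moreover have "finite (Q \<rightarrow>\<^sub>E {..<3::nat})" using assms by (intro finite_PiE) auto
  ultimately have "card {(A, B). A \<subseteq> Q \<and> B \<subseteq> Q \<and> A \<inter> B = {}} \<le> card (Q \<rightarrow>\<^sub>E {..<3::nat})"
    by (rule card_inj_on_le)
  then show ?thesis using assms by (simp add: card_PiE)
qed

text \<open>Candidates for the links of \<open>y\<close> and \<open>z\<close> when
  \<open>{y, z, x}\<close> is an edge. \<open>Q\<close> will be a set of crossing pairs that
  contains both links up to \<open>k\<close> exceptions.\<close>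

definition link_pairs :: "nat \<Rightarrow> nat set set \<Rightarrow> real \<Rightarrow> nat \<Rightarrow> (nat set set \<times> nat set set) set" where
  "link_pairs n Q k x = {(A, B). A \<subseteq> pairs n \<and> B \<subseteq> pairs n \<and>
     real (card (A - Q)) \<le> k \<and> real (card (B - Q)) \<le> k \<and> (\<forall>p\<in>A \<inter> B. x \<in> p)}"

lemma finite_link_pairs [simp]: "finite (link_pairs n Q k x)"
  by (rule finite_subset[of _ "Pow (pairs n) \<times> Pow (pairs n)"]) (auto simp: link_pairs_def)

text \<open>Each of \<open>A\<close> and \<open>B\<close> is cut into its few pairs outside
  \<open>Q\<close>, its pairs through \<open>x\<close>, of which there are at most \<open>n\<close>,
  and the rest inside \<open>Q\<close>, where the two are disjoint.\<close>

lemma card_link_pairs_le: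
  assumes "Q \<subseteq> pairs n"
  shows "card (link_pairs n Q k x) \<le> card (small_subsets (pairs n) k) ^ 2 * (4 ^ n * 3 ^ card Q)"
proof -
  define S where "S = {p \<in> pairs n. x \<in> p}"
  have fS: "finite S" by (simp add: S_def)
  have cS: "card S \<le> n" by (rule card_pairs_through[of S n x]) (auto simp: S_def)
  note S = fS cS
  have fQ: "finite Q" using assms finite_subset finite_pairs by blast
  define DP where "DP = {(A, B). A \<subseteq> Q \<and> B \<subseteq> Q \<and> A \<inter> B = {}}"
  have fDP: "finite DP" by (rule finite_subset[of _ "Pow Q \<times> Pow Q"]) (use fQ in \<open>auto simp: DP_def\<close>)
  let ?s = "small_subsets (pairs n) k"
  let ?f = "\<lambda>(A, B). (A - Q, B - Q, A \<inter> S, B \<inter> S, A \<inter> Q - S, B \<inter> Q - S)"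
  let ?Y = "?s \<times> ?s \<times> Pow S \<times> Pow S \<times> DP"
  have "card (link_pairs n Q k x) \<le> card ?Y"
  proof (rule card_inj_on_le)
    show "inj_on ?f (link_pairs n Q k x)"
    proof (rule inj_onI, clarify)
      fix A B A' B'
      assume eq: "A - Q = A' - Q" "B - Q = B' - Q" "A \<inter> S = A' \<inter> S" "B \<inter> S = B' \<inter> S"
        "A \<inter> Q - S = A' \<inter> Q - S" "B \<inter> Q - S = B' \<inter> Q - S"
      have dec: "M = (M - Q) \<union> (M \<inter> S) \<union> (M \<inter> Q - S)" for M by blast
      have "A = (A' - Q) \<union> (A' \<inter> S) \<union> (A' \<inter> Q - S)" using dec[of A] unfolding eq .
      moreover have "B = (B' - Q) \<union> (B' \<inter> S) \<union> (B' \<inter> Q - S)" using dec[of B] unfolding eq .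
      ultimately show "A = A' \<and> B = B'" using dec[of A'] dec[of B'] by simp
    qed
    show "?f ` link_pairs n Q k x \<subseteq> ?Y"
      by (auto simp: link_pairs_def small_subsets_def DP_def S_def)
    show "finite ?Y" using S fDP by auto
  qed
  also have "\<dots> = card ?s ^ 2 * (2 ^ card S * 2 ^ card S * card DP)"
    using S by (simp add: card_cartesian_product card_Pow power2_eq_square)
  also have "\<dots> \<le> card ?s ^ 2 * (2 ^ n * 2 ^ n * 3 ^ card Q)"
    unfolding DP_def by (intro mult_le_mono power_increasing card_disjoint_pairs_le fQ cS order_refl) simp_all
  also have "2 ^ n * 2 ^ n = (4 ^ n :: nat)" by (simp add: power_mult_distrib[symmetric])
  finally show ?thesis .
qed

lemma edges_from_links:
  "H = {e \<in> H. y \<notin> e \<and> z \<notin> e} \<union> insert y ` link H y \<union> insert z ` link H z"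
proof -
  have "e \<in> insert v ` link H v" if "e \<in> H" "v \<in> e" for e v
  proof (rule image_eqI)
    show "e = insert v (e - {v})" using that by auto
    then show "e - {v} \<in> link H v" using that by (simp add: link_def)
  qed
  then show ?thesis by (auto simp: link_def)
qed

text \<open>A system is determined by its triples avoiding \<open>y\<close> and \<open>z\<close>
  together with the two links, and the edge \<open>{y, z, x}\<close> forces the links to meet only
  in pairs through \<open>x\<close>.\<close>

lemma card_close_links_le:
  assumes xyz: "y \<in> {1..n}" "z \<in> {1..n}" "y \<noteq> z"
  shows "card {H \<in> Forb n F5. {y, z, x} \<in> H \<and> real (card (link H y - Q)) \<le> k \<and> real (card (link H z - Q)) \<le> k}
    \<le> card (Forb (n - 2) F5) * card (link_pairs n Q k x)"
proof -
  let ?F = "{H \<in> Forb n F5. {y, z, x} \<in> H \<and> real (card (link H y - Q)) \<le> k \<and> real (card (link H z - Q)) \<le> k}"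
  let ?f = "\<lambda>H. ({e \<in> H. y \<notin> e \<and> z \<notin> e}, link H y, link H z)"
  define W where "W = {1..n} - {y, z}"
  have W: "finite W" "card W = n - 2" using xyz by (auto simp: W_def card_Diff_subset)
  have "card ?F \<le> card (F5_free_on W \<times> link_pairs n Q k x)"
  proof (rule card_inj_on_le[where f = ?f])
    show "inj_on ?f ?F"
    proof (rule inj_onI)
      fix H H' assume "?f H = ?f H'"
      then show "H = H'" using edges_from_links[of H y z] edges_from_links[of H' y z] by simp
    qed
    show "?f ` ?F \<subseteq> F5_free_on W \<times> link_pairs n Q k x"
    proof (rule image_subsetI)
      fix H assume "H \<in> ?F"
      then have H: "H \<subseteq> triples n" "\<not> contains_copy H F5" "{y, z, x} \<in> H"
        and k: "real (card (link H y - Q)) \<le> k" "real (card (link H z - Q)) \<le> k" by (auto simp: Forb_eq)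
      have "\<not> contains_copy {e \<in> H. y \<notin> e \<and> z \<notin> e} F5"
        using H(2) unfolding contains_copy_def by blast
      then have "{e \<in> H. y \<notin> e \<and> z \<notin> e} \<in> F5_free_on W"
        using H(1) by (auto simp: F5_free_on_def W_def triples_def)
      moreover have "(link H y, link H z) \<in> link_pairs n Q k x"
        using k link_subset_pairs[OF H(1)] links_meet_in_star[OF H] by (simp add: link_pairs_def)
      ultimately show "?f H \<in> F5_free_on W \<times> link_pairs n Q k x" by blast
    qed
    have "finite (F5_free_on W)"
      by (rule finite_subset[of _ "Pow (Pow W)"]) (use W in \<open>auto simp: F5_free_on_def\<close>)
    then show "finite (F5_free_on W \<times> link_pairs n Q k x)" by simp
  qed
  also have "\<dots> = card (F5_free_on W) * card (link_pairs n Q k x)" by (rule card_cartesian_product)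
  also have "\<dots> \<le> card (Forb (n - 2) F5) * card (link_pairs n Q k x)"
    using card_F5_free_on_le[OF W(1)] W(2) by (intro mult_right_mono) auto
  finally show ?thesis .
qed

section \<open>Counting typical systems that are not tripartite\<close>

text \<open>The factor \<open>3 ^ n * 3 * n ^ 3\<close> accounts for the colouring \<open>c\<close>,
  the index \<open>i\<close> of the common crossing set and the three vertices of the edge.\<close>

lemma card_typical_nontripartite_le:
  "real (card {H \<in> Forb n F5. typical n \<gamma> \<xi> H \<and> \<not> tripartite {1..n} H}) \<le>
    (3 ^ n * 3 * real n ^ 3) * (real (card (Forb (n - 2) F5)) *
      (real (card (small_subsets (pairs n) (\<xi> * real n ^ 2))) ^ 2 * (4 ^ n * 3 powr ((1 / 9 + \<gamma>) * real n ^ 2))))"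
    (is "real (card ?B) \<le> _ * ?b")
proof -
  define k where "k = \<xi> * real n ^ 2"
  define Q where "Q = cross_pairs n"
  define J where "J = {(c, i, x, y, z). c \<in> colourings n \<and> i < 3 \<and> x \<in> {1..n} \<and> y \<in> {1..n} \<and> z \<in> {1..n} \<and>
    y \<noteq> z \<and> real (card (Q c i)) \<le> (1 / 9 + \<gamma>) * real n ^ 2}"
  define Fam where "Fam = (\<lambda>(c, i, x, y, z). {H \<in> Forb n F5. {y, z, x} \<in> H \<and>
    real (card (link H y - Q c i)) \<le> k \<and> real (card (link H z - Q c i)) \<le> k})"
  have JJ: "J \<subseteq> colourings n \<times> {..<3} \<times> {1..n} \<times> {1..n} \<times> {1..n}" by (auto simp: J_def)
  then have fJ: "finite J" by (rule finite_subset) simp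
  have "card J \<le> card (colourings n \<times> {..<3::nat} \<times> {1..n} \<times> {1..n} \<times> {1..n})"
    using JJ by (intro card_mono) auto
  then have "real (card J) \<le> real (card (colourings n \<times> {..<3::nat} \<times> {1..n} \<times> {1..n} \<times> {1..n}))"
    by (simp only: of_nat_le_iff)
  then have cJ: "real (card J) \<le> 3 ^ n * 3 * real n ^ 3"
    by (simp add: card_cartesian_product power3_eq_cube mult_ac)
  have fForb: "finite (Forb n F5)" by (rule finite_subset[of _ "Pow (triples n)"]) (auto simp: Forb_eq)
  have "?B \<subseteq> (\<Union>j\<in>J. Fam j)"
  proof
    fix H assume "H \<in> ?B"
    then have H: "H \<in> Forb n F5" "H \<subseteq> triples n" "typical n \<gamma> \<xi> H" "\<not> tripartite {1..n} H" by (auto simp: Forb_eq)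
    then obtain c where c: "c \<in> colourings n" and near: "\<forall>y. \<exists>i<3. real (card (link H y - Q c i)) \<le> k"
      and bal: "\<forall>i<3. real (card (Q c i)) \<le> (1 / 9 + \<gamma>) * real n ^ 2"
      unfolding typical_def Q_def k_def by blast
    \<comment> \<open>The recolouring: \<open>w y\<close> is an index whose crossing pairs nearly
      contain the link of \<open>y\<close>. Were all triples crossing for \<open>w\<close>, the
      system would be tripartite; so some edge has two vertices of equal new colour, whose links lie
      near the same crossing set.\<close>
    obtain w where w: "\<And>y. w y < 3" "\<And>y. real (card (link H y - Q c (w y))) \<le> k"
      using near by metis
    have "\<not> H \<subseteq> crossing n (restrict w {1..n})"
    proof
      assume "H \<subseteq> crossing n (restrict w {1..n})"
      then have "\<exists>c\<in>colourings n. H \<subseteq> crossing n c" by (rule bexI[OF _ restrict_colouring(1)[OF w(1)]])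
      then show False using H(4) unfolding tripartite_iff[OF H(2)] by simp
    qed
    then obtain e where e: "e \<in> H" "\<not> inj_on w e"
      unfolding restrict_colouring(2)[OF w(1)] using H(2) by blast
    then obtain y z where yz: "y \<in> e" "z \<in> e" "y \<noteq> z" "w y = w z" by (auto simp: inj_on_def)
    have e3: "card e = 3" "e \<subseteq> {1..n}" using e(1) H(2) by (auto simp: triples_def)
    have "card (e - {y, z}) = 1" using yz e3 by (simp add: card_Diff_subset)
    then obtain x where "e - {y, z} = {x}" by (rule card_1_singletonE)
    then have ee: "e = {y, z, x}" using yz by auto
    have "(c, w y, x, y, z) \<in> J" using c w(1) e3 yz bal unfolding J_def by (auto simp: ee)
    moreover have "H \<in> Fam (c, w y, x, y, z)"
      using H(1) e(1) w(2)[of y] w(2)[of z] yz(4) unfolding Fam_def by (simp add: ee)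
    ultimately show "H \<in> (\<Union>j\<in>J. Fam j)" by blast
  qed
  moreover have "finite (Fam j)" for j using fForb by (simp add: Fam_def split_def)
  ultimately have "card ?B \<le> card (\<Union>j\<in>J. Fam j)" using fJ by (intro card_mono) auto
  also have "\<dots> \<le> (\<Sum>j\<in>J. card (Fam j))" by (rule card_UN_le[OF fJ])
  finally have "real (card ?B) \<le> real (\<Sum>j\<in>J. card (Fam j))" by (simp only: of_nat_le_iff)
  also have "\<dots> = (\<Sum>j\<in>J. real (card (Fam j)))" by simp
  also have "\<dots> \<le> (\<Sum>j\<in>J. ?b)"
  proof (rule sum_mono)
    fix j assume "j \<in> J"
    then obtain c i x y z where j: "j = (c, i, x, y, z)" and yz: "y \<in> {1..n}" "z \<in> {1..n}" "y \<noteq> z"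
      and bal: "real (card (Q c i)) \<le> (1 / 9 + \<gamma>) * real n ^ 2"
      unfolding J_def by blast
    have QP: "Q c i \<subseteq> pairs n" by (auto simp: Q_def cross_pairs_def)
    have "card (Fam j) \<le> card (Forb (n - 2) F5) * card (link_pairs n (Q c i) k x)"
      unfolding Fam_def j prod.case by (rule card_close_links_le[OF yz])
    also have "\<dots> \<le> card (Forb (n - 2) F5) * (card (small_subsets (pairs n) k) ^ 2 * (4 ^ n * 3 ^ card (Q c i)))"
      by (intro mult_le_mono order_refl card_link_pairs_le[OF QP])
    finally have "real (card (Fam j)) \<le>
        real (card (Forb (n - 2) F5) * (card (small_subsets (pairs n) k) ^ 2 * (4 ^ n * 3 ^ card (Q c i))))"
      by (simp only: of_nat_le_iff)
    also have "\<dots> = real (card (Forb (n - 2) F5)) * (real (card (small_subsets (pairs n) k)) ^ 2 * (4 ^ n * 3 ^ card (Q c i)))"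
      by simp
    also have "(3::real) ^ card (Q c i) = 3 powr real (card (Q c i))" by (rule powr_realpow[symmetric]) simp
    also have "real (card (Forb (n - 2) F5)) * (real (card (small_subsets (pairs n) k)) ^ 2 * (4 ^ n * 3 powr real (card (Q c i)))) \<le> ?b"
      unfolding k_def using bal by (intro mult_left_mono powr_mono) auto
    finally show "real (card (Fam j)) \<le> ?b" .
  qed
  also have "\<dots> = real (card J) * ?b" by simp
  also have "\<dots> \<le> (3 ^ n * 3 * real n ^ 3) * ?b" using cJ by (rule mult_right_mono) simp
  finally show ?thesis .
qed

text \<open>The constant \<open>2 / 45\<close> of the theorem is \<open>2 / 9 - 8 / 45\<close>, where \<open>8 / 45\<close> bounds
  \<open>log 2 3 / 9\<close> because \<open>3 ^ 5 < 2 ^ 8\<close>.\<close>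
lemma log_2_3_less: "log 2 3 < (8 / 5 :: real)"
proof -
  have "5 * log 2 (3::real) = log 2 (3 ^ 5)" by (subst log_nat_power) auto
  also have "\<dots> < log 2 (2 ^ 8)" by (subst log_less_cancel_iff) auto
  also have "\<dots> = (8::real)" by (subst log_nat_power) auto
  finally show ?thesis by simp
qed

lemma few_typical_nontripartite:
  obtains \<gamma> \<xi> \<beta> :: real where "\<gamma> > 0" "\<xi> > 0" "\<beta> > 0"
    "\<forall>\<^sub>F n in sequentially. real (card {H \<in> Forb n F5. typical n \<gamma> \<xi> H \<and> \<not> tripartite {1..n} H})
      \<le> real (card (Forb (n - 2) F5)) * 2 powr ((8 / 45 - \<beta>) * real n ^ 2)"
proof -
  define \<mu> where "\<mu> = log 2 (3::real)"
  \<comment> \<open>The margin between \<open>8 / 45\<close> and \<open>log 2 3 / 9\<close>.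
    Imbalance of the classes, exceptional link pairs and linear terms in the exponent take at most
    \<open>b / 4\<close> each, and \<open>b / 4\<close> remains.\<close>
  define b where "b = (8 / 5 - \<mu>) / 9"
  have \<mu>: "0 \<le> \<mu>" "\<mu> \<le> 2" using log_2_3_less by (auto simp: \<mu>_def)
  have b: "b > 0" using log_2_3_less by (simp add: b_def \<mu>_def)
  then have "b / 8 > 0" by simp
  from card_small_subsets_le[OF this, where 'a = "nat set"]
  obtain \<xi> :: real where \<xi>: "\<xi> > 0" and small: "\<forall>(S :: nat set set) M. finite S \<longrightarrow> real (card S) \<le> M \<longrightarrow>
       real (card (small_subsets S (\<xi> * M))) \<le> 2 powr (b / 8 * M)"
    by blast
  have "\<forall>\<^sub>F n in sequentially. 7 * real n + 2 \<le> b / 4 * real n ^ 2" using b by real_asymp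
  then have "\<forall>\<^sub>F n in sequentially. real (card {H \<in> Forb n F5. typical n (b / 8) \<xi> H \<and> \<not> tripartite {1..n} H})
      \<le> real (card (Forb (n - 2) F5)) * 2 powr ((8 / 45 - b / 4) * real n ^ 2)"
  proof eventually_elim
    case (elim n)
    have two: "(2::real) ^ m = 2 powr real m" for m by (rule powr_realpow[symmetric]) simp
    have four: "(4::real) ^ n = 2 powr (2 * real n)"
    proof -
      have "(4::real) ^ n = (2 ^ 2) ^ n" by simp
      also have "\<dots> = 2 ^ (2 * n)" by (simp only: power_mult)
      also have "\<dots> = 2 powr real (2 * n)" by (rule two)
      finally show ?thesis by simp
    qed
    have "real n \<le> 2 ^ n" using of_nat_less_two_power[of n, where 'a = real] by linarith
    then have "real n ^ 3 \<le> (2 ^ n) ^ 3" by (intro power_mono) auto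
    also have "\<dots> = 2 ^ (n * 3)" by (simp only: power_mult)
    also have "\<dots> = 2 powr real (n * 3)" by (rule two)
    finally have n3: "real n ^ 3 \<le> 2 powr (3 * real n)" by (simp add: mult.commute)
    have "(3::real) ^ n \<le> 4 ^ n" by (intro power_mono) auto
    moreover have "(3::real) \<le> 2 powr 2" by simp
    ultimately have "3 ^ n * 3 * real n ^ 3 \<le> 2 powr (2 * real n) * 2 powr 2 * 2 powr (3 * real n)"
      using n3 unfolding four by (intro mult_mono) auto
    also have "\<dots> = 2 powr (5 * real n + 2)" unfolding powr_add[symmetric] by (simp add: algebra_simps)
    finally have p1: "3 ^ n * 3 * real n ^ 3 \<le> 2 powr (5 * real n + 2)" .
    have "real (card (small_subsets (pairs n) (\<xi> * real n ^ 2))) \<le> 2 powr (b / 8 * real n ^ 2)"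
      using small card_pairs_le by simp
    then have "real (card (small_subsets (pairs n) (\<xi> * real n ^ 2))) ^ 2 \<le> (2 powr (b / 8 * real n ^ 2)) ^ 2"
      by (intro power_mono) auto
    also have "\<dots> = 2 powr (b / 4 * real n ^ 2)"
      unfolding power2_eq_square[of "2 powr _"] powr_add[symmetric] by simp
    finally have p2: "real (card (small_subsets (pairs n) (\<xi> * real n ^ 2))) ^ 2 \<le> 2 powr (b / 4 * real n ^ 2)" .
    have "(3::real) = 2 powr \<mu>" by (simp add: \<mu>_def)
    then have "3 powr ((1 / 9 + b / 8) * real n ^ 2) = (2 powr \<mu>) powr ((1 / 9 + b / 8) * real n ^ 2)" by simp
    also have "\<dots> = 2 powr (\<mu> * ((1 / 9 + b / 8) * real n ^ 2))" by (rule powr_powr)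
    also have "\<dots> \<le> 2 powr ((8 / 45 - b + b / 4) * real n ^ 2)"
    proof (intro powr_mono)
      have "\<mu> * (1 / 9 + b / 8) = 8 / 45 - b + \<mu> * (b / 8)" by (simp add: b_def field_simps)
      also have "\<dots> \<le> 8 / 45 - b + 2 * (b / 8)" using \<mu> b by (intro add_left_mono mult_right_mono) auto
      finally have "\<mu> * (1 / 9 + b / 8) \<le> 8 / 45 - b + b / 4" by simp
      then have "\<mu> * (1 / 9 + b / 8) * real n ^ 2 \<le> (8 / 45 - b + b / 4) * real n ^ 2" by (rule mult_right_mono) simp
      then show "\<mu> * ((1 / 9 + b / 8) * real n ^ 2) \<le> (8 / 45 - b + b / 4) * real n ^ 2" by (simp only: mult.assoc)
    qed simp
    finally have p3: "3 powr ((1 / 9 + b / 8) * real n ^ 2) \<le> 2 powr ((8 / 45 - b + b / 4) * real n ^ 2)" .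
    define f where "f = real (card (Forb (n - 2) F5))"
    have "real (card {H \<in> Forb n F5. typical n (b / 8) \<xi> H \<and> \<not> tripartite {1..n} H})
      \<le> (3 ^ n * 3 * real n ^ 3) * (f * (real (card (small_subsets (pairs n) (\<xi> * real n ^ 2))) ^ 2 *
          (4 ^ n * 3 powr ((1 / 9 + b / 8) * real n ^ 2))))"
      unfolding f_def by (rule card_typical_nontripartite_le)
    also have "\<dots> \<le> 2 powr (5 * real n + 2) * (f * (2 powr (b / 4 * real n ^ 2) *
          (2 powr (2 * real n) * 2 powr ((8 / 45 - b + b / 4) * real n ^ 2))))"
      unfolding four by (intro mult_mono p1 p2 p3 order_refl) (auto simp: f_def)
    also have "\<dots> = f * (2 powr (5 * real n + 2) * (2 powr (b / 4 * real n ^ 2) *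
          (2 powr (2 * real n) * 2 powr ((8 / 45 - b + b / 4) * real n ^ 2))))" by (simp only: mult_ac)
    also have "\<dots> = f * 2 powr (5 * real n + 2 + (b / 4 * real n ^ 2 + (2 * real n + (8 / 45 - b + b / 4) * real n ^ 2)))"
      by (simp only: powr_add[symmetric])
    also have "\<dots> \<le> f * 2 powr ((8 / 45 - b / 4) * real n ^ 2)"
      using elim by (intro mult_left_mono powr_mono) (auto simp: f_def algebra_simps)
    finally show ?case by (simp add: f_def)
  qed
  then show ?thesis using that[of "b / 8" \<xi> "b / 4"] b \<xi> by simp
qed

section \<open>Induction in steps of two\<close>

definition non_tripartite_count :: "nat \<Rightarrow> nat" where
  "non_tripartite_count n = card {H \<in> Forb n F5. \<not> tripartite {1..n} H}"

lemma non_tripartite_recursion: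
  obtains \<delta> \<beta> :: real where "\<delta> > 0" "\<beta> > 0"
    "\<forall>\<^sub>F n in sequentially. real (non_tripartite_count n) \<le> 2 powr (real n ^ 3 / 27 - \<delta> * real n ^ 3) +
      real (card (Forb (n - 2) F5)) * 2 powr ((8 / 45 - \<beta>) * real n ^ 2)"
proof -
  have "\<exists>\<gamma> \<xi> \<beta>. \<gamma> > 0 \<and> \<xi> > 0 \<and> \<beta> > 0 \<and>
    (\<forall>\<^sub>F n in sequentially. real (card {H \<in> Forb n F5. typical n \<gamma> \<xi> H \<and> \<not> tripartite {1..n} H})
      \<le> real (card (Forb (n - 2) F5)) * 2 powr ((8 / 45 - \<beta>) * real n ^ 2))"
    by (rule few_typical_nontripartite) (intro exI conjI)
  then obtain \<gamma> \<xi> \<beta> :: real where p: "\<gamma> > 0" "\<xi> > 0" "\<beta> > 0" and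
    ev1: "\<forall>\<^sub>F n in sequentially. real (card {H \<in> Forb n F5. typical n \<gamma> \<xi> H \<and> \<not> tripartite {1..n} H})
      \<le> real (card (Forb (n - 2) F5)) * 2 powr ((8 / 45 - \<beta>) * real n ^ 2)"
    by blast
  obtain \<delta> where \<delta>: "\<delta> > 0" and ev2: "\<forall>\<^sub>F n in sequentially.
    real (card {H \<in> Forb n F5. \<not> typical n \<gamma> \<xi> H}) \<le> 2 powr (real n ^ 3 / 27 - \<delta> * real n ^ 3)"
    using few_atypical[OF p(1,2)] by blast
  have "\<forall>\<^sub>F n in sequentially. real (non_tripartite_count n) \<le> 2 powr (real n ^ 3 / 27 - \<delta> * real n ^ 3) +
      real (card (Forb (n - 2) F5)) * 2 powr ((8 / 45 - \<beta>) * real n ^ 2)"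
    using ev1 ev2
  proof eventually_elim
    case (elim n)
    let ?A = "{H \<in> Forb n F5. \<not> typical n \<gamma> \<xi> H}"
    let ?B = "{H \<in> Forb n F5. typical n \<gamma> \<xi> H \<and> \<not> tripartite {1..n} H}"
    have "finite (Forb n F5)" by (rule finite_subset[of _ "Pow (triples n)"]) (auto simp: Forb_eq)
    then have "non_tripartite_count n \<le> card (?A \<union> ?B)"
      unfolding non_tripartite_count_def by (intro card_mono) auto
    also have "\<dots> \<le> card ?A + card ?B" by (rule card_Un_le)
    finally show ?case using elim by linarith
  qed
  with \<delta> p(3) show ?thesis by (rule that)
qed

lemma non_tripartite_count_trivial: "real (non_tripartite_count n) \<le> 2 powr (real n ^ 3)"
proof -
  have "non_tripartite_count n \<le> card (Pow (triples n))"
    unfolding non_tripartite_count_def by (intro card_mono) (auto simp: Forb_eq)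
  then have "real (non_tripartite_count n) \<le> real (card (Pow (triples n)))" by (simp only: of_nat_le_iff)
  also have "\<dots> = 2 powr real (card (triples n))" by (simp add: card_Pow powr_realpow)
  also have "\<dots> \<le> 2 powr (real n ^ 3)" using card_triples_le by (intro powr_mono) auto
  finally show ?thesis .
qed

text \<open>From \<open>n - 2\<close> to \<open>n\<close> the term \<open>n ^ 3 / 27\<close> grows
  by \<open>2 / 9 * n ^ 2\<close> up to a linear term, whereas extending a system to a
  non-tripartite one costs less than \<open>8 / 45 * n ^ 2\<close>; the difference is
  \<open>2 / 45 * n ^ 2\<close>. The tripartite systems on \<open>n - 2\<close> vertices dominate
  the bound, since non-tripartite ones gain this amount a second time.\<close>

lemma non_tripartite_count_le:
  "\<exists>C\<ge>0. \<forall>n. real (non_tripartite_count n) \<le> 2 powr (real n ^ 3 / 27 - 2 * real n ^ 2 / 45 + C * real n)"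
proof -
  have "\<exists>\<delta> \<beta>. \<delta> > 0 \<and> \<beta> > 0 \<and>
    (\<forall>\<^sub>F n in sequentially. real (non_tripartite_count n) \<le> 2 powr (real n ^ 3 / 27 - \<delta> * real n ^ 3) +
      real (card (Forb (n - 2) F5)) * 2 powr ((8 / 45 - \<beta>) * real n ^ 2))"
    by (rule non_tripartite_recursion) (intro exI conjI)
  then obtain \<delta> \<beta> :: real where p: "\<delta> > 0" "\<beta> > 0" and
    ev: "\<forall>\<^sub>F n in sequentially. real (non_tripartite_count n) \<le> 2 powr (real n ^ 3 / 27 - \<delta> * real n ^ 3) +
      real (card (Forb (n - 2) F5)) * 2 powr ((8 / 45 - \<beta>) * real n ^ 2)"
    by blast
  have "\<forall>\<^sub>F n in sequentially. 2 * real n ^ 2 / 45 + 2 \<le> \<delta> * real n ^ 3" using p by real_asymp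
  moreover have "\<forall>\<^sub>F n in sequentially. 3 * real n + 2 \<le> \<beta> * real n ^ 2" using p by real_asymp
  ultimately have "\<forall>\<^sub>F n in sequentially. 2 * real n ^ 2 / 45 + 2 \<le> \<delta> * real n ^ 3 \<and> 3 * real n + 2 \<le> \<beta> * real n ^ 2 \<and>
     real (non_tripartite_count n) \<le> 2 powr (real n ^ 3 / 27 - \<delta> * real n ^ 3) +
      real (card (Forb (n - 2) F5)) * 2 powr ((8 / 45 - \<beta>) * real n ^ 2)"
    using ev by eventually_elim simp
  then obtain n0 where n0: "\<And>n. n \<ge> n0 \<Longrightarrow> 2 * real n ^ 2 / 45 + 2 \<le> \<delta> * real n ^ 3 \<and> 3 * real n + 2 \<le> \<beta> * real n ^ 2 \<and>
     real (non_tripartite_count n) \<le> 2 powr (real n ^ 3 / 27 - \<delta> * real n ^ 3) +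
      real (card (Forb (n - 2) F5)) * 2 powr ((8 / 45 - \<beta>) * real n ^ 2)"
    unfolding eventually_sequentially by blast
  \<comment> \<open>Below \<open>n0 + 2\<close> the trivial bound is enough: there
    \<open>n ^ 3\<close> is at most \<open>n * (n0 + 2) ^ 2\<close> and \<open>n ^ 2\<close> at most
    \<open>n * (n0 + 2)\<close>.\<close>
  define C where "C = real (n0 + 2) ^ 2 + real (n0 + 2)"
  have C: "C \<ge> 0" by (simp add: C_def)
  have "real (non_tripartite_count n) \<le> 2 powr (real n ^ 3 / 27 - 2 * real n ^ 2 / 45 + C * real n)" for n
  proof (induction n rule: less_induct)
    case (less n)
    show ?case
    proof (cases "n < n0 + 2")
      case True
      have "real n ^ 3 \<le> real n ^ 3 / 27 - 2 * real n ^ 2 / 45 + C * real n"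
      proof -
        define D where "D = real n * real (n0 + 2) ^ 2"
        define D' where "D' = real n * real (n0 + 2)"
        have "real n * real n ^ 2 \<le> D"
          unfolding D_def using True by (intro mult_left_mono power_mono) auto
        then have "real n ^ 3 \<le> D" by (simp add: power2_eq_square power3_eq_cube)
        moreover have "real n * real n \<le> D'" unfolding D'_def using True by (intro mult_left_mono) auto
        then have "real n ^ 2 \<le> D'" by (simp add: power2_eq_square)
        moreover have "C * real n = D + D'"
          unfolding C_def D_def D'_def by (rule trans[OF mult.commute distrib_left])
        moreover have "0 \<le> real n ^ 3" "0 \<le> real n ^ 2" by simp_all
        ultimately show ?thesis by linarith
      qed
      then have "2 powr (real n ^ 3) \<le> 2 powr (real n ^ 3 / 27 - 2 * real n ^ 2 / 45 + C * real n)"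
        by (intro powr_mono) auto
      then show ?thesis using non_tripartite_count_trivial[of n] by linarith
    next
      case False
      \<comment> \<open>The shift of the threshold by 2 makes this a genuine difference.\<close>
      define m where "m = n - 2"
      have nm: "real n = real m + 2" "m < n" using False by (auto simp: m_def)
      define E where "E = real n ^ 3 / 27 - 2 * real n ^ 2 / 45 + C * real n"
      have b1: "2 * real n ^ 2 / 45 + 2 \<le> \<delta> * real n ^ 3" and b2: "3 * real n + 2 \<le> \<beta> * real n ^ 2"
        and rec: "real (non_tripartite_count n) \<le> 2 powr (real n ^ 3 / 27 - \<delta> * real n ^ 3) +
          real (card (Forb m F5)) * 2 powr ((8 / 45 - \<beta>) * real n ^ 2)"
        using n0[of n] False by (auto simp: m_def)
      \<comment> \<open>Three terms remain (atypical systems, tripartite rest, non-tripartite rest),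
        so a quarter of the target for each is enough.\<close>
      have quarter: "2 powr x \<le> 2 powr E / 4" if "x \<le> E - 2" for x
      proof -
        have "2 powr x \<le> 2 powr (E - 2)" using that by (intro powr_mono) auto
        then show ?thesis by (simp add: powr_diff)
      qed
      have Cn: "0 \<le> C * real n" using C by simp
      have m3: "real m ^ 3 / 27 \<le> real n ^ 3 / 27 - 2 / 9 * real n ^ 2 + real n / 2"
        by (simp add: nm(1) power2_eq_square power3_eq_cube field_simps)
      have "real (card (Forb m F5)) = real (T m) + real (non_tripartite_count m)"
        unfolding card_Forb_split(1)[of m] non_tripartite_count_def by simp
      also have "\<dots> \<le> 2 powr (real m ^ 3 / 27 + 2 * real m) + 2 powr (real m ^ 3 / 27 - 2 * real m ^ 2 / 45 + C * real m)"
        by (intro add_mono T_le less.IH nm(2))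
      finally have "real (card (Forb m F5)) * 2 powr ((8 / 45 - \<beta>) * real n ^ 2) \<le>
          (2 powr (real m ^ 3 / 27 + 2 * real m) + 2 powr (real m ^ 3 / 27 - 2 * real m ^ 2 / 45 + C * real m)) *
          2 powr ((8 / 45 - \<beta>) * real n ^ 2)"
        by (rule mult_right_mono) simp
      also have "\<dots> = 2 powr (real m ^ 3 / 27 + 2 * real m + (8 / 45 - \<beta>) * real n ^ 2) +
          2 powr (real m ^ 3 / 27 - 2 * real m ^ 2 / 45 + C * real m + (8 / 45 - \<beta>) * real n ^ 2)"
        by (simp only: distrib_right powr_add)
      also have "\<dots> \<le> 2 powr E / 4 + 2 powr E / 4"
      proof (intro add_mono quarter)
        \<comment> \<open>For a tripartite rest the quadratic terms match exactly, and
          \<open>\<beta> * n ^ 2\<close> absorbs the linear ones.\<close>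
        have "real m \<le> real n" "0 \<le> real n" using nm by auto
        then show "real m ^ 3 / 27 + 2 * real m + (8 / 45 - \<beta>) * real n ^ 2 \<le> E - 2"
          using m3 b2 Cn unfolding E_def by (simp add: algebra_simps)
        have "C * real m \<le> C * real n" using C nm by (intro mult_left_mono) auto
        moreover have "2 * real n ^ 2 / 45 \<le> 2 * real m ^ 2 / 45 + real n"
          by (simp add: nm(1) power2_eq_square algebra_simps)
        moreover have "(8 / 45 - \<beta>) * real n ^ 2 = 8 / 45 * real n ^ 2 - \<beta> * real n ^ 2"
          by (rule left_diff_distrib)
        moreover have "0 \<le> real m ^ 2" "0 \<le> real n" by simp_all
        ultimately show "real m ^ 3 / 27 - 2 * real m ^ 2 / 45 + C * real m + (8 / 45 - \<beta>) * real n ^ 2 \<le> E - 2"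
          using m3 b2 unfolding E_def by linarith
      qed
      finally have "real (non_tripartite_count n) \<le> 2 powr E / 4 + (2 powr E / 4 + 2 powr E / 4)"
        using rec quarter[of "real n ^ 3 / 27 - \<delta> * real n ^ 3"] b1 Cn unfolding E_def by linarith
      also have "\<dots> \<le> 2 powr E" by simp
      finally show ?thesis by (simp add: E_def)
    qed
  qed
  then show ?thesis using C by blast
qed

theorem theorem1:
  shows "(\<exists>C::real. \<forall>n::nat. n \<ge> 1 \<longrightarrow>
            real (card (Forb n F5))
              < (1 + 2 powr (C * real n - 2 * (real n)\<^sup>2 / 45)) * real (T n))
       \<and> (\<lambda>n. real (card {H \<in> Forb n F5. tripartite {1..n} H}) / real (card (Forb n F5)))
            \<longlonglongrightarrow> 1"
proof -
  obtain C0 where C0: "C0 \<ge> 0"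
    "\<And>n. real (non_tripartite_count n) \<le> 2 powr (real n ^ 3 / 27 - 2 * real n ^ 2 / 45 + C0 * real n)"
    using non_tripartite_count_le by blast
  \<comment> \<open>One \<open>n\<close> makes up for the loss in the lower bound on
    \<open>T n\<close>, the other makes the inequality strict for positive \<open>n\<close>.\<close>
  define C where "C = C0 + 2"
  have Tpos: "0 < real (T n)" for n using T_ge[of n] by (rule less_le_trans[rotated]) simp
  have main: "real (card (Forb n F5)) < (1 + 2 powr (C * real n - 2 * (real n)\<^sup>2 / 45)) * real (T n)" if "n \<ge> 1" for n
  proof -
    have "real (non_tripartite_count n) \<le> 2 powr (real n ^ 3 / 27 - 2 * real n ^ 2 / 45 + C0 * real n)" by (rule C0(2))
    also have "\<dots> < 2 powr ((C * real n - 2 * (real n)\<^sup>2 / 45) + (real n ^ 3 / 27 - real n))"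
      using that by (simp add: C_def algebra_simps)
    also have "\<dots> = 2 powr (C * real n - 2 * (real n)\<^sup>2 / 45) * 2 powr (real n ^ 3 / 27 - real n)"
      by (rule powr_add)
    also have "\<dots> \<le> 2 powr (C * real n - 2 * (real n)\<^sup>2 / 45) * real (T n)"
      using T_ge by (intro mult_left_mono) auto
    finally show ?thesis
      unfolding card_Forb_split(1) non_tripartite_count_def[symmetric] by (simp add: distrib_right)
  qed
  have "(\<lambda>n. real (card {H \<in> Forb n F5. tripartite {1..n} H}) / real (card (Forb n F5))) \<longlonglongrightarrow> 1"
  \<comment> \<open>The ratio is \<open>T n / card (Forb n F5)\<close>, bounded below by the
    reciprocal of the factor in \<open>main\<close>. The exponent there tends to minus infinity for
    every \<open>C\<close>.\<close>
  proof (rule tendsto_sandwich)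
    have eq: "real (card {H \<in> Forb n F5. tripartite {1..n} H}) = real (T n)" for n
      by (simp only: card_Forb_split(2) T_def)
    have Fpos: "real (T n) \<le> real (card (Forb n F5))" for n unfolding card_Forb_split(1) by simp
    show "\<forall>\<^sub>F n in sequentially. 1 / (1 + 2 powr (C * real n - 2 * (real n)\<^sup>2 / 45))
        \<le> real (card {H \<in> Forb n F5. tripartite {1..n} H}) / real (card (Forb n F5))"
      using eventually_ge_at_top[of 1]
    proof eventually_elim
      case (elim n)
      have "1 + 2 powr (C * real n - 2 * (real n)\<^sup>2 / 45) > 0" by (simp add: add_pos_pos)
      moreover have "0 < real (card (Forb n F5))" using Fpos[of n] Tpos[of n] by linarith
      ultimately show ?case unfolding eq
        using main[OF elim] by (simp add: divide_simps mult_ac)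
    qed
    show "\<forall>\<^sub>F n in sequentially.
        real (card {H \<in> Forb n F5. tripartite {1..n} H}) / real (card (Forb n F5)) \<le> 1"
      unfolding eq using Fpos by (intro always_eventually allI divide_le_eq_1[THEN iffD2]) (use Fpos Tpos in \<open>auto intro: less_le_trans\<close>)
    show "(\<lambda>n. 1 / (1 + 2 powr (C * real n - 2 * (real n)\<^sup>2 / 45))) \<longlonglongrightarrow> 1"
      by real_asymp
  qed simp
  then show ?thesis using main by blast
qed

end
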